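(* Let $\textsc{crSDS}$ be any procedure that, given a $2$-connected graph $K$ and a colouring $g\colon V(K)\to\{1,0,\hat0\}$, returns a minimum-size $g$-respecting simultaneous dominating set of $K$ together with its size. Consider the following algorithm on input a connected graph $G$ and colouring $f\colon V(G)\to\{1,0,\hat0\}$: set $S=\emptyset$; while $G$ is not $2$-connected, choose a block $B$ of $G$ containing exactly one cut vertex $v$ of $G$, let $c^\star=f(v)$, and for each $c\in\{1,0,\hat0\}$ compute $(S_c,\#_c)=\textsc{crSDS}(B,g_c)$ where $g_c$ is $f$ restricted to $V(B)$ with $v$ recoloured $c$; then (with $f(v)=c^\star$ still) if $\#_1=\#_{\hat0}=\#_0$ set $f(v)=1$ and $S=S\cup S_1$; else if $\#_1>\#_{\hat0}=\#_0$ set $f(v)=\mathrm{best}\{c^\star,0\}$ and $S=S\cup S_{\hat0}$; else set $S=S\cup S_0$ (leaving $f(v)$ unchanged); then replace $G$ by $G-(V(B)\setminus\{v\})$ (with $f$ restricted accordingly). When the loop ends, compute $(S_G,\#)=\textsc{crSDS}(G,f)$ and return $S\cup S_G$. Then this algorithm returns a minimum-size $f$-respecting simultaneous dominating set of the input graph $G$. Moreover, if $\textsc{crSDS}$ runs in polynomial time, then the algorithm can be implemented to run in polynomial time.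
   Context: All graphs are finite, simple and undirected. A cut vertex of $G$ is a vertex whose removal increases the number of connected components; a graph without cut vertex is $2$-connected; a block is a maximal $2$-connected subgraph. For a connected graph $G$ and $S\subseteq V(G)$, a vertex $w$ is simultaneously dominated by $S$ if in every spanning tree $T$ of $G$, $w\in S$ or $w$ has a neighbour in $T$ belonging to $S$. For a colouring $f\colon V(G)\to\{1,0,\hat 0\}$, a set $S\subseteq V(G)$ is an $f$-respecting simultaneous dominating set of $G$ if $f^{-1}(1)\subseteq S$ and every vertex of $f^{-1}(\hat 0)$ is simultaneously dominated by $S$. Colours are ordered $1$ better than $0$ better than $\hat 0$, and $\mathrm{best}\{\cdot\}$ denotes the best colour of a set of colours. *)

theory Defs
  imports "HOL-Library.FuncSet" "HOL-Computational_Algebra.Polynomial"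
begin

section \<open>Finite simple graphs\<close>

record 'v ugraph =
  verts :: "'v set"
  edges :: "'v set set"

definition ugraph :: "'v ugraph \<Rightarrow> bool" where
  "ugraph G \<longleftrightarrow> finite (verts G) \<and> (\<forall>e\<in>edges G. e \<subseteq> verts G \<and> card e = 2)"

definition adj :: "'v ugraph \<Rightarrow> 'v \<Rightarrow> 'v \<Rightarrow> bool" where
  "adj G u v \<longleftrightarrow> {u, v} \<in> edges G"

definition subgraph :: "'v ugraph \<Rightarrow> 'v ugraph \<Rightarrow> bool" where
  "subgraph H G \<longleftrightarrow> ugraph H \<and> verts H \<subseteq> verts G \<and> edges H \<subseteq> edges G"

definition remove_verts :: "'v ugraph \<Rightarrow> 'v set \<Rightarrow> 'v ugraph" where
  "remove_verts G X = \<lparr>verts = verts G - X, edges = {e \<in> edges G. e \<inter> X = {}}\<rparr>"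

definition conn_components :: "'v ugraph \<Rightarrow> 'v set set" where
  "conn_components G = (\<lambda>v. {w \<in> verts G. (adj G)\<^sup>*\<^sup>* v w}) ` verts G"

definition connected_graph :: "'v ugraph \<Rightarrow> bool" where
  "connected_graph G \<longleftrightarrow> verts G \<noteq> {} \<and> (\<forall>u\<in>verts G. \<forall>v\<in>verts G. (adj G)\<^sup>*\<^sup>* u v)"

definition cut_vertex :: "'v ugraph \<Rightarrow> 'v \<Rightarrow> bool" where
  "cut_vertex G v \<longleftrightarrow> v \<in> verts G \<and>
     card (conn_components (remove_verts G {v})) > card (conn_components G)"

text \<open>Connectedness is part of 2-connectedness; otherwise the maximal 2-connected subgraphs
  would not be the usual blocks. The graphs with one vertex or with a single edge on two
  vertices are 2-connected in this sense.\<close>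

definition two_connected :: "'v ugraph \<Rightarrow> bool" where
  "two_connected G \<longleftrightarrow> connected_graph G \<and> (\<nexists>v. cut_vertex G v)"

definition block :: "'v ugraph \<Rightarrow> 'v ugraph \<Rightarrow> bool" where
  "block B G \<longleftrightarrow> subgraph B G \<and> two_connected B \<and>
     (\<forall>H. subgraph H G \<and> two_connected H \<and> subgraph B H \<longrightarrow> H = B)"

definition graph_cycle :: "'v ugraph \<Rightarrow> 'v list \<Rightarrow> bool" where
  "graph_cycle G c \<longleftrightarrow> 3 \<le> length c \<and> distinct c \<and>
     (\<forall>i<length c. adj G (c ! i) (c ! (Suc i mod length c)))"

definition spanning_tree :: "'v ugraph \<Rightarrow> 'v ugraph \<Rightarrow> bool" where
  "spanning_tree T G \<longleftrightarrow> subgraph T G \<and> verts T = verts G \<and>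
     connected_graph T \<and> (\<nexists>c. graph_cycle T c)"


section \<open>Colour-respecting simultaneous domination\<close>

datatype colour = One | Zero | HatZero

type_synonym 'v colouring = "'v \<Rightarrow> colour"

text \<open>Colourings of a graph are extensional functions on its vertex set, so that they carry
  no information about other vertices.\<close>

abbreviation colourings :: "'v ugraph \<Rightarrow> 'v colouring set" where
  "colourings G \<equiv> verts G \<rightarrow>\<^sub>E UNIV"

primrec goodness :: "colour \<Rightarrow> nat" where
  "goodness HatZero = 0"
| "goodness Zero = 1"
| "goodness One = 2"

definition best :: "colour set \<Rightarrow> colour" where
  "best C = arg_max goodness (\<lambda>c. c \<in> C)"

definition sim_dominated :: "'v ugraph \<Rightarrow> 'v set \<Rightarrow> 'v \<Rightarrow> bool" where
  "sim_dominated G S w \<longleftrightarrow> (\<forall>T. spanning_tree T G \<longrightarrow> w \<in> S \<or> (\<exists>u\<in>S. adj T w u))"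

definition respecting_sds :: "'v ugraph \<Rightarrow> 'v colouring \<Rightarrow> 'v set \<Rightarrow> bool" where
  "respecting_sds G f S \<longleftrightarrow> S \<subseteq> verts G \<and>
     (\<forall>v\<in>verts G. f v = One \<longrightarrow> v \<in> S) \<and>
     (\<forall>v\<in>verts G. f v = HatZero \<longrightarrow> sim_dominated G S v)"

definition minimum_respecting_sds :: "'v ugraph \<Rightarrow> 'v colouring \<Rightarrow> 'v set \<Rightarrow> bool" where
  "minimum_respecting_sds G f S \<longleftrightarrow> respecting_sds G f S \<and>
     (\<forall>S'. respecting_sds G f S' \<longrightarrow> card S \<le> card S')"


section \<open>The algorithm\<close>

text \<open>A procedure is given by the relation between inputs and the results it may return.
  Deterministic procedures are the single-valued relations; a program whose result depends
  on the order in which vertices and edges are listed is covered as well.\<close>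

type_synonym 'v procedure = "'v ugraph \<Rightarrow> 'v colouring \<Rightarrow> 'v set \<times> nat \<Rightarrow> bool"

definition crsds_procedure :: "'v procedure \<Rightarrow> bool" where
  "crsds_procedure crSDS \<longleftrightarrow>
     (\<forall>K g. ugraph K \<and> two_connected K \<and> g \<in> colourings K \<longrightarrow>
        (\<exists>r. crSDS K g r) \<and>
        (\<forall>S n. crSDS K g (S, n) \<longrightarrow> minimum_respecting_sds K g S \<and> n = card S))"

text \<open>A configuration is either the state of the variables at the head of the loop or the
  returned set. The choice of the block makes the step relation nondeterministic.\<close>

datatype 'v config = Loop "'v ugraph" "'v colouring" "'v set" | Return "'v set"

inductive step :: "'v procedure \<Rightarrow> 'v config \<Rightarrow> 'v config \<Rightarrow> bool"
  for crSDS :: "'v procedure" where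
  iterate:
  "\<lbrakk> \<not> two_connected G;
     block B G;
     {u \<in> verts B. cut_vertex G u} = {v};
     \<forall>c. crSDS B ((restrict f (verts B))(v := c)) (Sc c, num c);
     (c', D) =
       (if num One = num HatZero \<and> num HatZero = num Zero then (One, Sc One)
        else if num One > num HatZero \<and> num HatZero = num Zero
          then (best {f v, Zero}, Sc HatZero)
        else (f v, Sc Zero));
     G' = remove_verts G (verts B - {v}) \<rbrakk>
   \<Longrightarrow> step crSDS (Loop G f S) (Loop G' (restrict (f(v := c')) (verts G')) (S \<union> D))"
| finish:
  "\<lbrakk> two_connected G; crSDS G f (S\<^sub>G, n) \<rbrakk>
   \<Longrightarrow> step crSDS (Loop G f S) (Return (S \<union> S\<^sub>G))"


section \<open>Polynomial time\<close>

text \<open>The model of computation is a combinator form of the WHILE language over binary trees: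
  a program maps a tree to a tree, \<open>Leaf\<close> acts as false, and every execution of a
  construct costs one plus the size of the tree it is applied to. Since the cost bounds the
  size of all trees occurring in a computation, running times are polynomially related to
  those of Turing machines.\<close>

datatype data = Leaf | Node data data

datatype prog =
    Ident
  | Empty
  | First
  | Second
  | Equal
  | Tuple prog prog
  | Comp prog prog  \<comment> \<open>left to right\<close>
  | Cond prog prog prog
  | While prog prog

inductive exec :: "prog \<Rightarrow> data \<Rightarrow> data \<Rightarrow> nat \<Rightarrow> bool" where
  "exec Ident x x (Suc (size x))"
| "exec Empty x Leaf (Suc (size x))"
| "exec First (Node a b) a (Suc (size (Node a b)))"
| "exec First Leaf Leaf (Suc (size Leaf))"
| "exec Second (Node a b) b (Suc (size (Node a b)))"
| "exec Second Leaf Leaf (Suc (size Leaf))"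
| "exec Equal (Node a b) (if a = b then Node Leaf Leaf else Leaf) (Suc (size (Node a b)))"
| "exec Equal Leaf Leaf (Suc (size Leaf))"
| "\<lbrakk> exec p x a s; exec q x b t \<rbrakk>
   \<Longrightarrow> exec (Tuple p q) x (Node a b) (Suc (size x) + s + t)"
| "\<lbrakk> exec p x y s; exec q y z t \<rbrakk>
   \<Longrightarrow> exec (Comp p q) x z (Suc (size x) + s + t)"
| "\<lbrakk> exec p x b s; b \<noteq> Leaf; exec q x y t \<rbrakk>
   \<Longrightarrow> exec (Cond p q r) x y (Suc (size x) + s + t)"
| "\<lbrakk> exec p x Leaf s; exec r x y t \<rbrakk>
   \<Longrightarrow> exec (Cond p q r) x y (Suc (size x) + s + t)"
| "exec p x Leaf s
   \<Longrightarrow> exec (While p q) x x (Suc (size x) + s)"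
| "\<lbrakk> exec p x b s; b \<noteq> Leaf; exec q x y t; exec (While p q) y z u \<rbrakk>
   \<Longrightarrow> exec (While p q) x z (Suc (size x) + s + t + u)"

primrec enc_list :: "data list \<Rightarrow> data" where
  "enc_list [] = Leaf"
| "enc_list (x # xs) = Node x (enc_list xs)"

primrec enc_colour :: "colour \<Rightarrow> data" where
  "enc_colour One = Node Leaf Leaf"
| "enc_colour Zero = Leaf"
| "enc_colour HatZero = Node Leaf (Node Leaf Leaf)"

text \<open>Unary numerals suffice, since the only numbers involved are sizes of vertex sets.\<close>

definition enc_nat :: "nat \<Rightarrow> data" where
  "enc_nat n = enc_list (replicate n Leaf)"

text \<open>The parameter \<open>\<nu>\<close> names the vertices by trees. Finite sets are encoded by
  duplicate-free lists in any order, and edges by pairs in either orientation.\<close>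

definition encodes_set :: "('v \<Rightarrow> data) \<Rightarrow> data \<Rightarrow> 'v set \<Rightarrow> bool" where
  "encodes_set \<nu> x A \<longleftrightarrow> (\<exists>vs. distinct vs \<and> set vs = A \<and> x = enc_list (map \<nu> vs))"

definition encodes_instance ::
    "('v \<Rightarrow> data) \<Rightarrow> data \<Rightarrow> 'v ugraph \<Rightarrow> 'v colouring \<Rightarrow> bool" where
  "encodes_instance \<nu> x G f \<longleftrightarrow>
     (\<exists>vs es. distinct vs \<and> set vs = verts G \<and>
        distinct (map (\<lambda>(u, w). {u, w}) es) \<and> set (map (\<lambda>(u, w). {u, w}) es) = edges G \<and>
        x = Node (enc_list (map (\<lambda>v. Node (\<nu> v) (enc_colour (f v))) vs))
                 (enc_list (map (\<lambda>(u, w). Node (\<nu> u) (\<nu> w)) es)))"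

definition procedure_poly_time :: "('v \<Rightarrow> data) \<Rightarrow> 'v procedure \<Rightarrow> bool" where
  "procedure_poly_time \<nu> crSDS \<longleftrightarrow>
     (\<exists>p. \<exists>q :: nat poly. \<forall>K g x.
        ugraph K \<and> two_connected K \<and> g \<in> colourings K \<and> encodes_instance \<nu> x K g \<longrightarrow>
        (\<exists>y S n t. exec p x (Node y (enc_nat n)) t \<and> t \<le> poly q (size x) \<and>
           encodes_set \<nu> y S \<and> crSDS K g (S, n)))"

definition algorithm_poly_time :: "('v \<Rightarrow> data) \<Rightarrow> 'v procedure \<Rightarrow> bool" where
  "algorithm_poly_time \<nu> crSDS \<longleftrightarrow>
     (\<exists>p. \<exists>q :: nat poly. \<forall>G f x.
        ugraph G \<and> connected_graph G \<and> f \<in> colourings G \<and> encodes_instance \<nu> x G f \<longrightarrow>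
        (\<exists>y R t. exec p x y t \<and> t \<le> poly q (size x) \<and>
           encodes_set \<nu> y R \<and> (step crSDS)\<^sup>*\<^sup>* (Loop G f {}) (Return R)))"

end

theory Submission
  imports Defs
begin

text \<open>Let \<open>B\<close> be the chosen block, \<open>v\<close> its cut vertex and \<open>G'\<close> the graph that remains.
  All edges leaving \<open>B - v\<close> stay in \<open>B\<close>, so the spanning trees of \<open>G\<close> are exactly the unions of a
  spanning tree of \<open>B\<close> and one of \<open>G'\<close>. Hence a vertex other than \<open>v\<close> is simultaneously dominated in
  \<open>G\<close> iff it is so in its own part, and \<open>v\<close> iff it is so in one of the two parts. Since adding
  \<open>v\<close> turns a solution for the colour \<open>Zero\<close> into one for \<open>One\<close>, the three optima for \<open>B\<close> differ by at
  most one, and each of the three possible patterns tells which solution for \<open>B\<close> can be fixed without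
  loss and what it does for \<open>v\<close>.

  For the running time, a leaf block is found by computing, for every pair of vertices \<open>v\<close> and \<open>w\<close>, the
  component of \<open>w\<close> in \<open>G - v\<close>: if \<open>v\<close> is a cut vertex and this component contains none, the component
  together with \<open>v\<close> induces a leaf block, and a minimal component has this property.\<close>

section \<open>Reachability, cut vertices and spanning trees\<close>

text \<open>In the graph theory, lists of vertices occur only where \<open>graph_cycle\<close> is
  traded for bridges. Connectivity is reachability along \<open>adj\<close>, a tree is a connected
  graph in which every edge is a bridge, and a walk is rerouted by a retraction that folds one side
  of the graph onto a single vertex. The same device shows that two trees sharing one vertex form a
  tree, that a component together with its cut vertex is two-connected, and that an ear of a block
  can be shrunk.

  For the running time no program is written down explicitly for the algorithm; polynomial-time
  functions on trees are closed under composition, pairing, tests, folds and loops with bounded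
  iterates. Two obstacles shape this calculus. \<open>crSDS\<close> is trusted only on encodings of
  two-connected graphs, hence the domains. Iterating a polynomial-time function can make trees
  explode, hence a size bound for every intermediate state in terms of the original input, not of
  the previous state.\<close>

definition induce :: "'v ugraph \<Rightarrow> 'v set \<Rightarrow> 'v ugraph" where
  "induce G X = \<lparr>verts = X, edges = {e \<in> edges G. e \<subseteq> X}\<rparr>"

lemma verts_induce [simp]: "verts (induce G X) = X"
  by (simp add: induce_def)

lemma adj_induce [simp]: "adj (induce G X) a b \<longleftrightarrow> adj G a b \<and> a \<in> X \<and> b \<in> X"
  by (auto simp: induce_def adj_def)

lemma verts_remove_verts [simp]: "verts (remove_verts G X) = verts G - X"
  by (simp add: remove_verts_def)

lemma adj_remove_verts [simp]: "adj (remove_verts G X) a b \<longleftrightarrow> adj G a b \<and> a \<notin> X \<and> b \<notin> X"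
  by (auto simp: remove_verts_def adj_def)

lemma ugraph_induce: "ugraph G \<Longrightarrow> X \<subseteq> verts G \<Longrightarrow> ugraph (induce G X)"
  by (auto simp: ugraph_def induce_def intro: finite_subset)

lemma ugraph_remove_verts: "ugraph G \<Longrightarrow> ugraph (remove_verts G X)"
  by (auto simp: ugraph_def remove_verts_def)

lemma subgraph_induce: "ugraph G \<Longrightarrow> X \<subseteq> verts G \<Longrightarrow> subgraph (induce G X) G"
  using ugraph_induce by (auto simp: subgraph_def induce_def)

lemma adj_sym: "adj G a b \<Longrightarrow> adj G b a"
  by (simp add: adj_def insert_commute)

lemma adj_verts: "ugraph G \<Longrightarrow> adj G a b \<Longrightarrow> a \<in> verts G \<and> b \<in> verts G"
  by (auto simp: ugraph_def adj_def)

lemma adj_neq: "ugraph G \<Longrightarrow> adj G a b \<Longrightarrow> a \<noteq> b"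
  by (auto simp: ugraph_def adj_def)

lemma reach_sym: "(adj G)\<^sup>*\<^sup>* x y \<Longrightarrow> (adj G)\<^sup>*\<^sup>* y x"
  by (induction rule: rtranclp_induct) (auto intro: converse_rtranclp_into_rtranclp adj_sym)

text \<open>A map that sends every edge to an edge or contracts it carries walks to walks. It is
  applied to retractions, where the contracted edges are those of the side that is folded
  away.\<close>

lemma reach_map:
  assumes "(adj G)\<^sup>*\<^sup>* x y"
    and "\<And>a b. adj G a b \<Longrightarrow> \<rho> a = \<rho> b \<or> adj H (\<rho> a) (\<rho> b)"
  shows "(adj H)\<^sup>*\<^sup>* (\<rho> x) (\<rho> y)"
  using assms(1)
proof (induction rule: rtranclp_induct)
  case (step y z)
  then show ?case using assms(2)[OF step(2)] by (auto intro: rtranclp.rtrancl_into_rtrancl)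
qed simp

lemma reach_mono:
  "(adj G)\<^sup>*\<^sup>* x y \<Longrightarrow> (\<And>a b. adj G a b \<Longrightarrow> adj H a b) \<Longrightarrow> (adj H)\<^sup>*\<^sup>* x y"
  using reach_map[of G x y "\<lambda>x. x" H] by blast

lemma reach_closed:
  assumes "(adj G)\<^sup>*\<^sup>* x y" "x \<in> X" "\<And>a b. a \<in> X \<Longrightarrow> adj G a b \<Longrightarrow> b \<in> X"
  shows "y \<in> X"
  using assms by (induction rule: rtranclp_induct) auto

lemma connected_via:
  assumes "verts G \<noteq> {}" "\<And>x. x \<in> verts G \<Longrightarrow> (adj G)\<^sup>*\<^sup>* x r"
  shows "connected_graph G"
  unfolding connected_graph_def using assms by (meson reach_sym rtranclp_trans)

lemma conn_components_eq_iff: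
  assumes "x \<in> verts G"
  shows "{w \<in> verts G. (adj G)\<^sup>*\<^sup>* x w} = {w \<in> verts G. (adj G)\<^sup>*\<^sup>* y w} \<longleftrightarrow> (adj G)\<^sup>*\<^sup>* x y"
proof
  show "(adj G)\<^sup>*\<^sup>* x y" if "{w \<in> verts G. (adj G)\<^sup>*\<^sup>* x w} = {w \<in> verts G. (adj G)\<^sup>*\<^sup>* y w}"
  proof -
    have "x \<in> {w \<in> verts G. (adj G)\<^sup>*\<^sup>* x w}" using assms by simp
    then show ?thesis using that reach_sym by (metis (mono_tags, lifting) mem_Collect_eq)
  qed
  show "{w \<in> verts G. (adj G)\<^sup>*\<^sup>* x w} = {w \<in> verts G. (adj G)\<^sup>*\<^sup>* y w}" if "(adj G)\<^sup>*\<^sup>* x y"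
    using that by (metis (no_types, opaque_lifting) reach_sym rtranclp_trans)
qed

text \<open>A connected graph has one component, so an increase means two components of
  \<open>G - v\<close>, that is, two vertices that no longer reach each other. For a single vertex
  the count drops to zero and both sides are false.\<close>

lemma cut_vertex_iff:
  assumes "ugraph G" "connected_graph G"
  shows "cut_vertex G v \<longleftrightarrow> v \<in> verts G \<and>
    (\<exists>x\<in>verts G - {v}. \<exists>y\<in>verts G - {v}. \<not> (adj (remove_verts G {v}))\<^sup>*\<^sup>* x y)"
proof -
  let ?H = "remove_verts G {v}"
  let ?K = "\<lambda>x. {w \<in> verts ?H. (adj ?H)\<^sup>*\<^sup>* x w}"
  have "conn_components G = {verts G}"
    using assms by (auto simp: conn_components_def connected_graph_def)
  then have "card (conn_components G) = 1" by simp
  moreover have "1 < card (conn_components ?H) \<longleftrightarrow>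
    (\<exists>x\<in>verts G - {v}. \<exists>y\<in>verts G - {v}. \<not> (adj ?H)\<^sup>*\<^sup>* x y)" (is "?L = ?R")
  proof
    have fin: "finite (conn_components ?H)"
      using assms by (auto simp: conn_components_def ugraph_def)
    show ?R if ?L
    proof (rule ccontr)
      assume n: "\<not> ?R"
      have "\<forall>a\<in>conn_components ?H. \<forall>b\<in>conn_components ?H. a = b"
      proof (intro ballI)
        fix a b assume "a \<in> conn_components ?H" "b \<in> conn_components ?H"
        then obtain x y where xy: "x \<in> verts ?H" "a = ?K x" "y \<in> verts ?H" "b = ?K y"
          by (auto simp: conn_components_def)
        then have "(adj ?H)\<^sup>*\<^sup>* x y" using n by auto
        then show "a = b" using conn_components_eq_iff[of x ?H y] xy by blast
      qed
      then show False using \<open>?L\<close> fin card_le_Suc0_iff_eq[OF fin] by auto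
    qed
    show ?L if ?R
    proof -
      obtain x y where xy: "x \<in> verts ?H" "y \<in> verts ?H" "\<not> (adj ?H)\<^sup>*\<^sup>* x y"
        using \<open>?R\<close> by (metis verts_remove_verts)
      then have "?K x \<noteq> ?K y" using conn_components_eq_iff[of x ?H y] by blast
      moreover have "?K x \<in> conn_components ?H" "?K y \<in> conn_components ?H"
        using xy by (auto simp: conn_components_def)
      ultimately show ?L using card_le_Suc0_iff_eq[OF fin] by (metis One_nat_def not_le)
    qed
  qed
  ultimately show ?thesis by (simp add: cut_vertex_def)
qed

lemma two_connected_iff:
  assumes "ugraph G"
  shows "two_connected G \<longleftrightarrow> connected_graph G \<and>
    (\<forall>z\<in>verts G. \<forall>x\<in>verts G - {z}. \<forall>y\<in>verts G - {z}. (adj (remove_verts G {z}))\<^sup>*\<^sup>* x y)"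
  unfolding two_connected_def using cut_vertex_iff[OF assms] by blast

lemma two_connected_via:
  assumes "ugraph G" "connected_graph G"
    and "\<And>z. z \<in> verts G \<Longrightarrow> \<exists>r. \<forall>x\<in>verts G - {z}. (adj (remove_verts G {z}))\<^sup>*\<^sup>* x r"
  shows "two_connected G"
  unfolding two_connected_iff[OF assms(1)] using assms(2,3)
  by (meson reach_sym rtranclp_trans)

text \<open>Additional edges on the same vertices only add walks, before and after the deletion of a
  vertex.\<close>

lemma two_connected_induce:
  assumes "subgraph B G" "two_connected B" "ugraph G"
  shows "two_connected (induce G (verts B))"
proof -
  have u: "ugraph B" "ugraph (induce G (verts B))"
    using assms by (auto simp: subgraph_def intro: ugraph_induce)
  have a: "adj (induce G (verts B)) a b" if "adj B a b" for a b
    using that assms(1) adj_verts[OF u(1) that] by (auto simp: subgraph_def adj_def induce_def)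
  have r: "(adj (remove_verts (induce G (verts B)) X))\<^sup>*\<^sup>* x y"
    if "(adj (remove_verts B X))\<^sup>*\<^sup>* x y" for x y X
    using that by (rule reach_mono) (use a in auto)
  have "(adj (induce G (verts B)))\<^sup>*\<^sup>* x y" if "(adj B)\<^sup>*\<^sup>* x y" for x y
    using that a by (rule reach_mono)
  then show ?thesis
    using assms(2) r unfolding two_connected_iff[OF u(1)] two_connected_iff[OF u(2)] connected_graph_def
    by (metis verts_induce)
qed

text \<open>Filling in all edges of \<open>G\<close> between the vertices of \<open>B\<close>
  preserves two-connectedness, so maximality says that they were there already. A block is thereby
  determined by its vertex set.\<close>

lemma block_induce:
  assumes "block B G" "ugraph G"
  shows "B = induce G (verts B)"
proof -
  have "subgraph B (induce G (verts B))"
    using assms(1) by (auto simp: block_def subgraph_def induce_def ugraph_def)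
  then show ?thesis
    using assms two_connected_induce[of B G] subgraph_induce[of G "verts B"]
    unfolding block_def by (metis subgraph_def)
qed

section \<open>Bridges, cycles and spanning trees\<close>

definition delete_edge :: "'v ugraph \<Rightarrow> 'v set \<Rightarrow> 'v ugraph" where
  "delete_edge G e = \<lparr>verts = verts G, edges = edges G - {e}\<rparr>"

lemma adj_delete_edge [simp]: "adj (delete_edge G e) a b \<longleftrightarrow> adj G a b \<and> {a, b} \<noteq> e"
  by (auto simp: delete_edge_def adj_def)

lemma verts_delete_edge [simp]: "verts (delete_edge G e) = verts G"
  by (simp add: delete_edge_def)

text \<open>The path is kept simple while it grows: if the next vertex already occurs, the list is
  cut back to that occurrence.\<close>

lemma reach_simple_path:
  assumes "R\<^sup>*\<^sup>* x y"
  shows "\<exists>p. p \<noteq> [] \<and> hd p = x \<and> last p = y \<and> distinct p \<and> successively R p"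
  using assms
proof (induction rule: rtranclp_induct)
  case base
  show ?case by (rule exI[of _ "[x]"]) simp
next
  case (step y z)
  then obtain p where p: "p \<noteq> []" "hd p = x" "last p = y" "distinct p" "successively R p" by blast
  show ?case
  proof (cases "z \<in> set p")
    case True
    then obtain a b where "p = a @ z # b" by (meson split_list)
    with p show ?thesis
      by (intro exI[of _ "a @ [z]"]) (auto simp: successively_append_iff hd_append split: if_splits)
  next
    case False
    with p step(2) show ?thesis
      by (intro exI[of _ "p @ [z]"]) (auto simp: successively_append_iff)
  qed
qed

text \<open>Deleting the closing edge of a cycle leaves a walk between its ends; conversely a simple
  path around an edge closes up to a cycle. Bridges are expressed by reachability, to which
  retractions apply.\<close>

lemma cycle_iff_non_bridge:
  assumes "ugraph T"
  shows "(\<exists>c. graph_cycle T c) \<longleftrightarrow> (\<exists>x y. adj T x y \<and> (adj (delete_edge T {x, y}))\<^sup>*\<^sup>* x y)"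
    (is "?L \<longleftrightarrow> ?R")
proof
  assume ?L
  then obtain c where c: "3 \<le> length c" "distinct c"
    "\<And>i. i < length c \<Longrightarrow> adj T (c ! i) (c ! (Suc i mod length c))"
    by (auto simp: graph_cycle_def)
  let ?n = "length c"
  let ?T = "delete_edge T {c ! 0, c ! (?n - 1)}"
  have "(adj ?T)\<^sup>*\<^sup>* (c ! 0) (c ! i)" if "i < ?n" for i
    using that
  proof (induction i)
    case (Suc i)
    have "adj T (c ! i) (c ! Suc i)" using c(3)[of i] Suc.prems by simp
    \<comment> \<open>An edge of the cycle before the last one could coincide with the closing edge
      only if \<open>i = 0\<close> and \<open>Suc i = ?n - 1\<close>, that is, for length 2, or if
      \<open>i = ?n - 1\<close>.\<close>
    moreover have "{c ! i, c ! Suc i} \<noteq> {c ! 0, c ! (?n - 1)}"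
    proof
      assume "{c ! i, c ! Suc i} = {c ! 0, c ! (?n - 1)}"
      then have "c ! i = c ! 0 \<and> c ! Suc i = c ! (?n - 1) \<or> c ! i = c ! (?n - 1)"
        by (auto simp: doubleton_eq_iff)
      then have "i = 0 \<and> Suc i = ?n - 1 \<or> i = ?n - 1"
        using c(1) Suc.prems nth_eq_iff_index_eq[OF c(2), of i 0]
          nth_eq_iff_index_eq[OF c(2), of "Suc i" "?n - 1"] nth_eq_iff_index_eq[OF c(2), of i "?n - 1"]
        by linarith
      then show False using c(1) Suc.prems by auto
    qed
    ultimately have "adj ?T (c ! i) (c ! Suc i)" by simp
    then show ?case using Suc by (meson Suc_lessD rtranclp.rtrancl_into_rtrancl)
  qed simp
  then have "(adj ?T)\<^sup>*\<^sup>* (c ! 0) (c ! (?n - 1))" using c(1) by simp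
  moreover have "adj T (c ! 0) (c ! (?n - 1))"
  proof -
    have "Suc (?n - 1) = ?n" using c(1) by linarith
    then show ?thesis using c(3)[of "?n - 1"] adj_sym by fastforce
  qed
  ultimately show ?R by blast
next
  assume ?R
  then obtain x y where xy: "adj T x y" "(adj (delete_edge T {x, y}))\<^sup>*\<^sup>* x y" by blast
  from reach_simple_path[OF xy(2)] obtain p where p: "p \<noteq> []" "hd p = x" "last p = y"
    "distinct p" "successively (adj (delete_edge T {x, y})) p" by blast
  have nth: "adj (delete_edge T {x, y}) (p ! i) (p ! Suc i)" if "Suc i < length p" for i
    using p(5) that by (auto simp: successively_conv_nth)
  have ends: "p ! 0 = x" "p ! (length p - 1) = y"
    using p by (auto simp: hd_conv_nth last_conv_nth)
  have "length p \<noteq> 1" using ends adj_neq[OF assms xy(1)] by auto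
  \<comment> \<open>With two vertices the path would be the deleted edge itself.\<close>
  moreover have "length p \<noteq> 2"
  proof
    assume "length p = 2"
    with nth[of 0] ends show False by simp
  qed
  moreover have "length p \<noteq> 0" using p by simp
  ultimately have 3: "3 \<le> length p" by linarith
  have "adj T (p ! i) (p ! (Suc i mod length p))" if "i < length p" for i
  proof (cases "Suc i < length p")
    case True
    then show ?thesis using nth[of i] by simp
  next
    case False
    then have "i = length p - 1" "Suc i = length p" using that by auto
    then show ?thesis using ends adj_sym[OF xy(1)] by simp
  qed
  with 3 p(4) show ?L by (auto simp: graph_cycle_def)
qed

lemma spanning_tree_iff:
  "spanning_tree T G \<longleftrightarrow> subgraph T G \<and> verts T = verts G \<and> connected_graph T \<and>
     (\<forall>x y. adj T x y \<longrightarrow> \<not> (adj (delete_edge T {x, y}))\<^sup>*\<^sup>* x y)"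
  unfolding spanning_tree_def using cycle_iff_non_bridge by (metis subgraph_def)

lemma ugraph_delete_edge: "ugraph G \<Longrightarrow> ugraph (delete_edge G e)"
  by (auto simp: ugraph_def delete_edge_def)

lemma finite_edges: "ugraph G \<Longrightarrow> finite (edges G)"
  by (rule finite_subset[of _ "Pow (verts G)"]) (auto simp: ugraph_def)

lemma subgraph_adj: "subgraph H G \<Longrightarrow> adj H a b \<Longrightarrow> adj G a b"
  by (auto simp: subgraph_def adj_def)

text \<open>A connected spanning subgraph with fewest edges has only bridges, since any other edge
  could be dropped. The lemma serves to complete a spanning tree of one side to one of the whole
  graph.\<close>

lemma spanning_tree_exists:
  assumes "ugraph G" "connected_graph G"
  shows "\<exists>T. spanning_tree T G"
proof -
  define P where "P H \<longleftrightarrow> subgraph H G \<and> verts H = verts G \<and> connected_graph H" for H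
  have "P G" using assms by (auto simp: P_def subgraph_def)
  then obtain T where T: "P T" "\<And>H. P H \<Longrightarrow> card (edges T) \<le> card (edges H)"
    using exists_least_iff[of "\<lambda>n. \<exists>H. P H \<and> card (edges H) = n"] by (metis not_le)
  have uT: "ugraph T" using T by (simp add: P_def subgraph_def)
  have False if xy: "adj T x y" "(adj (delete_edge T {x, y}))\<^sup>*\<^sup>* x y" for x y
  proof -
    let ?H = "delete_edge T {x, y}"
    have "(adj ?H)\<^sup>*\<^sup>* a b" if "(adj T)\<^sup>*\<^sup>* a b" for a b
      using that
    proof (induction rule: rtranclp_induct)
      case (step b c)
      \<comment> \<open>Each use of the deleted edge, in either direction, is replaced by the detour
        \<open>xy(2)\<close>.\<close>
      have "(adj ?H)\<^sup>*\<^sup>* b c"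
      proof (cases "{b, c} = {x, y}")
        case True
        then show ?thesis using xy(2) reach_sym by (metis doubleton_eq_iff)
      next
        case False
        then have "adj ?H b c" using step(2) by (simp only: adj_delete_edge simp_thms)
        then show ?thesis by blast
      qed
      then show ?case using step by (meson rtranclp_trans)
    qed simp
    then have "P ?H" using T(1) ugraph_delete_edge[OF uT]
      by (auto simp: P_def subgraph_def connected_graph_def) (auto simp: delete_edge_def)
    then have "card (edges T) \<le> card (edges T - {{x, y}})"
      using T(2)[of ?H] by (simp add: delete_edge_def)
    moreover have "card (edges T - {{x, y}}) < card (edges T)"
      by (rule card_Diff1_less[OF finite_edges[OF uT]]) (use xy(1) in \<open>simp add: adj_def\<close>)
    ultimately show False by simp
  qed
  then show ?thesis using T(1) by (auto simp: P_def spanning_tree_iff)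
qed

section \<open>Simultaneous domination across a separating vertex\<close>

lemma sim_dominated_mono: "sim_dominated G S w \<Longrightarrow> S \<subseteq> S' \<Longrightarrow> sim_dominated G S' w"
  unfolding sim_dominated_def by blast

text \<open>\<open>C\<close> is a union of components of \<open>G - v\<close>. Both a leaf block
  without its cut vertex and a component found by search are instances, so correctness and running
  time share the decomposition.\<close>

locale separation =
  fixes G :: "'v ugraph" and v :: 'v and C :: "'v set"
  assumes ugraph: "ugraph G" and connected: "connected_graph G"
    and v_in: "v \<in> verts G" and C_subset: "C \<subseteq> verts G - {v}"
    and closed: "\<And>a b. a \<in> C \<Longrightarrow> adj G a b \<Longrightarrow> b \<in> insert v C"
begin

abbreviation B :: "'v ugraph" where "B \<equiv> induce G (insert v C)"
abbreviation G' :: "'v ugraph" where "G' \<equiv> remove_verts G C"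

text \<open>Retractions onto the two sides that fold the other side onto \<open>v\<close>. The sides
  meet only in \<open>v\<close>, so each edge is kept or contracted.\<close>

definition to_B :: "'v \<Rightarrow> 'v" where "to_B a = (if a \<in> C then a else v)"
definition to_G' :: "'v \<Rightarrow> 'v" where "to_G' a = (if a \<in> C then v else a)"

lemma B_subset: "insert v C \<subseteq> verts G"
  using v_in C_subset by blast

lemma v_notin: "v \<notin> C"
  using C_subset by blast

lemma ugraph_B: "ugraph B"
  using ugraph_induce[OF ugraph B_subset] .

lemma ugraph_G': "ugraph G'"
  using ugraph_remove_verts[OF ugraph] .

lemma adj_cases:
  assumes "adj G a b"
  obtains "a \<in> insert v C" "b \<in> insert v C" | "a \<notin> C" "b \<notin> C"
  using assms closed adj_sym by (metis insert_iff)

lemma to_B_reach: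
  assumes "(adj H)\<^sup>*\<^sup>* x y" "\<And>a b. adj H a b \<Longrightarrow> adj G a b"
    and "\<And>a b. adj H a b \<Longrightarrow> a \<in> insert v C \<Longrightarrow> b \<in> insert v C \<Longrightarrow> adj K a b"
  shows "(adj K)\<^sup>*\<^sup>* (to_B x) (to_B y)"
  using assms(1)
proof (rule reach_map)
  fix a b assume ab: "adj H a b"
  from assms(2)[OF this] show "to_B a = to_B b \<or> adj K (to_B a) (to_B b)"
    by (cases rule: adj_cases) (use assms(3)[OF ab] in \<open>auto simp: to_B_def\<close>)
qed

lemma to_G'_reach:
  assumes "(adj H)\<^sup>*\<^sup>* x y" "\<And>a b. adj H a b \<Longrightarrow> adj G a b"
    and "\<And>a b. adj H a b \<Longrightarrow> a \<notin> C \<Longrightarrow> b \<notin> C \<Longrightarrow> adj K a b"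
  shows "(adj K)\<^sup>*\<^sup>* (to_G' x) (to_G' y)"
  using assms(1)
proof (rule reach_map)
  fix a b assume ab: "adj H a b"
  from assms(2)[OF this] show "to_G' a = to_G' b \<or> adj K (to_G' a) (to_G' b)"
    by (cases rule: adj_cases) (use assms(3)[OF ab] v_notin in \<open>auto simp: to_G'_def\<close>)
qed

lemma to_B_id: "a \<in> insert v C \<Longrightarrow> to_B a = a"
  by (auto simp: to_B_def)

lemma to_G'_id: "a \<notin> C \<Longrightarrow> to_G' a = a"
  by (auto simp: to_G'_def)

text \<open>A walk to \<open>v\<close> in \<open>T\<close> folds to a walk to \<open>v\<close> in
  either part, so \<open>v\<close> serves as the hub. With \<open>T = G\<close> the two sides of
  \<open>G\<close> itself come out connected.\<close>

lemma connected_parts: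
  assumes "subgraph T G" "verts T = verts G" "connected_graph T"
  shows "connected_graph (induce T (insert v C))" "connected_graph (remove_verts T C)"
proof -
  have r: "(adj T)\<^sup>*\<^sup>* x v" if "x \<in> verts G" for x
    using assms that v_in by (auto simp: connected_graph_def)
  show "connected_graph (induce T (insert v C))"
  proof (rule connected_via)
    fix x assume "x \<in> verts (induce T (insert v C))"
    then have x: "x \<in> insert v C" by simp
    have "(adj (induce T (insert v C)))\<^sup>*\<^sup>* (to_B x) (to_B v)"
      by (rule to_B_reach[OF r]) (use x B_subset subgraph_adj[OF assms(1)] in auto)
    then show "(adj (induce T (insert v C)))\<^sup>*\<^sup>* x v" using x by (simp add: to_B_id)
  qed auto
  show "connected_graph (remove_verts T C)"
  proof (rule connected_via)
    fix x assume "x \<in> verts (remove_verts T C)"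
    then have x: "x \<in> verts G" "x \<notin> C" using assms by auto
    have "(adj (remove_verts T C))\<^sup>*\<^sup>* (to_G' x) (to_G' v)"
      by (rule to_G'_reach[OF r]) (use x subgraph_adj[OF assms(1)] in auto)
    then show "(adj (remove_verts T C))\<^sup>*\<^sup>* x v" using x v_notin by (simp add: to_G'_id)
  qed (use assms v_in v_notin in auto)
qed

lemma connected_B: "connected_graph B" and connected_G': "connected_graph G'"
  using connected_parts[of G] ugraph connected by (auto simp: subgraph_def)

lemma graph_cycle_mono:
  "graph_cycle H c \<Longrightarrow> (\<And>a b. adj H a b \<Longrightarrow> adj K a b) \<Longrightarrow> graph_cycle K c"
  by (auto simp: graph_cycle_def)

lemma spanning_tree_parts:
  assumes "spanning_tree T G"
  shows "spanning_tree (induce T (insert v C)) B" "spanning_tree (remove_verts T C) G'"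
proof -
  have T: "subgraph T G" "verts T = verts G" "connected_graph T" "\<nexists>c. graph_cycle T c"
    using assms by (auto simp: spanning_tree_def)
  have u: "ugraph T" using T by (simp add: subgraph_def)
  have "subgraph (induce T (insert v C)) B"
    using ugraph_induce[OF u, of "insert v C"] B_subset T by (auto simp: subgraph_def induce_def)
  moreover have "\<nexists>c. graph_cycle (induce T (insert v C)) c"
    using T(4) graph_cycle_mono[of "induce T (insert v C)" _ T] by auto
  ultimately show "spanning_tree (induce T (insert v C)) B"
    using connected_parts[OF T(1-3)] by (simp add: spanning_tree_def)
  have "subgraph (remove_verts T C) G'"
    using ugraph_remove_verts[OF u] T by (auto simp: subgraph_def remove_verts_def)
  moreover have "\<nexists>c. graph_cycle (remove_verts T C) c"
    using T(4) graph_cycle_mono[of "remove_verts T C" _ T] by auto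
  ultimately show "spanning_tree (remove_verts T C) G'"
    using connected_parts[OF T(1-3)] T by (simp add: spanning_tree_def)
qed

definition join :: "'v ugraph \<Rightarrow> 'v ugraph \<Rightarrow> 'v ugraph" where
  "join T1 T2 = \<lparr>verts = verts G, edges = edges T1 \<union> edges T2\<rparr>"

lemma adj_join [simp]: "adj (join T1 T2) a b \<longleftrightarrow> adj T1 a b \<or> adj T2 a b"
  by (auto simp: join_def adj_def)

text \<open>A detour around an edge of the union folds to a detour inside the tree that contains the
  edge, where that edge is a bridge. So the spanning trees of the two sides can be chosen
  independently.\<close>

lemma spanning_tree_join:
  assumes "spanning_tree T1 B" "spanning_tree T2 G'"
  shows "spanning_tree (join T1 T2) G"
proof -
  let ?T = "join T1 T2"
  have 1: "subgraph T1 B" "verts T1 = insert v C" "connected_graph T1"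
    "\<And>x y. adj T1 x y \<Longrightarrow> \<not> (adj (delete_edge T1 {x, y}))\<^sup>*\<^sup>* x y"
    using assms(1) unfolding spanning_tree_iff by auto
  have 2: "subgraph T2 G'" "verts T2 = verts G - C" "connected_graph T2"
    "\<And>x y. adj T2 x y \<Longrightarrow> \<not> (adj (delete_edge T2 {x, y}))\<^sup>*\<^sup>* x y"
    using assms(2) unfolding spanning_tree_iff by auto
  note a1 = subgraph_adj[OF 1(1), simplified] and a2 = subgraph_adj[OF 2(1), simplified]
  \<comment> \<open>The sides share only \<open>v\<close>, so an edge of the other tree with both
    ends here would be a loop.\<close>
  have T1: "adj T1 a b" if "adj ?T a b" "a \<in> insert v C" "b \<in> insert v C" for a b
    using that a2[of a b] adj_neq[OF ugraph, of a b] by auto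
  have T2: "adj T2 a b" if "adj ?T a b" "a \<notin> C" "b \<notin> C" for a b
    using that a1[of a b] adj_neq[OF ugraph, of a b] by auto
  have aG: "adj G a b" if "adj ?T a b" for a b
    using that a1[of a b] a2[of a b] by auto
  have sub: "subgraph ?T G"
    using 1(1) 2(1) B_subset ugraph unfolding subgraph_def join_def ugraph_def
    by (auto simp: induce_def remove_verts_def)
  have conn: "connected_graph ?T"
  proof (rule connected_via)
    fix x assume "x \<in> verts ?T"
    then consider "x \<in> insert v C" | "x \<in> verts G - C" by (auto simp: join_def)
    then show "(adj ?T)\<^sup>*\<^sup>* x v"
    proof cases
      case 1
      then have "(adj T1)\<^sup>*\<^sup>* x v" using \<open>verts T1 = _\<close> \<open>connected_graph T1\<close>
        by (auto simp: connected_graph_def)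
      then show ?thesis by (rule reach_mono) simp
    next
      case 2
      then have "(adj T2)\<^sup>*\<^sup>* x v" using \<open>verts T2 = _\<close> \<open>connected_graph T2\<close> v_in v_notin
        by (auto simp: connected_graph_def)
      then show ?thesis by (rule reach_mono) simp
    qed
  qed (use v_in in \<open>auto simp: join_def\<close>)
  have "\<not> (adj (delete_edge ?T {x, y}))\<^sup>*\<^sup>* x y" if xy: "adj ?T x y" for x y
  proof
    assume r: "(adj (delete_edge ?T {x, y}))\<^sup>*\<^sup>* x y"
    from aG[OF xy] show False
    proof (cases rule: adj_cases)
      case 1
      have "(adj (delete_edge T1 {x, y}))\<^sup>*\<^sup>* (to_B x) (to_B y)"
        by (rule to_B_reach[OF r]) (use aG T1 in auto)
      with 1 have "(adj (delete_edge T1 {x, y}))\<^sup>*\<^sup>* x y" by (simp add: to_B_id)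
      then show False using \<open>adj T1 x y \<Longrightarrow> \<not> _\<close> T1[OF xy 1] by blast
    next
      case 2
      have "(adj (delete_edge T2 {x, y}))\<^sup>*\<^sup>* (to_G' x) (to_G' y)"
        by (rule to_G'_reach[OF r]) (use aG T2 in auto)
      with 2 have "(adj (delete_edge T2 {x, y}))\<^sup>*\<^sup>* x y" by (simp add: to_G'_id)
      then show False using \<open>adj T2 x y \<Longrightarrow> \<not> _\<close> T2[OF xy 2] by blast
    qed
  qed
  with sub conn show ?thesis unfolding spanning_tree_iff by (auto simp: join_def)
qed

text \<open>All neighbours of \<open>w\<close> in a spanning tree of \<open>G\<close> lie in the
  part of the tree on \<open>B\<close>. One direction restricts trees, the other completes a given
  tree of \<open>B\<close> by an arbitrary one of \<open>G'\<close>.\<close>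

lemma sim_dominated_B:
  assumes "w \<in> C"
  shows "sim_dominated G S w \<longleftrightarrow> sim_dominated B (S \<inter> insert v C) w"
proof
  assume L: "sim_dominated G S w"
  obtain T2 where T2: "spanning_tree T2 G'"
    using spanning_tree_exists[OF ugraph_G' connected_G'] by blast
  show "sim_dominated B (S \<inter> insert v C) w"
    unfolding sim_dominated_def
  proof (intro allI impI)
    fix T1 assume T1: "spanning_tree T1 B"
    have "w \<in> S \<or> (\<exists>u\<in>S. adj (join T1 T2) w u)"
      using L spanning_tree_join[OF T1 T2] by (auto simp: sim_dominated_def)
    moreover have "adj T1 w u \<and> u \<in> insert v C" if "adj (join T1 T2) w u" for u
      using that assms T1 T2 unfolding spanning_tree_def by (auto dest: subgraph_adj)
    ultimately show "w \<in> S \<inter> insert v C \<or> (\<exists>u\<in>S \<inter> insert v C. adj T1 w u)"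
      using assms by blast
  qed
next
  assume R: "sim_dominated B (S \<inter> insert v C) w"
  show "sim_dominated G S w"
    unfolding sim_dominated_def
    using R spanning_tree_parts(1) by (fastforce simp: sim_dominated_def)
qed

lemma sim_dominated_G':
  assumes "w \<in> verts G - insert v C"
  shows "sim_dominated G S w \<longleftrightarrow> sim_dominated G' (S - C) w"
proof
  assume L: "sim_dominated G S w"
  obtain T1 where T1: "spanning_tree T1 B"
    using spanning_tree_exists[OF ugraph_B connected_B] by blast
  show "sim_dominated G' (S - C) w"
    unfolding sim_dominated_def
  proof (intro allI impI)
    fix T2 assume T2: "spanning_tree T2 G'"
    have "w \<in> S \<or> (\<exists>u\<in>S. adj (join T1 T2) w u)"
      using L spanning_tree_join[OF T1 T2] by (auto simp: sim_dominated_def)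
    moreover have "adj T2 w u \<and> u \<notin> C" if "adj (join T1 T2) w u" for u
      using that assms T1 T2 unfolding spanning_tree_def by (auto dest: subgraph_adj)
    ultimately show "w \<in> S - C \<or> (\<exists>u\<in>S - C. adj T2 w u)"
      using assms by blast
  qed
next
  assume R: "sim_dominated G' (S - C) w"
  show "sim_dominated G S w"
    unfolding sim_dominated_def
    using R spanning_tree_parts(2) by (fastforce simp: sim_dominated_def)
qed

text \<open>Forward, a tree of \<open>B\<close> and a tree of \<open>G'\<close> that both fail to
  dominate \<open>v\<close> join to a tree of \<open>G\<close> that fails. The disjunction can stand
  outside the quantifiers over trees because the two choices are independent.\<close>

lemma sim_dominated_v:
  "sim_dominated G S v \<longleftrightarrow> sim_dominated B (S \<inter> insert v C) v \<or> sim_dominated G' (S - C) v"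
proof
  assume L: "sim_dominated G S v"
  show "sim_dominated B (S \<inter> insert v C) v \<or> sim_dominated G' (S - C) v"
  proof (rule ccontr)
    assume "\<not> ?thesis"
    then obtain T1 T2 where T: "spanning_tree T1 B" "v \<notin> S" "\<not> (\<exists>u\<in>S \<inter> insert v C. adj T1 v u)"
      "spanning_tree T2 G'" "\<not> (\<exists>u\<in>S - C. adj T2 v u)"
      unfolding sim_dominated_def by blast
    then obtain u where "u \<in> S" "adj T1 v u \<or> adj T2 v u"
      using L spanning_tree_join[OF T(1,4)] by (auto simp: sim_dominated_def)
    moreover have "adj B v u" if "adj T1 v u"
      using subgraph_adj[OF _ that] T(1) unfolding spanning_tree_def by blast
    moreover have "adj G' v u" if "adj T2 v u"
      using subgraph_adj[OF _ that] T(4) unfolding spanning_tree_def by blast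
    ultimately show False using T(3,5) by auto
  qed
next
  assume "sim_dominated B (S \<inter> insert v C) v \<or> sim_dominated G' (S - C) v"
  then show "sim_dominated G S v"
    unfolding sim_dominated_def
    using spanning_tree_parts by fastforce
qed

end

section \<open>Splitting a solution at a cut vertex\<close>

lemma sim_dominated_member: "w \<in> S \<Longrightarrow> sim_dominated G S w"
  by (simp add: sim_dominated_def)

lemma respecting_sds_finite: "ugraph G \<Longrightarrow> respecting_sds G f S \<Longrightarrow> finite S"
  by (auto simp: respecting_sds_def ugraph_def intro: finite_subset)

lemma respecting_sds_insert:
  assumes "respecting_sds G (f(v := c)) S" "v \<in> verts G"
  shows "respecting_sds G (f(v := c')) (insert v S)"
  using assms unfolding respecting_sds_def
  by (auto simp: sim_dominated_member split: if_splits intro: sim_dominated_mono)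

text \<open>\<open>Zero\<close> asks nothing of \<open>v\<close> and serves as the common base; each
  other colour adds one condition on \<open>v\<close>.\<close>

lemma respecting_sds_upd_iff:
  assumes "v \<in> verts G"
  shows "respecting_sds G (f(v := c)) S \<longleftrightarrow> respecting_sds G (f(v := Zero)) S \<and>
    (c = One \<longrightarrow> v \<in> S) \<and> (c = HatZero \<longrightarrow> sim_dominated G S v)"
  using assms unfolding respecting_sds_def by (auto split: if_splits)

lemma respecting_sds_cong:
  "(\<And>x. x \<in> verts G \<Longrightarrow> f x = g x) \<Longrightarrow> respecting_sds G f S \<longleftrightarrow> respecting_sds G g S"
  unfolding respecting_sds_def by auto

lemma minimum_respecting_sds_cong:
  "(\<And>x. x \<in> verts G \<Longrightarrow> f x = g x) \<Longrightarrow>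
     minimum_respecting_sds G f S \<longleftrightarrow> minimum_respecting_sds G g S"
  unfolding minimum_respecting_sds_def using respecting_sds_cong by metis

text \<open>\<open>best\<close> is a choice by \<open>arg_max\<close>; injectivity of
  \<open>goodness\<close> makes its value unique.\<close>

lemma best_Zero: "best {c, Zero} = (if c = One then One else Zero)"
proof -
  have "best {c, Zero} = x" if "x \<in> {c, Zero}" "\<forall>y\<in>{c, Zero}. goodness y \<le> goodness x" for x
    unfolding best_def arg_max_def
  proof (rule some_equality)
    fix y assume "is_arg_max goodness (\<lambda>y. y \<in> {c, Zero}) y"
    then have "goodness y = goodness x" using that by (auto simp: is_arg_max_linorder intro: antisym)
    then show "y = x" by (cases y; cases x) auto
  qed (use that in \<open>auto simp: is_arg_max_linorder\<close>)
  from this[of One] this[of Zero] show ?thesis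
    by (cases c) auto
qed

context separation
begin

text \<open>Both parts take \<open>v\<close> with colour \<open>Zero\<close>, and the demand of
  \<open>v\<close> is stated apart: domination of \<open>v\<close> may come from either side and so
  belongs to neither part alone.\<close>

lemma respecting_sds_iff:
  "respecting_sds G f S \<longleftrightarrow> S \<subseteq> verts G \<and>
     respecting_sds B (f(v := Zero)) (S \<inter> insert v C) \<and> respecting_sds G' (f(v := Zero)) (S - C) \<and>
     (f v = One \<longrightarrow> v \<in> S) \<and>
     (f v = HatZero \<longrightarrow> sim_dominated B (S \<inter> insert v C) v \<or> sim_dominated G' (S - C) v)"
proof -
  have V: "verts G = C \<union> (verts G - insert v C) \<union> {v}" using B_subset by blast
  have all: "(\<forall>x\<in>verts G. P x) \<longleftrightarrow> (\<forall>x\<in>C. P x) \<and> (\<forall>x\<in>verts G - insert v C. P x) \<and> P v" for P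
    by (subst V) blast
  have e: "(\<forall>x\<in>insert v A. (f(v := Zero)) x = c \<longrightarrow> P x) \<longleftrightarrow> (\<forall>x\<in>A. f x = c \<longrightarrow> P x)"
    if "c \<noteq> Zero" "v \<notin> A" for A c P
    using that by (metis (no_types, lifting) fun_upd_apply insert_iff)
  have V': "verts G - C = insert v (verts G - insert v C)" using v_in v_notin by auto
  have vn: "v \<notin> verts G - insert v C" by simp
  have 1: "respecting_sds B (f(v := Zero)) (S \<inter> insert v C) \<longleftrightarrow>
      (\<forall>x\<in>C. f x = One \<longrightarrow> x \<in> S) \<and> (\<forall>x\<in>C. f x = HatZero \<longrightarrow> sim_dominated G S x)"
    unfolding respecting_sds_def verts_induce e[OF colour.distinct(1) v_notin] e[OF colour.distinct(6) v_notin]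
    by (simp add: sim_dominated_B cong: ball_cong)
  have 2: "respecting_sds G' (f(v := Zero)) (S - C) \<longleftrightarrow> S \<subseteq> verts G \<union> C \<and>
      (\<forall>x\<in>verts G - insert v C. f x = One \<longrightarrow> x \<in> S) \<and>
      (\<forall>x\<in>verts G - insert v C. f x = HatZero \<longrightarrow> sim_dominated G S x)"
    unfolding respecting_sds_def verts_remove_verts V' e[OF colour.distinct(1) vn] e[OF colour.distinct(6) vn]
    using v_in by (auto simp: sim_dominated_G' cong: ball_cong)
  show ?thesis
    unfolding respecting_sds_def[of G] all 1 2 sim_dominated_v[symmetric] using B_subset by auto
qed

lemma card_split: "finite S \<Longrightarrow> card S = card (S \<inter> insert v C) + card (S - C) - (if v \<in> S then 1 else 0)"
proof -
  assume fin: "finite S"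
  have "card (S \<inter> insert v C) + card (S - C)
      = card ((S \<inter> insert v C) \<union> (S - C)) + card ((S \<inter> insert v C) \<inter> (S - C))"
    using fin by (intro card_Un_Int) auto
  moreover have "(S \<inter> insert v C) \<union> (S - C) = S" by auto
  moreover have "(S \<inter> insert v C) \<inter> (S - C) = (if v \<in> S then {v} else {})" using v_notin by auto
  ultimately show ?thesis by simp
qed

text \<open>A solution for \<open>One\<close> contains \<open>v\<close> and hence dominates it,
  which orders the three optima. For \<open>Zero\<close>, \<open>HatZero\<close>, \<open>One\<close>
  this leaves the patterns k, k, k and k, k, k+1 and k, k+1, k+1.\<close>

lemma minimum_colour_bounds:
  assumes "\<And>c. minimum_respecting_sds B (f(v := c)) (Sc c)"
  shows "card (Sc Zero) \<le> card (Sc HatZero)" "card (Sc HatZero) \<le> card (Sc One)"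
    "card (Sc One) \<le> card (Sc Zero) + 1"
proof -
  have vB: "v \<in> verts B" by simp
  have r: "respecting_sds B (f(v := c)) (Sc c)" for c
    using assms by (simp add: minimum_respecting_sds_def)
  have m: "card (Sc c) \<le> card S" if "respecting_sds B (f(v := c)) S" for c S
    using assms that by (simp add: minimum_respecting_sds_def)
  have *: "\<And>c. respecting_sds B (f(v := Zero)) (Sc c)" "v \<in> Sc One"
    using r respecting_sds_upd_iff[OF vB, of f] by metis+
  show "card (Sc Zero) \<le> card (Sc HatZero)" using m * by blast
  have "respecting_sds B (f(v := HatZero)) (Sc One)"
    unfolding respecting_sds_upd_iff[OF vB, of f HatZero] using * by (simp add: sim_dominated_member)
  then show "card (Sc HatZero) \<le> card (Sc One)" by (rule m)
  have "card (Sc One) \<le> card (insert v (Sc Zero))"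
    by (rule m) (rule respecting_sds_insert[OF r vB])
  also have "\<dots> \<le> card (Sc Zero) + 1" by (simp add: card_insert_le_m1 card_insert_if)
  finally show "card (Sc One) \<le> card (Sc Zero) + 1" .
qed

text \<open>Let k be the optimum for \<open>Zero\<close>; the chosen \<open>D\<close> always has
  size k. In case (a) \<open>v\<close> lies in \<open>D\<close> at no cost, and requiring it in
  \<open>R\<close> as well lets the union save one vertex. In case (b) \<open>v\<close> is dominated
  at no cost, so only the colour \<open>One\<close> is passed on. In case (c) any help for
  \<open>v\<close> from \<open>B\<close> costs an extra vertex, which is no better than putting
  \<open>v\<close> into the rest, so the colour is passed on unchanged.\<close>

lemma minimum_step:
  assumes Sc: "\<And>c. minimum_respecting_sds B (f(v := c)) (Sc c)"
    and num: "\<And>c. num c = card (Sc c)"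
    and c': "(c', D) =
       (if num One = num HatZero \<and> num HatZero = num Zero then (One, Sc One)
        else if num One > num HatZero \<and> num HatZero = num Zero
          then (best {f v, Zero}, Sc HatZero)
        else (f v, Sc Zero))"
    and R: "minimum_respecting_sds G' (f(v := c')) R"
  shows "minimum_respecting_sds G f (D \<union> R)"
proof -
  have vB: "v \<in> verts B" and vG': "v \<in> verts G'" using v_in v_notin by auto
  have r: "respecting_sds B (f(v := c)) (Sc c)" for c
    using Sc by (simp add: minimum_respecting_sds_def)
  have m: "card (Sc c) \<le> card S" if "respecting_sds B (f(v := c)) S" for c S
    using Sc that by (simp add: minimum_respecting_sds_def)
  have rR: "respecting_sds G' (f(v := c')) R"
    using R by (simp add: minimum_respecting_sds_def)
  have mR: "card R \<le> card S" if "respecting_sds G' (f(v := c')) S" for S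
    using R that by (simp add: minimum_respecting_sds_def)
  have r0: "respecting_sds B (f(v := Zero)) (Sc c)" for c
    using r respecting_sds_upd_iff[OF vB, of f] by metis
  have r1: "v \<in> Sc One" and rh: "sim_dominated B (Sc HatZero) v"
    using r[of One] r[of HatZero] respecting_sds_upd_iff[OF vB, of f One]
      respecting_sds_upd_iff[OF vB, of f HatZero] by simp_all
  have rR0: "respecting_sds G' (f(v := Zero)) R" "c' = One \<Longrightarrow> v \<in> R"
    "c' = HatZero \<Longrightarrow> sim_dominated G' R v"
    using rR respecting_sds_upd_iff[OF vG', of f c'] by simp_all
  have ScB: "Sc c \<subseteq> insert v C" for c using r by (auto simp: respecting_sds_def)
  have RG': "R \<subseteq> verts G - C" using rR by (auto simp: respecting_sds_def)
  have finSc: "finite (Sc c)" for c using respecting_sds_finite[OF ugraph_B r] .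
  have finR: "finite R" using respecting_sds_finite[OF ugraph_G' rR] .
  let ?k = "card (Sc Zero)"
  note bounds = minimum_colour_bounds[OF Sc]
  consider
    (a) "card (Sc One) = ?k" "card (Sc HatZero) = ?k" "c' = One" "D = Sc One"
  | (b) "card (Sc One) = ?k + 1" "card (Sc HatZero) = ?k" "c' = (if f v = One then One else Zero)"
      "D = Sc HatZero"
  | (c) "card (Sc One) = ?k + 1" "card (Sc HatZero) = ?k + 1" "c' = f v" "D = Sc Zero"
  proof (cases "card (Sc HatZero) = ?k")
    case True
    show ?thesis
    proof (cases "card (Sc One) = ?k")
      case False
      with True bounds have "card (Sc One) = ?k + 1" by linarith
      then show ?thesis using c' True by (intro b) (auto simp: num best_Zero)
    qed (use c' True in \<open>intro a, auto simp: num\<close>)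
  next
    case False
    with bounds have "card (Sc One) = ?k + 1" "card (Sc HatZero) = ?k + 1" by linarith+
    then show ?thesis using c' by (intro c) (auto simp: num)
  qed
  note cases = this
  have "\<exists>c. D = Sc c \<and> card (Sc c) = ?k" using cases by cases auto
  then obtain cD where cD: "D = Sc cD" "card (Sc cD) = ?k" by blast
  have DB: "D \<subseteq> insert v C" and Dr0: "respecting_sds B (f(v := Zero)) D"
    and finD: "finite D" and cardD: "card D = ?k"
    using ScB r0 finSc cD by simp_all
  have int: "(D \<union> R) \<inter> insert v C = D \<union> (R \<inter> {v})" "D \<union> R - C = R \<union> (D \<inter> {v})"
    using DB RG' v_notin by auto
  have resp: "respecting_sds G f (D \<union> R)"
    unfolding respecting_sds_iff int
  proof (intro conjI impI)
    show "D \<union> R \<subseteq> verts G" using DB RG' B_subset by blast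
    show "respecting_sds B (f(v := Zero)) (D \<union> (R \<inter> {v}))"
      using Dr0 respecting_sds_insert[OF Dr0 vB] by (cases "v \<in> R") (simp_all add: Int_insert_right)
    show "respecting_sds G' (f(v := Zero)) (R \<union> (D \<inter> {v}))"
      using rR0 respecting_sds_insert[OF rR0(1) vG'] by (cases "v \<in> D") (simp_all add: Int_insert_right)
    show "v \<in> D \<union> R" if "f v = One"
      using cases that rR0 by cases auto
    show "sim_dominated B (D \<union> R \<inter> {v}) v \<or> sim_dominated G' (R \<union> D \<inter> {v}) v" if "f v = HatZero"
      using cases
    proof cases
      case a then show ?thesis using r1 by (auto intro: sim_dominated_member)
    next
      case b then show ?thesis using rh sim_dominated_mono[of B "Sc HatZero" v] by blast
    next
      case c then show ?thesis using rR0(3) that sim_dominated_mono[of G' R v] by auto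
    qed
  qed
  have "card (D \<union> R) \<le> card S" if S: "respecting_sds G f S" for S
  proof -
    have finS: "finite S" using respecting_sds_finite[OF ugraph S] .
    let ?SB = "S \<inter> insert v C" and ?SR = "S - C"
    have SB: "respecting_sds B (f(v := Zero)) ?SB" and SR: "respecting_sds G' (f(v := Zero)) ?SR"
      and S1: "f v = One \<Longrightarrow> v \<in> S"
      and Sh: "f v = HatZero \<Longrightarrow> sim_dominated B ?SB v \<or> sim_dominated G' ?SR v"
      using S unfolding respecting_sds_iff[of f S] by auto
    have k: "?k \<le> card ?SB" using m SB by blast
    have ins: "respecting_sds G' (f(v := c')) (insert v ?SR)"
      using respecting_sds_insert[OF SR vG'] .
    have cins: "card (insert v ?SR) \<le> card ?SR + 1" by (simp add: card_insert_if finS)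
    have cU: "card (D \<union> R) \<le> ?k + card R" using card_Un_le[of D R] cardD by simp
    show ?thesis
    proof (cases "v \<in> S")
      case True
      \<comment> \<open>Containing \<open>v\<close>, each piece of \<open>S\<close> meets every
        colour at \<open>v\<close>: the piece in \<open>B\<close> solves \<open>One\<close>, the
        other one solves \<open>c'\<close>.\<close>
      have "?SB = insert v ?SB" using True by auto
      then have SB1: "respecting_sds B (f(v := One)) ?SB"
        using respecting_sds_insert[OF SB vB, of One] by simp
      have "?SR = insert v ?SR" using True v_notin by auto
      then have R_le: "card R \<le> card ?SR" using mR ins by metis
      have pos: "0 < card ?SR" using True v_notin finS by (auto simp: card_gt_0_iff)
      have cS: "card S + 1 = card ?SB + card ?SR" using card_split[OF finS] True pos by simp
      show ?thesis using cases
      proof cases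
        case a
        \<comment> \<open>\<open>v\<close> is counted in both sets, which offsets that
          \<open>S\<close> is one smaller than the sum of its pieces.\<close>
        then have "v \<in> D \<inter> R" using r1 rR0 by auto
        then have "0 < card (D \<inter> R)" using finD by (auto simp: card_gt_0_iff)
        moreover have "card (D \<union> R) + card (D \<inter> R) = card D + card R"
          using card_Un_Int[OF finD finR] by simp
        ultimately show ?thesis using cardD k cS R_le by linarith
      next
        case b
        \<comment> \<open>In this and the next case \<open>?SB\<close> has at least k + 1 vertices,
          which pays for \<open>v\<close> being counted twice in the pieces of
          \<open>S\<close>.\<close>
        then show ?thesis using m[OF SB1] cS R_le cU by linarith
      next
        case c
        then show ?thesis using m[OF SB1] cS R_le cU by linarith
      qed
    next
      case False
      have cS: "card S = card ?SB + card ?SR" using card_split[OF finS] False by simp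
      show ?thesis using cases
      proof cases
        case a
        \<comment> \<open>Adding \<open>v\<close> to \<open>?SR\<close> gives a solution for
          \<open>c'\<close>; the vertex shared by \<open>D\<close> and \<open>R\<close> compensates
          for it.\<close>
        then have "v \<in> D \<inter> R" using r1 rR0 by auto
        then have "0 < card (D \<inter> R)" using finD by (auto simp: card_gt_0_iff)
        moreover have "card (D \<union> R) + card (D \<inter> R) = card D + card R"
          using card_Un_Int[OF finD finR] by simp
        ultimately show ?thesis using cardD k cS mR[OF ins] cins by linarith
      next
        case b
        \<comment> \<open>\<open>S\<close> avoids \<open>v\<close>, so \<open>f v\<close> is not
          \<open>One\<close> and \<open>?SR\<close> itself is a solution for
          \<open>c'\<close>.\<close>
        then have "c' = Zero" using S1 False by auto
        then have "card R \<le> card ?SR" using mR SR by simp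
        then show ?thesis using cS cU k by linarith
      next
        case c
        show ?thesis
        proof (cases "card ?SB = ?k")
          case True
          \<comment> \<open>Otherwise \<open>?SB\<close> would be a solution for
            \<open>HatZero\<close> of size k, below the optimum k + 1. So a demand to dominate
            \<open>v\<close> is met in \<open>G'\<close>.\<close>
          have "\<not> sim_dominated B ?SB v"
          proof
            assume "sim_dominated B ?SB v"
            then have "respecting_sds B (f(v := HatZero)) ?SB"
              unfolding respecting_sds_upd_iff[OF vB, of f HatZero] using SB by simp
            then show False using m c True by fastforce
          qed
          then have "respecting_sds G' (f(v := c')) ?SR"
            unfolding respecting_sds_upd_iff[OF vG', of f c'] using SR S1 Sh False c by auto
          then show ?thesis using mR cS cU k by fastforce
        next
          case False
          \<comment> \<open>The extra vertex of \<open>?SB\<close> pays for adding \<open>v\<close>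
            to \<open>?SR\<close>.\<close>
          then show ?thesis using k cS cU mR[OF ins] cins by linarith
        qed
      qed
    qed
  qed
  with resp show ?thesis by (simp add: minimum_respecting_sds_def)
qed

end

section \<open>Leaf blocks\<close>

lemma two_connected_reach:
  assumes "ugraph B" "two_connected B" "x \<in> verts B - {z}" "y \<in> verts B - {z}"
  shows "(adj (remove_verts B {z}))\<^sup>*\<^sup>* x y"
proof (cases "z \<in> verts B")
  case True
  then show ?thesis using assms unfolding two_connected_iff[OF assms(1)] by blast
next
  case False
  then have "adj (remove_verts B {z}) = adj B"
    using adj_verts[OF assms(1)] by (intro ext) auto
  then show ?thesis using assms by (simp add: two_connected_def connected_graph_def)
qed

text \<open>Instead of a path, the ear \<open>W\<close> is a minimal set of vertices. Were a part \<open>C\<close> of \<open>W\<close> cut off from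
  \<open>B\<close> by some \<open>z \<in> W\<close>, then collapsing \<open>C\<close> to \<open>z\<close> would be a retraction, so \<open>W - C\<close> would do as well.\<close>

lemma block_no_ear:
  assumes G: "ugraph G" and B: "block B G"
    and b: "b1 \<in> verts B" "b2 \<in> verts B" "b1 \<noteq> b2"
    and W: "W \<subseteq> verts G - verts B" "W \<noteq> {}"
    and conn: "\<And>z. z \<in> verts B \<Longrightarrow> connected_graph (induce G (verts B \<union> W - {z}))"
  shows False
proof -
  define P where "P W \<longleftrightarrow> W \<subseteq> verts G - verts B \<and> W \<noteq> {} \<and>
    (\<forall>z\<in>verts B. connected_graph (induce G (verts B \<union> W - {z})))" for W
  have "P W" using W conn by (simp add: P_def)
  then obtain W where W: "P W" and minimal: "\<And>W'. P W' \<Longrightarrow> card W \<le> card W'"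
    using exists_least_iff[of "\<lambda>n. \<exists>W. P W \<and> card W = n"] by (metis not_le)
  have fin: "finite W" using W G by (auto simp: P_def ugraph_def intro: finite_subset)
  have uB: "ugraph B" and tB: "two_connected B" and BG: "verts B \<subseteq> verts G"
    using B by (auto simp: block_def subgraph_def)
  have Beq: "B = induce G (verts B)" using block_induce[OF B G] .
  have adjB: "adj B x y \<longleftrightarrow> adj G x y \<and> x \<in> verts B \<and> y \<in> verts B" for x y
    by (subst Beq) simp
  let ?H = "induce G (verts B \<union> W)"
  have HG: "verts B \<union> W \<subseteq> verts G" using W BG by (auto simp: P_def)
  have uH: "ugraph ?H" using ugraph_induce[OF G HG] .
  have Hz: "(adj (remove_verts ?H {z}))\<^sup>*\<^sup>* x y"
    if "z \<in> verts B" "x \<in> verts B \<union> W - {z}" "y \<in> verts B \<union> W - {z}" for x y z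
  proof -
    have "(adj (induce G (verts B \<union> W - {z})))\<^sup>*\<^sup>* x y"
      using W that by (auto simp: P_def connected_graph_def)
    then show ?thesis by (rule reach_mono) auto
  qed
  have "connected_graph ?H"
  proof (rule connected_via)
    fix x assume x: "x \<in> verts ?H"
    show "(adj ?H)\<^sup>*\<^sup>* x b1"
    \<comment> \<open>Every vertex but \<open>b2\<close> reaches \<open>b1\<close> even without
      \<open>b2\<close>; \<open>b2\<close> itself does so inside \<open>B\<close>.\<close>
    proof (cases "x = b2")
      case True
      have "(adj B)\<^sup>*\<^sup>* x b1" using tB b True by (auto simp: two_connected_def connected_graph_def)
      then show ?thesis by (rule reach_mono) (auto simp: adjB)
    next
      case False
      have "(adj (remove_verts ?H {b2}))\<^sup>*\<^sup>* x b1" using Hz[of b2 x b1] False x b by auto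
      then show ?thesis by (rule reach_mono) auto
    qed
  qed (use b in auto)
  then have "two_connected ?H"
  proof (rule two_connected_via[OF uH])
    fix z assume z: "z \<in> verts ?H"
    show "\<exists>r. \<forall>x\<in>verts ?H - {z}. (adj (remove_verts ?H {z}))\<^sup>*\<^sup>* x r"
    proof (cases "z \<in> verts B")
      case True
      \<comment> \<open>Vertices of \<open>W\<close> survive the deletion of \<open>z\<close> from
        \<open>B\<close>, so one of them can be the hub.\<close>
      obtain w where "w \<in> W" using W by (auto simp: P_def)
      then have "w \<in> verts B \<union> W - {z}" using W True by (auto simp: P_def)
      then show ?thesis using Hz[OF True] by fastforce
    next
      case False
      then have zW: "z \<in> W" using z by simp
      define C where "C = {y \<in> verts B \<union> W - {z}. \<not> (adj (remove_verts ?H {z}))\<^sup>*\<^sup>* y b1}"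
      have "(adj (remove_verts ?H {z}))\<^sup>*\<^sup>* y b1" if "y \<in> verts B" for y
      proof -
        have "(adj B)\<^sup>*\<^sup>* y b1" using tB b that by (auto simp: two_connected_def connected_graph_def)
        then show ?thesis by (rule reach_mono) (use False in \<open>auto simp: adjB\<close>)
      qed
      then have CW: "C \<subseteq> W - {z}" by (auto simp: C_def)
      have "C = {}"
      proof (rule ccontr)
        assume "C \<noteq> {}"
        have "P (W - C)"
          unfolding P_def
        proof (intro conjI ballI)
          fix b assume bB: "b \<in> verts B"
          let ?K = "induce G (verts B \<union> (W - C) - {b})"
          show "connected_graph ?K"
          proof (rule connected_via)
            show "verts ?K \<noteq> {}" using zW CW bB False by auto
            fix x assume x: "x \<in> verts ?K"
            let ?\<rho> = "\<lambda>c. if c \<in> C then z else c"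
            have "(adj (remove_verts ?H {b}))\<^sup>*\<^sup>* x z"
              using Hz[OF bB, of x z] x zW bB False by auto
            then have "(adj ?K)\<^sup>*\<^sup>* (?\<rho> x) (?\<rho> z)"
            proof (rule reach_map)
              fix p q assume pq: "adj (remove_verts ?H {b}) p q"
              \<comment> \<open>Edges of \<open>?H\<close> leave \<open>C\<close> only towards
                \<open>z\<close>; hence folding \<open>C\<close> onto \<open>z\<close> keeps or
                contracts every edge.\<close>
              have out: "q' = z" if "p' \<in> C" "q' \<notin> C" "adj ?H p' q'" for p' q'
              proof (rule ccontr)
                assume "q' \<noteq> z"
                moreover have "p' \<noteq> z" using that CW by auto
                ultimately have "adj (remove_verts ?H {z}) p' q'" "(adj (remove_verts ?H {z}))\<^sup>*\<^sup>* q' b1"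
                  using that by (auto simp: C_def)
                then have "(adj (remove_verts ?H {z}))\<^sup>*\<^sup>* p' b1"
                  by (rule converse_rtranclp_into_rtranclp)
                then show False using that by (simp add: C_def)
              qed
              show "?\<rho> p = ?\<rho> q \<or> adj ?K (?\<rho> p) (?\<rho> q)"
                using pq out[of p q] out[of q p] adj_sym[of ?H p q] by auto
            qed
            then show "(adj ?K)\<^sup>*\<^sup>* x z" using x CW b W by (auto simp: P_def C_def split: if_splits)
          qed
        qed (use W zW CW in \<open>auto simp: P_def\<close>)
        then have "card W \<le> card (W - C)" by (rule minimal)
        moreover have "card (W - C) < card W"
          using CW \<open>C \<noteq> {}\<close> fin by (intro psubset_card_mono) auto
        ultimately show False by simp
      qed
      then show ?thesis by (intro exI[of _ b1]) (auto simp: C_def)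
    qed
  qed
  moreover have "subgraph ?H G" using subgraph_induce[OF G HG] .
  moreover have "subgraph B ?H"
  proof -
    have "edges B \<subseteq> edges ?H" by (subst Beq) (auto simp: induce_def)
    then show ?thesis using uB by (simp add: subgraph_def)
  qed
  ultimately have "?H = B" using B by (simp add: block_def)
  then have "verts B \<union> W = verts B" by (metis verts_induce)
  then show False using W by (auto simp: P_def)
qed

text \<open>If an edge led from \<open>a \<noteq> v\<close> in \<open>B\<close> to some
  \<open>w\<close> outside, the component of \<open>w\<close> in \<open>G\<close> without
  \<open>B\<close> would be an ear: \<open>a\<close> is no cut vertex of \<open>G\<close>, so this
  component is attached to \<open>B\<close> at a second vertex.\<close>

lemma leaf_block_separation:
  assumes G: "ugraph G" "connected_graph G" and B: "block B G"
    and cut: "{u \<in> verts B. cut_vertex G u} = {v}"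
  shows "separation G v (verts B - {v})" "verts B - {v} \<noteq> {}" "B = induce G (insert v (verts B - {v}))"
proof -
  have uB: "ugraph B" and tB: "two_connected B" and BG: "verts B \<subseteq> verts G"
    using B by (auto simp: block_def subgraph_def)
  have Beq: "B = induce G (verts B)" using block_induce[OF B G(1)] .
  have adjB: "adj B x y \<longleftrightarrow> adj G x y \<and> x \<in> verts B \<and> y \<in> verts B" for x y
    by (subst Beq) simp
  have v: "v \<in> verts B" "cut_vertex G v" and nc: "\<And>u. u \<in> verts B \<Longrightarrow> u \<noteq> v \<Longrightarrow> \<not> cut_vertex G u"
    using cut by blast+
  have ins: "insert v (verts B - {v}) = verts B" using v by auto
  show "B = induce G (insert v (verts B - {v}))" unfolding ins by (rule Beq)
  show "verts B - {v} \<noteq> {}"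
  proof
    assume "verts B - {v} = {}"
    then have Bv: "verts B = {v}" using v by auto
    obtain x where "x \<in> verts G" "x \<noteq> v" using v(2) unfolding cut_vertex_iff[OF G] by blast
    then have "(adj G)\<^sup>*\<^sup>* v x" using G(2) v(1) BG unfolding connected_graph_def by blast
    \<comment> \<open>The first edge of a walk from \<open>v\<close> to \<open>x\<close> is a
      two-connected graph properly larger than a single vertex.\<close>
    then obtain w where w: "adj G v w" using \<open>x \<noteq> v\<close>
      by (cases rule: converse_rtranclpE) auto
    have wG: "w \<in> verts G" "w \<noteq> v" using adj_verts[OF G(1) w] adj_neq[OF G(1) w] by blast+
    let ?H = "induce G {v, w}"
    have sub: "{v, w} \<subseteq> verts G" using wG v BG by auto
    have uH: "ugraph ?H" using ugraph_induce[OF G(1) sub] .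
    have "adj ?H w v" using adj_sym[OF w] by simp
    then have "connected_graph ?H"
      by (intro connected_via[of _ v]) (auto intro: r_into_rtranclp)
    moreover have "\<exists>r. \<forall>x\<in>verts ?H - {z}. (adj (remove_verts ?H {z}))\<^sup>*\<^sup>* x r"
      if "z \<in> verts ?H" for z
    proof -
      have "x = (if z = v then w else v)" if "x \<in> verts ?H - {z}" for x
        using that \<open>z \<in> verts ?H\<close> by (auto split: if_splits)
      then show ?thesis by (metis rtranclp.rtrancl_refl)
    qed
    ultimately have "two_connected ?H" by (rule two_connected_via[OF uH])
    moreover have "subgraph B ?H"
    proof -
      have "edges B \<subseteq> edges ?H" by (subst Beq) (auto simp: induce_def Bv)
      then show ?thesis using uB Bv by (simp add: subgraph_def)
    qed
    ultimately have "?H = B" using B subgraph_induce[OF G(1) sub] by (simp add: block_def)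
    then have "{v, w} = verts B" by (metis verts_induce)
    then show False using Bv wG by auto
  qed
  show "separation G v (verts B - {v})"
  proof
    fix a w assume a: "a \<in> verts B - {v}" and aw: "adj G a w"
    show "w \<in> insert v (verts B - {v})"
    proof (rule ccontr)
      assume "w \<notin> insert v (verts B - {v})"
      then have w: "w \<in> verts G - verts B" using adj_verts[OF G(1) aw] v by auto
      let ?K = "induce G (verts G - verts B)"
      define W where "W = {y. (adj ?K)\<^sup>*\<^sup>* w y}"
      have WG: "W \<subseteq> verts G - verts B"
      proof
        fix y assume "y \<in> W"
        then have "(adj ?K)\<^sup>*\<^sup>* w y" by (simp add: W_def)
        then show "y \<in> verts G - verts B" by (rule reach_closed) (use w in auto)
      qed
      show False
      proof (rule block_no_ear[OF G(1) B _ v(1) _ WG])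
        show "a \<in> verts B" "a \<noteq> v" using a by auto
        show "W \<noteq> {}" by (auto simp: W_def)
        fix z assume z: "z \<in> verts B"
        let ?L = "induce G (verts B \<union> W - {z})"
        have zW: "z \<notin> W" using WG z by auto
        have inW: "(adj ?L)\<^sup>*\<^sup>* w y" if "(adj ?K)\<^sup>*\<^sup>* w y" for y
          using that
        proof (induction rule: rtranclp_induct)
          case (step p q)
          then have "p \<in> W" "q \<in> W" by (auto simp: W_def intro: rtranclp.rtrancl_into_rtrancl)
          then have "adj ?L p q" using step zW by auto
          then show ?case using step by (meson rtranclp.rtrancl_into_rtrancl)
        qed simp
        \<comment> \<open>After the deletion of \<open>z\<close> the ear must still be attached. For
          \<open>z = a\<close>, a walk from \<open>w\<close> to \<open>v\<close> that avoids
          \<open>a\<close> has to leave \<open>W\<close>, and it can do so only into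
          \<open>B\<close>.\<close>
        have "\<exists>p\<in>W. \<exists>q\<in>verts B - {z}. adj G p q"
        proof (cases "z = a")
          case False
          then show ?thesis using a aw adj_sym by (intro bexI[of _ w] bexI[of _ a]) (auto simp: W_def)
        next
          case True
          show ?thesis
          proof (rule ccontr)
            assume none: "\<not> ?thesis"
            have "(adj (remove_verts G {a}))\<^sup>*\<^sup>* w v"
              using nc[of a] a w v BG unfolding cut_vertex_iff[OF G] by auto
            then have "v \<in> W"
            proof (rule reach_closed)
              show "w \<in> W" by (simp add: W_def)
              fix p q assume p: "p \<in> W" and pq: "adj (remove_verts G {a}) p q"
              then have "q \<notin> verts B" using none True by auto
              then have "adj ?K p q" using p pq WG adj_verts[OF G(1), of p q] by auto
              then show "q \<in> W" using p by (auto simp: W_def intro: rtranclp.rtrancl_into_rtrancl)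
            qed
            then show False using WG v by auto
          qed
        qed
        then obtain p q where pq: "p \<in> W" "q \<in> verts B - {z}" "adj G p q" by blast
        have pw: "(adj ?L)\<^sup>*\<^sup>* w p" using inW pq by (simp add: W_def)
        have "adj ?L p q" using pq zW by auto
        then have wq: "(adj ?L)\<^sup>*\<^sup>* w q" using pw by (rule rtranclp.rtrancl_into_rtrancl[rotated])
        show "connected_graph ?L"
        proof (rule connected_via)
          show "verts ?L \<noteq> {}" using pq by auto
          fix x assume "x \<in> verts ?L"
          then consider "x \<in> W" | "x \<in> verts B - {z}" by auto
          then have "(adj ?L)\<^sup>*\<^sup>* w x"
          proof cases
            case 1
            then show ?thesis using inW by (simp add: W_def)
          next
            case 2
            have "(adj (remove_verts B {z}))\<^sup>*\<^sup>* q x"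
              using two_connected_reach[OF uB tB] pq 2 by blast
            then have "(adj ?L)\<^sup>*\<^sup>* q x" by (rule reach_mono) (auto simp: adjB)
            then show ?thesis using wq by (rule rtranclp_trans[rotated])
          qed
          then show "(adj ?L)\<^sup>*\<^sup>* x w" by (rule reach_sym)
        qed
      qed
    qed
  qed (use G v BG in auto)
qed

definition component_without :: "'v ugraph \<Rightarrow> 'v \<Rightarrow> 'v \<Rightarrow> 'v set" where
  "component_without G v w = {y. (adj (remove_verts G {v}))\<^sup>*\<^sup>* w y}"

lemma component_separation:
  assumes G: "ugraph G" "connected_graph G" and v: "v \<in> verts G" and w: "w \<in> verts G" "w \<noteq> v"
  shows "separation G v (component_without G v w)"
proof
  show "component_without G v w \<subseteq> verts G - {v}"
  proof
    fix y assume "y \<in> component_without G v w"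
    then have "(adj (remove_verts G {v}))\<^sup>*\<^sup>* w y" by (simp add: component_without_def)
    then show "y \<in> verts G - {v}" by (rule reach_closed) (use w adj_verts[OF G(1)] in auto)
  qed
  fix a b assume ab: "a \<in> component_without G v w" "adj G a b"
  show "b \<in> insert v (component_without G v w)"
  proof (cases "b = v")
    case False
    have "a \<noteq> v" using ab \<open>component_without G v w \<subseteq> verts G - {v}\<close> by auto
    then have "adj (remove_verts G {v}) a b" using ab False by auto
    then show ?thesis using ab by (auto simp: component_without_def intro: rtranclp.rtrancl_into_rtrancl)
  qed simp
qed (use G v in auto)

text \<open>Without \<open>v\<close> the component is connected by construction. After deleting
  \<open>z\<close> from the component, which is no cut vertex of \<open>G\<close>, the remaining
  vertices still reach \<open>v\<close> in \<open>G\<close>, and these walks fold onto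
  \<open>B\<close>. In a larger two-connected \<open>H\<close>, every vertex other than
  \<open>v\<close> is reached from \<open>w\<close> without \<open>v\<close>, so it already lies in
  the component.\<close>

lemma leaf_block_of_component:
  assumes G: "ugraph G" "connected_graph G" and v: "cut_vertex G v" and w: "w \<in> verts G" "w \<noteq> v"
    and nc: "\<And>u. u \<in> component_without G v w \<Longrightarrow> \<not> cut_vertex G u"
  defines "B \<equiv> induce G (insert v (component_without G v w))"
  shows "block B G" "{u \<in> verts B. cut_vertex G u} = {v}"
proof -
  let ?C = "component_without G v w"
  have vG: "v \<in> verts G" using v by (simp add: cut_vertex_def)
  interpret separation G v ?C using component_separation[OF G vG w] .
  have wC: "w \<in> ?C" by (simp add: component_without_def)
  show "{u \<in> verts B. cut_vertex G u} = {v}" using v nc by (auto simp: B_def)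
  have "two_connected B"
    unfolding B_def
  proof (rule two_connected_via[OF ugraph_B connected_B])
    fix z assume "z \<in> verts (induce G (insert v ?C))"
    then consider "z = v" | "z \<in> ?C" by auto
    then show "\<exists>r. \<forall>x\<in>verts (induce G (insert v ?C)) - {z}.
        (adj (remove_verts (induce G (insert v ?C)) {z}))\<^sup>*\<^sup>* x r"
    proof cases
      case 1
      have "(adj (remove_verts (induce G (insert v ?C)) {v}))\<^sup>*\<^sup>* w x"
        if "(adj (remove_verts G {v}))\<^sup>*\<^sup>* w x" for x
        using that
      proof (induction rule: rtranclp_induct)
        case (step p q)
        then have "p \<in> ?C" "q \<in> ?C"
          by (auto simp: component_without_def intro: rtranclp.rtrancl_into_rtrancl)
        then show ?case using step v_notin by (auto intro: rtranclp.rtrancl_into_rtrancl)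
      qed simp
      then show ?thesis using 1 by (intro exI[of _ w]) (auto simp: component_without_def intro: reach_sym)
    next
      case 2
      show ?thesis
      proof (intro exI ballI)
        fix x assume x: "x \<in> verts (induce G (insert v ?C)) - {z}"
        have "(adj (remove_verts G {z}))\<^sup>*\<^sup>* x v"
          using nc[OF 2] x 2 v_notin B_subset unfolding cut_vertex_iff[OF G] by auto
        then have "(adj (remove_verts (induce G (insert v ?C)) {z}))\<^sup>*\<^sup>* (to_B x) (to_B v)"
          by (rule to_B_reach) auto
        then show "(adj (remove_verts (induce G (insert v ?C)) {z}))\<^sup>*\<^sup>* x v"
          using x by (simp add: to_B_id)
      qed
    qed
  qed
  moreover have "H = B" if H: "subgraph H G" "two_connected H" "subgraph B H" for H
  proof -
    have uH: "ugraph H" using H by (simp add: subgraph_def)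
    have sub: "insert v ?C \<subseteq> verts H" using H by (simp add: subgraph_def B_def)
    have "verts H \<subseteq> insert v ?C"
    proof
      fix y assume y: "y \<in> verts H"
      show "y \<in> insert v ?C"
      proof (cases "y = v")
        case False
        have "(adj (remove_verts H {v}))\<^sup>*\<^sup>* w y"
          using two_connected_reach[OF uH H(2)] y False w sub wC by auto
        then have "(adj (remove_verts G {v}))\<^sup>*\<^sup>* w y"
          by (rule reach_mono) (use subgraph_adj[OF H(1)] in auto)
        then show ?thesis by (simp add: component_without_def)
      qed simp
    qed
    then have "verts H = verts B" using sub by (auto simp: B_def)
    moreover have "edges H = edges B"
      using H \<open>verts H = verts B\<close> by (auto simp: subgraph_def ugraph_def B_def induce_def)
    ultimately show ?thesis by simp
  qed
  ultimately show "block B G"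
    unfolding block_def using subgraph_induce[OF G(1) B_subset] by (simp add: B_def)
qed

text \<open>If a cut vertex \<open>u\<close> lay in the smallest component, it would separate some
  \<open>x\<close> from \<open>v\<close>. The component of \<open>x\<close> in \<open>G - u\<close>
  stays inside the old one, since everything outside reaches \<open>v\<close> without
  \<open>u\<close>, and it lacks \<open>u\<close>.\<close>

lemma leaf_component_exists:
  assumes G: "ugraph G" "connected_graph G" and "cut_vertex G v0"
  obtains v w where "cut_vertex G v" "w \<in> verts G" "w \<noteq> v"
    "\<And>u. u \<in> component_without G v w \<Longrightarrow> \<not> cut_vertex G u"
proof -
  define P where "P v w \<longleftrightarrow> cut_vertex G v \<and> w \<in> verts G \<and> w \<noteq> v" for v w
  obtain w0 where "P v0 w0" using assms(3) unfolding cut_vertex_iff[OF G] P_def by auto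
  then obtain v w where vw: "P v w"
    and minimal: "\<And>v' w'. P v' w' \<Longrightarrow> card (component_without G v w) \<le> card (component_without G v' w')"
    using exists_least_iff[of "\<lambda>n. \<exists>v w. P v w \<and> card (component_without G v w) = n"] by (metis not_le)
  let ?C = "component_without G v w"
  have vG: "v \<in> verts G" using vw by (simp add: P_def cut_vertex_def)
  interpret separation G v ?C using component_separation[OF G vG] vw by (simp add: P_def)
  have False if u: "u \<in> ?C" "cut_vertex G u" for u
  proof -
    obtain x y where xy: "x \<in> verts G - {u}" "y \<in> verts G - {u}" "\<not> (adj (remove_verts G {u}))\<^sup>*\<^sup>* x y"
      using u unfolding cut_vertex_iff[OF G] by blast
    then have "\<not> (adj (remove_verts G {u}))\<^sup>*\<^sup>* x v \<or> \<not> (adj (remove_verts G {u}))\<^sup>*\<^sup>* y v"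
      by (meson reach_sym rtranclp_trans)
    then obtain x where x: "x \<in> verts G - {u}" "\<not> (adj (remove_verts G {u}))\<^sup>*\<^sup>* x v"
      using xy by blast
    let ?C' = "component_without G u x"
    have uG: "u \<in> verts G" using u by (simp add: cut_vertex_def)
    interpret u: separation G u ?C' using component_separation[OF G uG] x by auto
    have "?C' \<subseteq> ?C"
    proof
      fix c assume c: "c \<in> ?C'"
      show "c \<in> ?C"
      proof (rule ccontr)
        assume "c \<notin> ?C"
        then have "c \<in> verts G'" using c u.B_subset by auto
        then have "(adj G')\<^sup>*\<^sup>* c v" using connected_G' v_in v_notin by (simp add: connected_graph_def)
        then have "(adj (remove_verts G {u}))\<^sup>*\<^sup>* c v" by (rule reach_mono) (use u in auto)
        then show False using c x by (auto simp: component_without_def intro: rtranclp_trans)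
      qed
    qed
    then have "?C' \<subset> ?C" using u u.v_notin by blast
    moreover have "finite ?C" using B_subset ugraph by (auto simp: ugraph_def intro: finite_subset)
    ultimately have "card ?C' < card ?C" by (rule psubset_card_mono[rotated])
    moreover have "P u x" using u x by (auto simp: P_def)
    ultimately show False using minimal by (meson not_le)
  qed
  then show ?thesis using that vw unfolding P_def by blast
qed

section \<open>Soundness, termination and progress of the loop\<close>

lemma crsds_minimum:
  "crsds_procedure crSDS \<Longrightarrow> ugraph K \<Longrightarrow> two_connected K \<Longrightarrow> g \<in> colourings K \<Longrightarrow> crSDS K g (S, n)
    \<Longrightarrow> minimum_respecting_sds K g S \<and> n = card S"
  unfolding crsds_procedure_def by blast

text \<open>The loop invariant quantifies over every minimum solution \<open>R\<close> of the
  remaining instance, since the calls still to come may return any of them.\<close>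

primrec sound_config :: "'v ugraph \<Rightarrow> 'v colouring \<Rightarrow> 'v config \<Rightarrow> bool" where
  "sound_config G0 f0 (Loop G f S) \<longleftrightarrow> ugraph G \<and> connected_graph G \<and> f \<in> colourings G \<and>
     (\<forall>R. minimum_respecting_sds G f R \<longrightarrow> minimum_respecting_sds G0 f0 (S \<union> R))"
| "sound_config G0 f0 (Return R) \<longleftrightarrow> minimum_respecting_sds G0 f0 R"

primrec config_size :: "'v config \<Rightarrow> nat" where
  "config_size (Loop G f S) = Suc (card (verts G))"
| "config_size (Return R) = 0"

lemma recolour_in_colourings: "v \<in> verts B \<Longrightarrow> (restrict f (verts B))(v := c) \<in> colourings B"
  by auto

lemma step_sound:
  assumes crsds: "crsds_procedure crSDS" and "step crSDS c d" "sound_config G0 f0 c"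
  shows "sound_config G0 f0 d \<and> config_size d < config_size c"
  using assms(2,3)
proof cases
  case (iterate G B v f Sc num c' D G' S)
  have G: "ugraph G" "connected_graph G"
    and IH: "\<And>R. minimum_respecting_sds G f R \<Longrightarrow> minimum_respecting_sds G0 f0 (S \<union> R)"
    using assms(3) iterate by auto
  let ?C = "verts B - {v}"
  note leaf = leaf_block_separation[OF G iterate(4,5)]
  interpret separation G v ?C using leaf(1) .
  have B: "ugraph B" "two_connected B" "v \<in> verts B"
    using iterate(4,5) by (auto simp: block_def subgraph_def)
  have G'': "G' = remove_verts G ?C" using iterate by simp
  have min: "minimum_respecting_sds B ((restrict f (verts B))(v := k)) (Sc k) \<and> num k = card (Sc k)" for k
    using crsds_minimum[OF crsds B(1,2) recolour_in_colourings[OF B(3)]] iterate(6) by blast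
  have Sc: "minimum_respecting_sds (induce G (insert v ?C)) (f(v := k)) (Sc k)" for k
  proof -
    have "minimum_respecting_sds B (f(v := k)) (Sc k)"
      using min[of k] minimum_respecting_sds_cong[of B "f(v := k)" "(restrict f (verts B))(v := k)"] by auto
    then show ?thesis using leaf(3) by simp
  qed
  have "minimum_respecting_sds G0 f0 (S \<union> D \<union> R)"
    if R: "minimum_respecting_sds G' (restrict (f(v := c')) (verts G')) R" for R
  proof -
    have "minimum_respecting_sds G' (f(v := c')) R"
      using R minimum_respecting_sds_cong[of G' "f(v := c')" "restrict (f(v := c')) (verts G')"] by auto
    then have "minimum_respecting_sds G f (D \<union> R)"
      using minimum_step[OF Sc _ iterate(7), of R] min G'' by simp
    then show ?thesis using IH by (simp add: Un_assoc)
  qed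
  moreover have "card (verts G - ?C) < card (verts G)"
    using leaf(2) C_subset ugraph by (intro psubset_card_mono) (auto simp: ugraph_def)
  ultimately show ?thesis
    using ugraph_G' connected_G' unfolding iterate(1,2) G'' by simp
next
  case (finish G f SG n S)
  then show ?thesis using assms(3) crsds_minimum[OF crsds, of G f SG n] by auto
qed

lemma steps_sound:
  assumes "crsds_procedure crSDS" and "(step crSDS)\<^sup>*\<^sup>* c d" "sound_config G0 f0 c"
  shows "sound_config G0 f0 d"
  using assms(2,3) by (induction rule: rtranclp_induct) (use step_sound[OF assms(1)] in auto)

lemma step_terminates:
  assumes "crsds_procedure crSDS" "sound_config G0 f0 c"
  shows "termip (step crSDS) c"
  using assms(2)
proof (induction "config_size c" arbitrary: c rule: less_induct)
  case less
  show ?case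
  proof (rule accp.accI)
    fix d assume "(step crSDS)\<inverse>\<inverse> d c"
    then show "termip (step crSDS) d"
      using less step_sound[OF assms(1), of c d] by blast
  qed
qed

text \<open>Excludes stuck loops, so that every final configuration is a \<open>Return\<close>: a
  leaf component supplies the block, and \<open>crSDS\<close> has an answer on all two-connected
  inputs.\<close>

lemma step_progress:
  assumes crsds: "crsds_procedure crSDS" and "sound_config G0 f0 (Loop G f S)"
  shows "\<exists>c. step crSDS (Loop G f S) c"
proof -
  have G: "ugraph G" "connected_graph G" "f \<in> colourings G" using assms(2) by auto
  show ?thesis
  proof (cases "two_connected G")
    case True
    then show ?thesis using crsds G finish unfolding crsds_procedure_def by (metis surj_pair)
  next
    case False
    then obtain v0 where "cut_vertex G v0" using G by (auto simp: two_connected_def)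
    then obtain v w where vw: "cut_vertex G v" "w \<in> verts G" "w \<noteq> v"
      "\<And>u. u \<in> component_without G v w \<Longrightarrow> \<not> cut_vertex G u"
      using leaf_component_exists[OF G(1,2)] by metis
    define B where "B = induce G (insert v (component_without G v w))"
    have B: "block B G" "{u \<in> verts B. cut_vertex G u} = {v}"
      unfolding B_def by (rule leaf_block_of_component[OF G(1,2) vw]; assumption)+
    have B': "ugraph B" "two_connected B" "v \<in> verts B"
      using B by (auto simp: block_def subgraph_def)
    have "\<forall>c. \<exists>r. crSDS B ((restrict f (verts B))(v := c)) r"
      using crsds B' recolour_in_colourings[OF B'(3)] unfolding crsds_procedure_def by blast
    then obtain r where "\<And>c. crSDS B ((restrict f (verts B))(v := c)) (r c)" by metis
    then have r: "\<forall>c. crSDS B ((restrict f (verts B))(v := c)) (fst (r c), snd (r c))" by simp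
    obtain c' D where cD: "(c', D) =
       (if snd (r One) = snd (r HatZero) \<and> snd (r HatZero) = snd (r Zero) then (One, fst (r One))
        else if snd (r One) > snd (r HatZero) \<and> snd (r HatZero) = snd (r Zero)
          then (best {f v, Zero}, fst (r HatZero))
        else (f v, fst (r Zero)))"
      by (metis surj_pair)
    have "step crSDS (Loop G f S) (Loop (remove_verts G (verts B - {v}))
        (restrict (f(v := c')) (verts (remove_verts G (verts B - {v})))) (S \<union> D))"
      by (rule iterate[where B = B and v = v and Sc = "\<lambda>c. fst (r c)" and num = "\<lambda>c. snd (r c)"])
        (fact False B r cD refl)+
    then show ?thesis by blast
  qed
qed

section \<open>Polynomial-time functions on trees\<close>

lemma poly_nat_mono: "m \<le> n \<Longrightarrow> poly p m \<le> poly p n" for p :: "nat poly"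
  by (induction p) (auto intro: mult_le_mono add_mono)

lemma exec_size: "exec p x y t \<Longrightarrow> size y \<le> t"
  by (induction rule: exec.induct) auto

text \<open>The domain \<open>D\<close> accommodates \<open>crSDS\<close>, whose program may fail to
  terminate or answer arbitrarily on other trees.\<close>

definition ptime_on :: "data set \<Rightarrow> (data \<Rightarrow> data) \<Rightarrow> bool" where
  "ptime_on D f \<longleftrightarrow> (\<exists>p. \<exists>q :: nat poly. \<forall>x\<in>D. \<exists>t. exec p x (f x) t \<and> t \<le> poly q (size x))"

abbreviation ptime :: "(data \<Rightarrow> data) \<Rightarrow> bool" where
  "ptime \<equiv> ptime_on UNIV"

lemma ptime_onI:
  "(\<And>x. x \<in> D \<Longrightarrow> \<exists>t. exec p x (f x) t \<and> t \<le> poly q (size x)) \<Longrightarrow> ptime_on D f" for q :: "nat poly"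
  unfolding ptime_on_def by blast

text \<open>The cost bounds the output as well, and the output is what a subsequent program has to
  read.\<close>

lemma ptime_on_bounds:
  assumes "ptime_on D f"
  shows "\<exists>p. \<exists>q :: nat poly. \<exists>t. \<forall>x\<in>D.
    exec p x (f x) (t x) \<and> t x \<le> poly q (size x) \<and> size (f x) \<le> poly q (size x)"
proof -
  obtain p and q :: "nat poly" where pq: "\<forall>x\<in>D. \<exists>t. exec p x (f x) t \<and> t \<le> poly q (size x)"
    using assms unfolding ptime_on_def by blast
  from bchoice[OF this] obtain t where t: "\<forall>x\<in>D. exec p x (f x) (t x) \<and> t x \<le> poly q (size x)" ..
  have "size (f x) \<le> poly q (size x)" if "x \<in> D" for x
    using t[rule_format, OF that] exec_size[of p x "f x" "t x"] by simp
  then show ?thesis using t by (intro exI[of _ p] exI[of _ q] exI[of _ t]) blast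
qed

lemma ptime_size: "ptime f \<Longrightarrow> \<exists>q :: nat poly. \<forall>x. size (f x) \<le> poly q (size x)"
  using ptime_on_bounds[of UNIV f] by blast

lemma ptime_on_subset: "ptime_on D f \<Longrightarrow> E \<subseteq> D \<Longrightarrow> ptime_on E f"
  unfolding ptime_on_def by (meson subsetD)

lemma ptime_on_cong: "ptime_on D f \<Longrightarrow> (\<And>x. x \<in> D \<Longrightarrow> f x = g x) \<Longrightarrow> ptime_on D g"
  unfolding ptime_on_def by auto

lemma ptime_on_comp:
  assumes "ptime_on D f" "ptime_on E g" "\<And>x. x \<in> D \<Longrightarrow> f x \<in> E"
  shows "ptime_on D (\<lambda>x. g (f x))"
proof -
  obtain p1 and q1 :: "nat poly" and t1 where h1: "\<forall>x\<in>D.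
      exec p1 x (f x) (t1 x) \<and> t1 x \<le> poly q1 (size x) \<and> size (f x) \<le> poly q1 (size x)"
    using ptime_on_bounds[OF assms(1)] by blast
  have 1: "\<And>x. x \<in> D \<Longrightarrow> exec p1 x (f x) (t1 x)" "\<And>x. x \<in> D \<Longrightarrow> t1 x \<le> poly q1 (size x)"
    "\<And>x. x \<in> D \<Longrightarrow> size (f x) \<le> poly q1 (size x)"
    using h1 by blast+
  obtain p2 and q2 :: "nat poly" and t2 where h2: "\<forall>x\<in>E.
      exec p2 x (g x) (t2 x) \<and> t2 x \<le> poly q2 (size x) \<and> size (g x) \<le> poly q2 (size x)"
    using ptime_on_bounds[OF assms(2)] by blast
  have 2: "\<And>x. x \<in> E \<Longrightarrow> exec p2 x (g x) (t2 x)" "\<And>x. x \<in> E \<Longrightarrow> t2 x \<le> poly q2 (size x)"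
    "\<And>x. x \<in> E \<Longrightarrow> size (g x) \<le> poly q2 (size x)"
    using h2 by blast+
  show ?thesis
  \<comment> \<open>\<open>[:1, 1:]\<close> is the cost \<open>Suc (size x)\<close> of the construct
    itself; the second program runs on a tree of size at most \<open>q1\<close>, hence the
    composition of polynomials.\<close>
  proof (rule ptime_onI[of _ "Comp p1 p2" _ "[:1, 1:] + q1 + pcompose q2 q1"])
    fix x assume x: "x \<in> D"
    have "t2 (f x) \<le> poly q2 (poly q1 (size x))"
      using 2(2)[OF assms(3)[OF x]] poly_nat_mono[OF 1(3)[OF x], of q2] by (rule order_trans)
    then show "\<exists>t. exec (Comp p1 p2) x (g (f x)) t \<and> t \<le> poly ([:1, 1:] + q1 + pcompose q2 q1) (size x)"
      using exec.intros(10)[OF 1(1)[OF x] 2(1)[OF assms(3)[OF x]]] 1(2)[OF x]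
      by (intro exI[of _ "Suc (size x) + t1 x + t2 (f x)"]) (simp add: poly_pcompose)
  qed
qed

lemma ptime_on_pair:
  assumes "ptime_on D f" "ptime_on D g"
  shows "ptime_on D (\<lambda>x. Node (f x) (g x))"
proof -
  obtain p1 and q1 :: "nat poly" and t1 where h1: "\<forall>x\<in>D.
      exec p1 x (f x) (t1 x) \<and> t1 x \<le> poly q1 (size x) \<and> size (f x) \<le> poly q1 (size x)"
    using ptime_on_bounds[OF assms(1)] by blast
  have 1: "\<And>x. x \<in> D \<Longrightarrow> exec p1 x (f x) (t1 x)" "\<And>x. x \<in> D \<Longrightarrow> t1 x \<le> poly q1 (size x)"
    "\<And>x. x \<in> D \<Longrightarrow> size (f x) \<le> poly q1 (size x)"
    using h1 by blast+
  obtain p2 and q2 :: "nat poly" and t2 where h2: "\<forall>x\<in>D.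
      exec p2 x (g x) (t2 x) \<and> t2 x \<le> poly q2 (size x) \<and> size (g x) \<le> poly q2 (size x)"
    using ptime_on_bounds[OF assms(2)] by blast
  have 2: "\<And>x. x \<in> D \<Longrightarrow> exec p2 x (g x) (t2 x)" "\<And>x. x \<in> D \<Longrightarrow> t2 x \<le> poly q2 (size x)"
    "\<And>x. x \<in> D \<Longrightarrow> size (g x) \<le> poly q2 (size x)"
    using h2 by blast+
  show ?thesis
  proof (rule ptime_onI[of _ "Tuple p1 p2" _ "[:1, 1:] + q1 + q2"])
    fix x assume x: "x \<in> D"
    show "\<exists>t. exec (Tuple p1 p2) x (Node (f x) (g x)) t \<and> t \<le> poly ([:1, 1:] + q1 + q2) (size x)"
      using exec.intros(9)[OF 1(1)[OF x] 2(1)[OF x]] 1(2)[OF x] 2(2)[OF x]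
      by (intro exI[of _ "Suc (size x) + t1 x + t2 x"]) simp
  qed
qed

lemma ptime_on_if:
  assumes "ptime_on D b" "ptime_on D f" "ptime_on D g"
  shows "ptime_on D (\<lambda>x. if b x = Leaf then g x else f x)"
proof -
  obtain p0 and q0 :: "nat poly" and t0 where h0: "\<forall>x\<in>D.
      exec p0 x (b x) (t0 x) \<and> t0 x \<le> poly q0 (size x) \<and> size (b x) \<le> poly q0 (size x)"
    using ptime_on_bounds[OF assms(1)] by blast
  have 0: "\<And>x. x \<in> D \<Longrightarrow> exec p0 x (b x) (t0 x)" "\<And>x. x \<in> D \<Longrightarrow> t0 x \<le> poly q0 (size x)"
    "\<And>x. x \<in> D \<Longrightarrow> size (b x) \<le> poly q0 (size x)"
    using h0 by blast+
  obtain p1 and q1 :: "nat poly" and t1 where h1: "\<forall>x\<in>D.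
      exec p1 x (f x) (t1 x) \<and> t1 x \<le> poly q1 (size x) \<and> size (f x) \<le> poly q1 (size x)"
    using ptime_on_bounds[OF assms(2)] by blast
  have 1: "\<And>x. x \<in> D \<Longrightarrow> exec p1 x (f x) (t1 x)" "\<And>x. x \<in> D \<Longrightarrow> t1 x \<le> poly q1 (size x)"
    "\<And>x. x \<in> D \<Longrightarrow> size (f x) \<le> poly q1 (size x)"
    using h1 by blast+
  obtain p2 and q2 :: "nat poly" and t2 where h2: "\<forall>x\<in>D.
      exec p2 x (g x) (t2 x) \<and> t2 x \<le> poly q2 (size x) \<and> size (g x) \<le> poly q2 (size x)"
    using ptime_on_bounds[OF assms(3)] by blast
  have 2: "\<And>x. x \<in> D \<Longrightarrow> exec p2 x (g x) (t2 x)" "\<And>x. x \<in> D \<Longrightarrow> t2 x \<le> poly q2 (size x)"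
    "\<And>x. x \<in> D \<Longrightarrow> size (g x) \<le> poly q2 (size x)"
    using h2 by blast+
  show ?thesis
  proof (rule ptime_onI[of _ "Cond p0 p1 p2" _ "[:1, 1:] + q0 + q1 + q2"])
    fix x assume x: "x \<in> D"
    show "\<exists>t. exec (Cond p0 p1 p2) x (if b x = Leaf then g x else f x) t \<and>
        t \<le> poly ([:1, 1:] + q0 + q1 + q2) (size x)"
    proof (cases "b x = Leaf")
      case True
      have "exec (Cond p0 p1 p2) x (g x) (Suc (size x) + t0 x + t2 x)"
        using exec.intros(12)[OF _ 2(1)[OF x], of p0] 0(1)[OF x] True by simp
      then show ?thesis using True 0(2)[OF x] 2(2)[OF x]
        by (intro exI[of _ "Suc (size x) + t0 x + t2 x"]) simp
    next
      case False
      have "exec (Cond p0 p1 p2) x (f x) (Suc (size x) + t0 x + t1 x)"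
        using exec.intros(11)[OF 0(1)[OF x] False 1(1)[OF x]] .
      then show ?thesis using False 0(2)[OF x] 1(2)[OF x]
        by (intro exI[of _ "Suc (size x) + t0 x + t1 x"]) simp
    qed
  qed
qed

primrec dfst :: "data \<Rightarrow> data" where
  "dfst Leaf = Leaf" | "dfst (Node a b) = a"

primrec dsnd :: "data \<Rightarrow> data" where
  "dsnd Leaf = Leaf" | "dsnd (Node a b) = b"

definition truth :: "bool \<Rightarrow> data" where
  "truth P = (if P then Node Leaf Leaf else Leaf)"

lemma truth_eq_Leaf [simp]: "truth P = Leaf \<longleftrightarrow> \<not> P"
  by (simp add: truth_def)

text \<open>Closure rules with arbitrary polynomial functions as arguments, so that introduction
  follows the syntax of the function in question.\<close>

named_theorems ptime_rules

lemma ptime_id [ptime_rules]: "ptime (\<lambda>x. x)"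
  by (rule ptime_onI[of _ Ident _ "[:1, 1:]"]) (auto intro!: exI exec.intros(1))

lemma ptime_Leaf: "ptime (\<lambda>x. Leaf)"
  by (rule ptime_onI[of _ Empty _ "[:1, 1:]"]) (auto intro!: exI exec.intros(2))

lemma ptime_const [ptime_rules]: "ptime (\<lambda>x. c)"
  by (induction c) (auto intro: ptime_Leaf ptime_on_pair)

lemmas ptime_pair [ptime_rules] = ptime_on_pair[where D = UNIV]

lemma ptime_comp: "ptime f \<Longrightarrow> ptime g \<Longrightarrow> ptime (\<lambda>x. g (f x))"
  by (rule ptime_on_comp) auto

lemma ptime_dfst [ptime_rules]:
  assumes "ptime f"
  shows "ptime (\<lambda>x. dfst (f x))"
proof -
  have "\<exists>t. exec First x (dfst x) t \<and> t \<le> poly [:1, 1:] (size x)" for x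
    by (cases x) (fastforce intro: exec.intros)+
  then have "ptime dfst" by (rule ptime_onI)
  with assms show ?thesis by (rule ptime_comp)
qed

lemma ptime_dsnd [ptime_rules]:
  assumes "ptime f"
  shows "ptime (\<lambda>x. dsnd (f x))"
proof -
  have "\<exists>t. exec Second x (dsnd x) t \<and> t \<le> poly [:1, 1:] (size x)" for x
    by (cases x) (fastforce intro: exec.intros)+
  then have "ptime dsnd" by (rule ptime_onI)
  with assms show ?thesis by (rule ptime_comp)
qed

lemma ptime_eq [ptime_rules]:
  assumes "ptime f" "ptime g"
  shows "ptime (\<lambda>x. truth (f x = g x))"
proof -
  \<comment> \<open>\<open>Equal\<close> answers \<open>Leaf\<close> on \<open>Leaf\<close>; the
    first conjunct disappears on the pair built from \<open>f\<close> and \<open>g\<close>.\<close>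
  have "\<exists>t. exec Equal x (truth (x \<noteq> Leaf \<and> dfst x = dsnd x)) t \<and> t \<le> poly [:1, 1:] (size x)" for x
    using exec.intros(7)[of "dfst x" "dsnd x"] exec.intros(8)
    by (cases x) (auto simp: truth_def intro!: exI[of _ "Suc (size x)"])
  then have "ptime (\<lambda>x. truth (x \<noteq> Leaf \<and> dfst x = dsnd x))" by (rule ptime_onI)
  from ptime_comp[OF ptime_pair[OF assms] this] show ?thesis by simp
qed

lemma ptime_if [ptime_rules]:
  "ptime (\<lambda>x. truth (P x)) \<Longrightarrow> ptime f \<Longrightarrow> ptime g \<Longrightarrow> ptime (\<lambda>x. if P x then f x else g x)"
  by (rule ptime_on_cong[OF ptime_on_if[of UNIV "\<lambda>x. truth (P x)" f g]]) simp_all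

lemma ptime_not [ptime_rules]: "ptime (\<lambda>x. truth (P x)) \<Longrightarrow> ptime (\<lambda>x. truth (\<not> P x))"
  by (rule ptime_on_cong[OF ptime_if[OF _ ptime_const[of Leaf] ptime_const[of "Node Leaf Leaf"], of P]])
     (simp_all add: truth_def)

lemma ptime_conj [ptime_rules]:
  assumes "ptime (\<lambda>x. truth (P x))" "ptime (\<lambda>x. truth (Q x))"
  shows "ptime (\<lambda>x. truth (P x \<and> Q x))"
  by (rule ptime_on_cong[OF ptime_if[OF assms ptime_const[of Leaf]]]) (simp add: truth_def)

lemma ptime_disj [ptime_rules]:
  assumes "ptime (\<lambda>x. truth (P x))" "ptime (\<lambda>x. truth (Q x))"
  shows "ptime (\<lambda>x. truth (P x \<or> Q x))"
  by (rule ptime_on_cong[OF ptime_if[OF assms(1) ptime_const[of "Node Leaf Leaf"] assms(2)]])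
     (simp add: truth_def)

section \<open>While loops and folds\<close>

lemma exec_While_funpow:
  assumes b: "\<And>i. i \<le> n \<Longrightarrow> exec pb ((f ^^ i) x) (b ((f ^^ i) x)) (tb i)"
    and f: "\<And>i. i < n \<Longrightarrow> exec pf ((f ^^ i) x) ((f ^^ Suc i) x) (tf i)"
    and bT: "\<And>i. i < n \<Longrightarrow> b ((f ^^ i) x) \<noteq> Leaf" and bF: "b ((f ^^ n) x) = Leaf"
    and K: "\<And>i. i \<le> n \<Longrightarrow> Suc (size ((f ^^ i) x)) + tb i \<le> K"
      "\<And>i. i < n \<Longrightarrow> Suc (size ((f ^^ i) x)) + tb i + tf i \<le> K"
  shows "\<exists>t. exec (While pb pf) x ((f ^^ n) x) t \<and> t \<le> Suc n * K"
  using assms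
proof (induction n arbitrary: x tb tf)
  case 0
  then show ?case using exec.intros(13)[of pb x "tb 0" pf] by fastforce
next
  case (Suc n)
  have "\<exists>t. exec (While pb pf) (f x) ((f ^^ n) (f x)) t \<and> t \<le> Suc n * K"
  proof (rule Suc.IH[of "f x" "\<lambda>i. tb (Suc i)" "\<lambda>i. tf (Suc i)"])
    fix i
    show "i \<le> n \<Longrightarrow> exec pb ((f ^^ i) (f x)) (b ((f ^^ i) (f x))) (tb (Suc i))"
      using Suc.prems(1)[of "Suc i"] by (simp add: funpow_swap1)
    show "i < n \<Longrightarrow> exec pf ((f ^^ i) (f x)) ((f ^^ Suc i) (f x)) (tf (Suc i))"
      using Suc.prems(2)[of "Suc i"] by (simp add: funpow_swap1)
    show "i < n \<Longrightarrow> b ((f ^^ i) (f x)) \<noteq> Leaf"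
      using Suc.prems(3)[of "Suc i"] by (simp add: funpow_swap1)
    show "i \<le> n \<Longrightarrow> Suc (size ((f ^^ i) (f x))) + tb (Suc i) \<le> K"
      using Suc.prems(5)[of "Suc i"] by (simp add: funpow_swap1)
    show "i < n \<Longrightarrow> Suc (size ((f ^^ i) (f x))) + tb (Suc i) + tf (Suc i) \<le> K"
      using Suc.prems(6)[of "Suc i"] by (simp add: funpow_swap1)
  qed (use Suc.prems(4) in \<open>simp add: funpow_swap1\<close>)
  then obtain t where t: "exec (While pb pf) (f x) ((f ^^ Suc n) x) t" "t \<le> Suc n * K"
    by (auto simp: funpow_swap1)
  have "exec (While pb pf) x ((f ^^ Suc n) x) (Suc (size x) + tb 0 + tf 0 + t)"
    using exec.intros(14)[of pb x _ "tb 0" pf "f x" "tf 0"] Suc.prems(1-3)[of 0] t(1) by simp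
  moreover have "Suc (size x) + tb 0 + tf 0 \<le> K" using Suc.prems(6)[of 0] by simp
  ultimately show ?case using t(2)
    by (intro exI[of _ "Suc (size x) + tb 0 + tf 0 + t"]) simp
qed

text \<open>Besides the number of rounds, the size of every iterate is bounded by hypothesis, as a
  polynomial-time body could square the size in each round. \<open>D\<close> has to contain only the
  states on which the body runs, which exempts the final one.\<close>

lemma ptime_on_while:
  fixes qn qs :: "nat poly"
  assumes f: "ptime_on D f" and b: "ptime b"
    and iter: "\<And>x. x \<in> I \<Longrightarrow> \<exists>n \<le> poly qn (size x). h x = (f ^^ n) x \<and> b ((f ^^ n) x) = Leaf \<and>
      (\<forall>i<n. b ((f ^^ i) x) \<noteq> Leaf \<and> (f ^^ i) x \<in> D) \<and> (\<forall>i\<le>n. size ((f ^^ i) x) \<le> poly qs (size x))"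
  shows "ptime_on I h"
proof -
  obtain pf and qf :: "nat poly" and tf where hf: "\<forall>x\<in>D.
      exec pf x (f x) (tf x) \<and> tf x \<le> poly qf (size x) \<and> size (f x) \<le> poly qf (size x)"
    using ptime_on_bounds[OF f] by blast
  have f: "\<And>x. x \<in> D \<Longrightarrow> exec pf x (f x) (tf x)" "\<And>x. x \<in> D \<Longrightarrow> tf x \<le> poly qf (size x)"
    "\<And>x. x \<in> D \<Longrightarrow> size (f x) \<le> poly qf (size x)"
    using hf by blast+
  obtain pb and qb :: "nat poly" and tb where hb: "\<forall>x\<in>UNIV.
      exec pb x (b x) (tb x) \<and> tb x \<le> poly qb (size x) \<and> size (b x) \<le> poly qb (size x)"
    using ptime_on_bounds[OF b] by blast
  have b: "\<And>x. exec pb x (b x) (tb x)" "\<And>x. tb x \<le> poly qb (size x)"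
    "\<And>x. size (b x) \<le> poly qb (size x)"
    using hb by blast+
  \<comment> \<open>Cost of one round, test and body, on a tree of size at most \<open>qs\<close>.
    The factor \<open>1 + qn\<close> below includes the final failing test.\<close>
  let ?K = "1 + qs + pcompose qb qs + pcompose qf qs"
  show ?thesis
  proof (rule ptime_onI[of _ "While pb pf" _ "(1 + qn) * ?K"])
    fix x assume "x \<in> I"
    from iter[OF this] obtain n where n: "n \<le> poly qn (size x)" "h x = (f ^^ n) x"
      "b ((f ^^ n) x) = Leaf" "\<And>i. i < n \<Longrightarrow> b ((f ^^ i) x) \<noteq> Leaf" "\<And>i. i < n \<Longrightarrow> (f ^^ i) x \<in> D"
      "\<And>i. i \<le> n \<Longrightarrow> size ((f ^^ i) x) \<le> poly qs (size x)" by blast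
    have tb: "tb ((f ^^ i) x) \<le> poly qb (poly qs (size x))" if "i \<le> n" for i
      using b(2) poly_nat_mono[OF n(6)[OF that], of qb] by (rule order_trans)
    have tf: "tf ((f ^^ i) x) \<le> poly qf (poly qs (size x))" if "i < n" for i
      using f(2)[OF n(5)[OF that]] poly_nat_mono[OF n(6)[of i], of qf] that by simp
    have "\<exists>t. exec (While pb pf) x ((f ^^ n) x) t \<and> t \<le> Suc n * poly ?K (size x)"
    proof (rule exec_While_funpow[where tb = "\<lambda>i. tb ((f ^^ i) x)" and tf = "\<lambda>i. tf ((f ^^ i) x)"])
      fix i
      show "exec pb ((f ^^ i) x) (b ((f ^^ i) x)) (tb ((f ^^ i) x))" by (rule b)
      show "exec pf ((f ^^ i) x) ((f ^^ Suc i) x) (tf ((f ^^ i) x))" if "i < n"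
        using f(1)[OF n(5)[OF that]] by simp
      show "Suc (size ((f ^^ i) x)) + tb ((f ^^ i) x) \<le> poly ?K (size x)" if "i \<le> n"
        using n(6)[OF that] tb[OF that] by (simp add: poly_pcompose)
      show "Suc (size ((f ^^ i) x)) + tb ((f ^^ i) x) + tf ((f ^^ i) x) \<le> poly ?K (size x)" if "i < n"
        using n(6)[of i] tb[of i] tf[OF that] that by (simp add: poly_pcompose)
    qed (use n in auto)
    then obtain t where t: "exec (While pb pf) x (h x) t" "t \<le> Suc n * poly ?K (size x)"
      using n(2) by auto
    have "Suc n * poly ?K (size x) \<le> (1 + poly qn (size x)) * poly ?K (size x)"
      using n(1) by (intro mult_le_mono1) simp
    also have "\<dots> = poly ((1 + qn) * ?K) (size x)" by simp
    finally show "\<exists>t. exec (While pb pf) x (h x) t \<and> t \<le> poly ((1 + qn) * ?K) (size x)"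
      using t by (meson order_trans)
  qed
qed

section \<open>Trees as lists\<close>

primrec items :: "data \<Rightarrow> data list" where
  "items Leaf = []" | "items (Node a b) = a # items b"

lemma items_enc_list [simp]: "items (enc_list xs) = xs"
  by (induction xs) auto

text \<open>With the preceding equation, every tree encodes exactly one list, so list functions are
  total on trees.\<close>

lemma enc_list_items [simp]: "enc_list (items d) = d"
  by (induction d) auto

lemma enc_list_eq_Leaf [simp]: "enc_list xs = Leaf \<longleftrightarrow> xs = []"
  by (cases xs) auto

lemma length_items: "length (items d) \<le> size d"
  by (induction d) auto

lemma size_item: "a \<in> set (items d) \<Longrightarrow> size a < size d"
  by (induction d) auto

lemma size_enc_list: "size (enc_list xs) = (\<Sum>a\<leftarrow>xs. Suc (size a))"
  by (induction xs) auto

lemma size_enc_list_filter: "size (enc_list (filter P xs)) \<le> size (enc_list xs)"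
  by (induction xs) auto

lemma size_enc_list_le:
  "(\<And>a. a \<in> set xs \<Longrightarrow> size a \<le> m) \<Longrightarrow> size (enc_list xs) \<le> length xs * Suc m"
proof (induction xs)
  case (Cons a xs)
  then have "size a \<le> m" "size (enc_list xs) \<le> length xs * Suc m" by simp_all
  then show ?case by simp
qed simp

text \<open>The loop state holds the accumulator, the remaining list and the parameter
  \<open>x\<close>. The accumulator has to be bounded after every prefix, since a fold can grow
  exponentially even for polynomial \<open>g\<close>.\<close>

lemma ptime_foldl:
  fixes q :: "nat poly"
  assumes g: "ptime (\<lambda>z. g (dfst z) (dfst (dsnd z)) (dsnd (dsnd z)))"
    and s: "ptime s" and l: "ptime l"
    and bound: "\<And>x xs ys. items (l x) = xs @ ys \<Longrightarrow>
      size (foldl (\<lambda>acc a. g acc a x) (s x) xs) \<le> poly q (size x)"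
  shows "ptime (\<lambda>x. foldl (\<lambda>acc a. g acc a x) (s x) (items (l x)))"
proof -
  define F where "F z = Node (g (dfst z) (dfst (dfst (dsnd z))) (dsnd (dsnd z)))
    (Node (dsnd (dfst (dsnd z))) (dsnd (dsnd z)))" for z
  define init where "init x = Node (s x) (Node (l x) x)" for x
  define state where "state x i = Node (foldl (\<lambda>acc a. g acc a x) (s x) (take i (items (l x))))
    (Node (enc_list (drop i (items (l x)))) x)" for x i
  have pF: "ptime F"
    unfolding F_def
    by (intro ptime_rules ptime_comp[OF _ g, of "\<lambda>z. Node (dfst z) (Node (dfst (dfst (dsnd z))) (dsnd (dsnd z)))", simplified])
  have pinit: "ptime init" unfolding init_def by (intro ptime_rules s l)
  obtain ql :: "nat poly" where ql: "\<And>x. size (l x) \<le> poly ql (size x)"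
    using ptime_size[OF l] by blast
  have iter: "(F ^^ i) (init x) = state x i" if "i \<le> length (items (l x))" for x i
    using that
  proof (induction i)
    case (Suc i)
    have "F (state x i) = state x (Suc i)"
      using Suc.prems by (simp add: state_def F_def take_Suc_conv_app_nth Cons_nth_drop_Suc[symmetric])
    then show ?case using Suc by simp
  qed (simp add: init_def state_def)
  have drop_le: "size (enc_list (drop i xs)) \<le> size (enc_list xs)" for i and xs :: "data list"
    by (induction xs arbitrary: i) (auto simp: drop_Cons le_SucI trans_le_add2 split: nat.split)
  \<comment> \<open>Two inner nodes, the accumulator, the remaining list and the parameter.\<close>
  have sz: "size (state x i) \<le> poly (2 + q + ql + [:0, 1:]) (size x)" for x i
    using bound[of x "take i (items (l x))" "drop i (items (l x))"] ql[of x] drop_le[of i "items (l x)"]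
    by (simp add: state_def)
  let ?r = "\<lambda>x. length (items (dfst (dsnd x)))"
  have "ptime_on (range init) (\<lambda>z. (F ^^ ?r z) z)"
  proof (rule ptime_on_while[where qn = "[:0, 1:]" and qs = "2 + q + ql + [:0, 1:]", OF pF])
    show "ptime (\<lambda>z. dfst (dsnd z))" by (intro ptime_rules)
    fix z assume "z \<in> range init"
    then obtain x where z: "z = init x" by auto
    have len: "?r z = length (items (l x))" by (simp add: z init_def)
    have xz: "size x \<le> size z" and lz: "size (l x) \<le> size z" by (simp_all add: z init_def)
    show "\<exists>n\<le>poly [:0, 1:] (size z). (F ^^ ?r z) z = (F ^^ n) z \<and> dfst (dsnd ((F ^^ n) z)) = Leaf \<and>
      (\<forall>i<n. dfst (dsnd ((F ^^ i) z)) \<noteq> Leaf \<and> (F ^^ i) z \<in> UNIV) \<and>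
      (\<forall>i\<le>n. size ((F ^^ i) z) \<le> poly (2 + q + ql + [:0, 1:]) (size z))"
    proof (intro exI[of _ "?r z"] conjI allI impI)
      show "?r z \<le> poly [:0, 1:] (size z)" using length_items[of "l x"] lz len by simp
      show "dfst (dsnd ((F ^^ ?r z) z)) = Leaf" unfolding len unfolding z by (simp add: iter state_def)
      fix i assume i: "i < ?r z"
      then show "dfst (dsnd ((F ^^ i) z)) \<noteq> Leaf" unfolding len unfolding z by (simp add: iter state_def)
    next
      fix i assume "i \<le> ?r z"
      then have "(F ^^ i) z = state x i" unfolding len unfolding z by (rule iter)
      then show "size ((F ^^ i) z) \<le> poly (2 + q + ql + [:0, 1:]) (size z)"
        using sz[of x i] poly_nat_mono[OF xz, of "2 + q + ql + [:0, 1:]"] by simp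
    qed auto
  qed
  then have "ptime (\<lambda>x. (F ^^ ?r (init x)) (init x))"
    by (rule ptime_on_comp[OF pinit]) auto
  then have "ptime (\<lambda>x. dfst ((F ^^ ?r (init x)) (init x)))" by (rule ptime_dfst)
  moreover have "dfst ((F ^^ ?r (init x)) (init x)) = foldl (\<lambda>acc a. g acc a x) (s x) (items (l x))" for x
    using iter[of "length (items (l x))" x] by (simp add: init_def state_def)
  ultimately show ?thesis by simp
qed

lemma foldl_Node: "foldl (\<lambda>acc a. Node a acc) s xs = enc_list (rev xs @ items s)"
  by (induction xs arbitrary: s) auto

text \<open>Pushing items one by one reverses a list; \<open>ptime_append\<close> and
  \<open>ptime_map_filter\<close> reverse a second time.\<close>

lemma ptime_rev_append:
  assumes "ptime s" "ptime l"
  shows "ptime (\<lambda>x. enc_list (rev (items (l x)) @ items (s x)))"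
proof -
  obtain qs ql :: "nat poly" where q: "\<And>x. size (s x) \<le> poly qs (size x)" "\<And>x. size (l x) \<le> poly ql (size x)"
    using ptime_size[OF assms(1)] ptime_size[OF assms(2)] by blast
  have "ptime (\<lambda>x. foldl (\<lambda>acc a. Node a acc) (s x) (items (l x)))"
  proof (rule ptime_foldl[OF _ assms, where q = "qs + ql"])
    show "ptime (\<lambda>z. Node (dfst (dsnd z)) (dfst z))" by (intro ptime_rules)
    fix x xs ys assume "items (l x) = xs @ ys"
    then have "l x = enc_list (xs @ ys)" by (metis enc_list_items)
    then have "size (enc_list xs) \<le> size (l x)" by (simp add: size_enc_list)
    moreover have "size (enc_list (rev xs @ items (s x))) = size (enc_list xs) + size (enc_list (items (s x)))"
      by (simp only: size_enc_list map_append sum_list_append rev_map[symmetric] sum_list_rev)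
    ultimately show "size (foldl (\<lambda>acc a. Node a acc) (s x) xs) \<le> poly (qs + ql) (size x)"
      using q[of x] by (simp add: foldl_Node)
  qed
  then show ?thesis by (simp add: foldl_Node)
qed

lemma ptime_append [ptime_rules]:
  assumes "ptime l" "ptime m"
  shows "ptime (\<lambda>x. enc_list (items (l x) @ items (m x)))"
proof -
  have "ptime (\<lambda>x. enc_list (rev (items (l x))))"
    using ptime_rev_append[OF ptime_const[of Leaf] assms(1)] by simp
  from ptime_rev_append[OF assms(2) this] show ?thesis by simp
qed

lemma ptime_map_filter [ptime_rules]:
  assumes h: "ptime (\<lambda>z. h (dfst z) (dsnd z))" and P: "ptime (\<lambda>z. truth (P (dfst z) (dsnd z)))"
    and l: "ptime l"
  shows "ptime (\<lambda>x. enc_list (map (\<lambda>a. h a x) (filter (\<lambda>a. P a x) (items (l x)))))"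
proof -
  let ?g = "\<lambda>acc a x. if P a x then Node (h a x) acc else acc"
  obtain ql qh :: "nat poly" where ql: "\<And>x. size (l x) \<le> poly ql (size x)"
    and qh: "\<And>z. size (h (dfst z) (dsnd z)) \<le> poly qh (size z)"
    using ptime_size[OF l] ptime_size[OF h] by blast
  have fold: "foldl (\<lambda>acc a. ?g acc a x) s xs = enc_list (rev (map (\<lambda>a. h a x) (filter (\<lambda>a. P a x) xs)) @ items s)"
    for x s xs
    by (induction xs arbitrary: s) auto
  have "ptime (\<lambda>x. foldl (\<lambda>acc a. ?g acc a x) Leaf (items (l x)))"
  \<comment> \<open>At most \<open>ql\<close> items, each computed by \<open>h\<close> from a pair
    of size at most \<open>1 + ql + size x\<close>, and one inner node per list cell.\<close>
  proof (rule ptime_foldl[where q = "ql * (1 + pcompose qh (1 + ql + [:0, 1:]))", OF _ _ l])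
    have "ptime (\<lambda>z. h (dfst (dsnd z)) (dsnd (dsnd z)))" "ptime (\<lambda>z. truth (P (dfst (dsnd z)) (dsnd (dsnd z))))"
      using ptime_comp[OF ptime_dsnd[OF ptime_id] h] ptime_comp[OF ptime_dsnd[OF ptime_id] P] by simp_all
    then show "ptime (\<lambda>z. ?g (dfst z) (dfst (dsnd z)) (dsnd (dsnd z)))"
      by (intro ptime_rules)
    show "ptime (\<lambda>x. Leaf)" by (rule ptime_const)
    fix x xs ys assume l_eq: "items (l x) = xs @ ys"
    let ?r = "rev (map (\<lambda>a. h a x) (filter (\<lambda>a. P a x) xs))"
    have "size b \<le> poly qh (1 + poly ql (size x) + size x)" if b: "b \<in> set ?r" for b
    proof -
      obtain a where a: "b = h a x" "a \<in> set (items (l x))" using b l_eq by auto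
      have "size (Node a x) \<le> 1 + poly ql (size x) + size x"
        using size_item[OF a(2)] ql[of x] by simp
      then show ?thesis
        using qh[of "Node a x"] poly_nat_mono[of "size (Node a x)" _ qh] a(1) by (metis dfst.simps(2) dsnd.simps(2) order_trans)
    qed
    then have "size (enc_list ?r) \<le> length ?r * Suc (poly qh (1 + poly ql (size x) + size x))"
      by (rule size_enc_list_le)
    also have "length ?r \<le> length (items (l x))" using l_eq by (simp add: trans_le_add1)
    then have "length ?r \<le> poly ql (size x)" using length_items[of "l x"] ql[of x] by linarith
    then have "length ?r * Suc (poly qh (1 + poly ql (size x) + size x)) \<le>
        poly ql (size x) * Suc (poly qh (1 + poly ql (size x) + size x))"
      by (rule mult_le_mono1)
    finally show "size (foldl (\<lambda>acc a. ?g acc a x) Leaf xs) \<le>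
        poly (ql * (1 + pcompose qh (1 + ql + [:0, 1:]))) (size x)"
      by (simp add: fold poly_pcompose)
  qed
  then have "ptime (\<lambda>x. enc_list (rev (map (\<lambda>a. h a x) (filter (\<lambda>a. P a x) (items (l x))))))"
    by (simp add: fold)
  from ptime_rev_append[OF ptime_const[of Leaf] this] show ?thesis by simp
qed

lemma ptime_map [ptime_rules]:
  assumes "ptime (\<lambda>z. h (dfst z) (dsnd z))" "ptime l"
  shows "ptime (\<lambda>x. enc_list (map (\<lambda>a. h a x) (items (l x))))"
  using ptime_map_filter[OF assms(1) _ assms(2), of "\<lambda>a x. Leaf = Leaf"] ptime_eq[OF ptime_const ptime_const]
  by (simp add: ptime_const)

lemma ptime_filter [ptime_rules]:
  assumes "ptime (\<lambda>z. truth (P (dfst z) (dsnd z)))" "ptime l"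
  shows "ptime (\<lambda>x. enc_list (filter (\<lambda>a. P a x) (items (l x))))"
  using ptime_map_filter[OF _ assms, of "\<lambda>a x. a"] by (simp add: ptime_dfst ptime_id)

lemma ptime_Bex [ptime_rules]:
  assumes "ptime (\<lambda>z. truth (P (dfst z) (dsnd z)))" "ptime l"
  shows "ptime (\<lambda>x. truth (\<exists>a\<in>set (items (l x)). P a x))"
  by (rule ptime_on_cong[OF ptime_not[OF ptime_eq[OF ptime_filter[OF assms] ptime_const[of Leaf]]]])
     (simp add: filter_empty_conv Bex_def)

lemma ptime_member [ptime_rules]:
  assumes "ptime f" "ptime l"
  shows "ptime (\<lambda>x. truth (f x \<in> set (items (l x))))"
proof -
  have "ptime (\<lambda>z. truth (dfst z = f (dsnd z)))"
    by (intro ptime_rules ptime_comp[OF _ assms(1)])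
  from ptime_Bex[OF this assms(2)] show ?thesis by (simp add: Bex_def conj_commute)
qed

text \<open>Substitution: a function of several arguments is shown polynomial once, on nested pairs,
  and can then be applied to any polynomial arguments.\<close>

lemma ptime_curry2:
  assumes "ptime (\<lambda>z. F (dfst z) (dsnd z))" "ptime a" "ptime b"
  shows "ptime (\<lambda>x. F (a x) (b x))"
  using ptime_comp[OF ptime_pair[OF assms(2,3)] assms(1)] by simp

lemma ptime_curry3:
  assumes "ptime (\<lambda>z. F (dfst z) (dfst (dsnd z)) (dsnd (dsnd z)))" "ptime a" "ptime b" "ptime c"
  shows "ptime (\<lambda>x. F (a x) (b x) (c x))"
  using ptime_comp[OF ptime_pair[OF assms(2) ptime_pair[OF assms(3,4)]] assms(1)] by simp

lemma ptime_curry4: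
  assumes "ptime (\<lambda>z. F (dfst z) (dfst (dsnd z)) (dfst (dsnd (dsnd z))) (dsnd (dsnd (dsnd z))))"
    "ptime a" "ptime b" "ptime c" "ptime d"
  shows "ptime (\<lambda>x. F (a x) (b x) (c x) (d x))"
  using ptime_comp[OF ptime_pair[OF assms(2) ptime_pair[OF assms(3) ptime_pair[OF assms(4,5)]]] assms(1)]
  by simp

section \<open>Encoded graphs\<close>

definition verts_of :: "data \<Rightarrow> data" where
  "verts_of I = enc_list (map dfst (items (dfst I)))"

definition edge_in :: "data \<Rightarrow> data \<Rightarrow> data \<Rightarrow> bool" where
  "edge_in I a b \<longleftrightarrow> Node a b \<in> set (items (dsnd I)) \<or> Node b a \<in> set (items (dsnd I))"

text \<open>Filtering the vertex list, rather than appending new vertices, keeps the result no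
  larger than that list and as free of duplicates.\<close>

definition reach_step :: "data \<Rightarrow> data \<Rightarrow> data \<Rightarrow> data" where
  "reach_step I v acc = enc_list (filter
     (\<lambda>u. u \<noteq> v \<and> (u \<in> set (items acc) \<or> (\<exists>r\<in>set (items acc). edge_in I r u)))
     (items (verts_of I)))"

text \<open>The list folded over is only a counter: there are as many rounds as vertices.\<close>

definition reach_from :: "data \<Rightarrow> data \<Rightarrow> data \<Rightarrow> data" where
  "reach_from I v w = foldl (\<lambda>acc a. reach_step I v acc)
     (enc_list (filter (\<lambda>u. u = w) (items (verts_of I)))) (items (verts_of I))"

definition is_cut :: "data \<Rightarrow> data \<Rightarrow> bool" where
  "is_cut I v \<longleftrightarrow> (\<exists>w\<in>set (items (verts_of I)). w \<noteq> v \<and>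
     (\<exists>u\<in>set (items (verts_of I)). u \<noteq> v \<and> u \<notin> set (items (reach_from I v w))))"

definition is_leaf :: "data \<Rightarrow> data \<Rightarrow> data \<Rightarrow> bool" where
  "is_leaf I v w \<longleftrightarrow> is_cut I v \<and> w \<noteq> v \<and> \<not> (\<exists>u\<in>set (items (reach_from I v w)). is_cut I u)"

definition cut_list :: "data \<Rightarrow> data" where
  "cut_list I = enc_list (filter (\<lambda>v. is_cut I v) (items (verts_of I)))"

definition leaf_vertex :: "data \<Rightarrow> data" where
  "leaf_vertex I = dfst (enc_list (filter
     (\<lambda>v. \<exists>w\<in>set (items (verts_of I)). is_leaf I v w) (items (verts_of I))))"

definition leaf_start :: "data \<Rightarrow> data \<Rightarrow> data" where
  "leaf_start I v = dfst (enc_list (filter (\<lambda>w. is_leaf I v w) (items (verts_of I))))"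

text \<open>Recolouring \<open>v\<close> is built in because the calls on the block and the
  remaining instance both require it.\<close>

definition induced :: "data \<Rightarrow> data \<Rightarrow> data \<Rightarrow> data \<Rightarrow> data" where
  "induced I X v c = Node
     (enc_list (map (\<lambda>p. Node (dfst p) (if dfst p = v then c else dsnd p))
       (filter (\<lambda>p. dfst p \<in> set (items X)) (items (dfst I)))))
     (enc_list (filter (\<lambda>e. dfst e \<in> set (items X) \<and> dsnd e \<in> set (items X)) (items (dsnd I))))"

definition colour_of :: "data \<Rightarrow> data \<Rightarrow> data" where
  "colour_of I v = dsnd (dfst (enc_list (filter (\<lambda>p. dfst p = v) (items (dfst I)))))"

text \<open>Items of \<open>l\<close> that occur in \<open>m\<close> are dropped since set encodings
  are duplicate-free.\<close>

definition union_of :: "data \<Rightarrow> data \<Rightarrow> data" where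
  "union_of l m = enc_list (items (enc_list (filter (\<lambda>a. a \<notin> set (items m)) (items l))) @ items m)"

definition removal :: "data \<Rightarrow> data \<Rightarrow> data" where
  "removal I X = enc_list (filter (\<lambda>a. a \<notin> set (items X)) (items (verts_of I)))"

section \<open>Polynomial time of the graph functions\<close>

lemma ptime_verts_of [ptime_rules]: "ptime a \<Longrightarrow> ptime (\<lambda>x. verts_of (a x))"
  unfolding verts_of_def by (intro ptime_rules)

lemma ptime_edge_in [ptime_rules]:
  "ptime a \<Longrightarrow> ptime b \<Longrightarrow> ptime c \<Longrightarrow> ptime (\<lambda>x. truth (edge_in (a x) (b x) (c x)))"
  unfolding edge_in_def by (intro ptime_rules)

lemma ptime_reach_step [ptime_rules]:
  "ptime a \<Longrightarrow> ptime b \<Longrightarrow> ptime c \<Longrightarrow> ptime (\<lambda>x. reach_step (a x) (b x) (c x))"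
  by (rule ptime_curry3[where F = reach_step]; assumption?) (unfold reach_step_def, intro ptime_rules)

lemma ptime_reach_from [ptime_rules]:
  assumes "ptime a" "ptime b" "ptime c"
  shows "ptime (\<lambda>x. reach_from (a x) (b x) (c x))"
proof (rule ptime_curry3[where F = reach_from, OF _ assms])
  have v: "ptime (\<lambda>x. verts_of (dfst x))" by (intro ptime_rules)
  then obtain q :: "nat poly" where q: "\<And>x. size (verts_of (dfst x)) \<le> poly q (size x)"
    using ptime_size by blast
  have "ptime (\<lambda>z. foldl (\<lambda>acc a. reach_step (dfst z) (dfst (dsnd z)) acc)
     (enc_list (filter (\<lambda>u. u = dsnd (dsnd z)) (items (verts_of (dfst z))))) (items (verts_of (dfst z))))"
  proof (rule ptime_foldl[where q = q])
    fix x xs ys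
    \<comment> \<open>After any number of rounds the accumulator is a filtered vertex list.\<close>
    have "size (foldl (\<lambda>acc a. reach_step (dfst x) (dfst (dsnd x)) acc)
       (enc_list (filter (\<lambda>u. u = dsnd (dsnd x)) (items (verts_of (dfst x))))) xs) \<le> size (verts_of (dfst x))"
      using size_enc_list_filter[of _ "items (verts_of (dfst x))"]
      by (induction xs rule: rev_induct) (simp_all add: reach_step_def)
    then show "size (foldl (\<lambda>acc a. reach_step (dfst x) (dfst (dsnd x)) acc)
       (enc_list (filter (\<lambda>u. u = dsnd (dsnd x)) (items (verts_of (dfst x))))) xs) \<le> poly q (size x)"
      using q[of x] by simp
  qed (intro ptime_rules)+
  then show "ptime (\<lambda>z. reach_from (dfst z) (dfst (dsnd z)) (dsnd (dsnd z)))"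
    by (simp add: reach_from_def)
qed

lemma ptime_is_cut [ptime_rules]:
  "ptime a \<Longrightarrow> ptime b \<Longrightarrow> ptime (\<lambda>x. truth (is_cut (a x) (b x)))"
  by (rule ptime_curry2[where F = "\<lambda>a b. truth (is_cut a b)"]; assumption?)
    (unfold is_cut_def, intro ptime_rules)

lemma ptime_is_leaf [ptime_rules]:
  "ptime a \<Longrightarrow> ptime b \<Longrightarrow> ptime c \<Longrightarrow> ptime (\<lambda>x. truth (is_leaf (a x) (b x) (c x)))"
  by (rule ptime_curry3[where F = "\<lambda>a b c. truth (is_leaf a b c)"]; assumption?)
    (unfold is_leaf_def, intro ptime_rules)

lemma ptime_cut_list [ptime_rules]: "ptime a \<Longrightarrow> ptime (\<lambda>x. cut_list (a x))"
  by (rule ptime_comp[where g = cut_list]; assumption?) (unfold cut_list_def, intro ptime_rules)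

lemma ptime_leaf_vertex [ptime_rules]: "ptime a \<Longrightarrow> ptime (\<lambda>x. leaf_vertex (a x))"
  by (rule ptime_comp[where g = leaf_vertex]; assumption?) (unfold leaf_vertex_def, intro ptime_rules)

lemma ptime_leaf_start [ptime_rules]: "ptime a \<Longrightarrow> ptime b \<Longrightarrow> ptime (\<lambda>x. leaf_start (a x) (b x))"
  by (rule ptime_curry2[where F = leaf_start]; assumption?) (unfold leaf_start_def, intro ptime_rules)

lemma ptime_induced [ptime_rules]:
  "ptime a \<Longrightarrow> ptime b \<Longrightarrow> ptime c \<Longrightarrow> ptime d \<Longrightarrow> ptime (\<lambda>x. induced (a x) (b x) (c x) (d x))"
  by (rule ptime_curry4[where F = induced]; assumption?) (unfold induced_def, intro ptime_rules)

lemma ptime_colour_of [ptime_rules]: "ptime a \<Longrightarrow> ptime b \<Longrightarrow> ptime (\<lambda>x. colour_of (a x) (b x))"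
  by (rule ptime_curry2[where F = colour_of]; assumption?) (unfold colour_of_def, intro ptime_rules)

lemma ptime_union_of [ptime_rules]: "ptime a \<Longrightarrow> ptime b \<Longrightarrow> ptime (\<lambda>x. union_of (a x) (b x))"
  by (rule ptime_curry2[where F = union_of]; assumption?) (unfold union_of_def, intro ptime_rules)

lemma ptime_removal [ptime_rules]: "ptime a \<Longrightarrow> ptime b \<Longrightarrow> ptime (\<lambda>x. removal (a x) (b x))"
  by (rule ptime_curry2[where F = removal]; assumption?) (unfold removal_def, intro ptime_rules)

text \<open>A chain of iterates inside \<open>V\<close> grows strictly until it is stationary, and
  it can grow at most \<open>card V\<close> times.\<close>

lemma finite_chain_limit:
  fixes F :: "'a set \<Rightarrow> 'a set"
  assumes "finite V" "\<And>i. (F ^^ i) W \<subseteq> V" "\<And>i. (F ^^ i) W \<subseteq> (F ^^ Suc i) W"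
  shows "(F ^^ card V) W = (\<Union>i. (F ^^ i) W)"
proof (rule finite_mono_strict_prefix_implies_finite_fixpoint[OF assms(2,1)])
  show "\<exists>N. (\<forall>n\<le>N. \<forall>m\<le>N. m < n \<longrightarrow> (F ^^ m) W \<subset> (F ^^ n) W) \<and> (\<forall>n\<ge>N. (F ^^ N) W = (F ^^ n) W)"
  proof (rule finite_mono_remains_stable_implies_strict_prefix)
    show "finite (range (\<lambda>i. (F ^^ i) W))"
      by (rule finite_subset[of _ "Pow V"]) (use assms(1,2) in auto)
    show "mono (\<lambda>i. (F ^^ i) W)" unfolding mono_iff_le_Suc using assms(3) by (rule allI)
    show "\<forall>n. (F ^^ n) W = (F ^^ Suc n) W \<longrightarrow> (F ^^ Suc n) W = (F ^^ Suc (Suc n)) W"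
    proof (intro allI impI)
      fix n assume e: "(F ^^ n) W = (F ^^ Suc n) W"
      show "(F ^^ Suc n) W = (F ^^ Suc (Suc n)) W"
        using arg_cong[OF e, of F] unfolding funpow.simps comp_apply .
    qed
  qed
qed

section \<open>Correctness of the graph functions on encodings\<close>

lemma encodes_set_iff:
  assumes "inj \<nu>" "encodes_set \<nu> x A"
  shows "\<nu> a \<in> set (items x) \<longleftrightarrow> a \<in> A" "\<And>y. y \<in> set (items x) \<Longrightarrow> \<exists>a\<in>A. y = \<nu> a"
  using assms by (auto simp: encodes_set_def inj_image_mem_iff)

lemma encodes_set_filter:
  "distinct vs \<Longrightarrow> encodes_set \<nu> (enc_list (filter P (map \<nu> vs))) {v \<in> set vs. P (\<nu> v)}"
  unfolding encodes_set_def
  by (intro exI[of _ "filter (P \<circ> \<nu>) vs"]) (auto simp: filter_map)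

lemma encodes_set_union:
  assumes "inj \<nu>" "encodes_set \<nu> x A" "encodes_set \<nu> y B"
  shows "encodes_set \<nu> (union_of x y) (A \<union> B)"
proof -
  obtain as bs where as: "distinct as" "set as = A" "x = enc_list (map \<nu> as)"
    and bs: "distinct bs" "set bs = B" "y = enc_list (map \<nu> bs)"
    using assms by (auto simp: encodes_set_def)
  show ?thesis
    unfolding encodes_set_def union_of_def
    by (intro exI[of _ "filter (\<lambda>a. \<nu> a \<notin> set (items y)) as @ bs"])
      (use as bs assms(1) in \<open>auto simp: filter_map o_def inj_image_mem_iff\<close>)
qed

lemma dfst_filter:
  assumes "\<exists>v\<in>set vs. P (\<nu> v)"
  shows "\<exists>v\<in>set vs. P (\<nu> v) \<and> dfst (enc_list (filter P (map \<nu> vs))) = \<nu> v"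
  using assms by (induction vs) auto

lemma encodes_instance_cong:
  "encodes_instance \<nu> x G f \<Longrightarrow> (\<And>v. v \<in> verts G \<Longrightarrow> f v = g v) \<Longrightarrow> encodes_instance \<nu> x G g"
  unfolding encodes_instance_def by (metis (mono_tags, lifting) map_eq_conv)

lemma enc_colour_inj [simp]: "enc_colour c = enc_colour d \<longleftrightarrow> c = d"
  by (cases c; cases d) auto

lemma enc_list_inj: "enc_list xs = enc_list ys \<longleftrightarrow> xs = ys"
  by (metis items_enc_list)

lemma enc_nat_inj [simp]: "enc_nat m = enc_nat n \<longleftrightarrow> m = n"
  by (metis enc_nat_def items_enc_list length_replicate)

text \<open>Lets a result computed from \<open>x\<close> alone be attributed to the instance that
  \<open>x\<close> encodes. Names are injective and colourings extensional, so the tree determines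
  both components.\<close>

lemma encodes_instance_unique:
  assumes "inj \<nu>" "encodes_instance \<nu> x K g" "encodes_instance \<nu> x K' g'"
    "g \<in> colourings K" "g' \<in> colourings K'"
  shows "K = K' \<and> g = g'"
proof -
  obtain vs es where 1: "set vs = verts K" "set (map (\<lambda>(u, w). {u, w}) es) = edges K"
    "x = Node (enc_list (map (\<lambda>v. Node (\<nu> v) (enc_colour (g v))) vs))
       (enc_list (map (\<lambda>(u, w). Node (\<nu> u) (\<nu> w)) es))"
    using assms(2) unfolding encodes_instance_def by blast
  obtain vs' es' where 2: "set vs' = verts K'" "set (map (\<lambda>(u, w). {u, w}) es') = edges K'"
    "x = Node (enc_list (map (\<lambda>v. Node (\<nu> v) (enc_colour (g' v))) vs'))
       (enc_list (map (\<lambda>(u, w). Node (\<nu> u) (\<nu> w)) es'))"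
    using assms(3) unfolding encodes_instance_def by blast
  have v: "map (\<lambda>v. Node (\<nu> v) (enc_colour (g v))) vs = map (\<lambda>v. Node (\<nu> v) (enc_colour (g' v))) vs'"
    and e: "map (\<lambda>(u, w). Node (\<nu> u) (\<nu> w)) es = map (\<lambda>(u, w). Node (\<nu> u) (\<nu> w)) es'"
    using trans[OF sym[OF 1(3)] 2(3)] by (simp_all only: data.inject enc_list_inj)
  have "map \<nu> vs = map \<nu> vs'" using arg_cong[OF v, of "map dfst"] by (simp add: o_def)
  then have vs: "vs = vs'" using assms(1) by (simp add: inj_map_eq_map)
  have "inj (\<lambda>(u, w). Node (\<nu> u) (\<nu> w))" using assms(1) by (auto simp: inj_def)
  then have es: "es = es'" using e by (simp add: inj_map_eq_map)
  have K: "K = K'" using 1 2 vs es by simp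
  have "g v = g' v" if "v \<in> verts K" for v
  proof -
    have "\<forall>v\<in>set vs. Node (\<nu> v) (enc_colour (g v)) = Node (\<nu> v) (enc_colour (g' v))"
      using v vs by simp
    then show ?thesis using that 1(1) by simp
  qed
  then have "g = g'" using assms(4,5) unfolding K by (rule PiE_ext[rotated 2])
  with K show ?thesis by simp
qed

locale encoded_graph =
  fixes \<nu> :: "'v \<Rightarrow> data" and I :: data and G :: "'v ugraph" and f :: "'v colouring"
  assumes inj: "inj \<nu>" and enc: "encodes_instance \<nu> I G f"
    and ugraph: "ugraph G" and connected: "connected_graph G"
begin

lemma enc_lists: "\<exists>vs es. distinct vs \<and> set vs = verts G \<and>
   distinct (map (\<lambda>(u, w). {u, w}) es) \<and> set (map (\<lambda>(u, w). {u, w}) es) = edges G \<and>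
   items (dfst I) = map (\<lambda>v. Node (\<nu> v) (enc_colour (f v))) vs \<and>
   items (dsnd I) = map (\<lambda>(u, w). Node (\<nu> u) (\<nu> w)) es \<and>
   items (verts_of I) = map \<nu> vs"
  using enc unfolding encodes_instance_def verts_of_def by (fastforce simp: o_def)

lemma verts_list: "\<exists>vs. distinct vs \<and> set vs = verts G \<and> items (verts_of I) = map \<nu> vs"
  using enc_lists by blast

lemma in_verts_of: "set (items (verts_of I)) = \<nu> ` verts G"
  using verts_list by auto

lemma edge_in_iff: "edge_in I (\<nu> a) (\<nu> b) \<longleftrightarrow> adj G a b"
proof -
  obtain es where es: "set (map (\<lambda>(u, w). {u, w}) es) = edges G"
    "items (dsnd I) = map (\<lambda>(u, w). Node (\<nu> u) (\<nu> w)) es"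
    using enc_lists by blast
  have "Node (\<nu> a) (\<nu> b) \<in> set (items (dsnd I)) \<longleftrightarrow> (a, b) \<in> set es" for a b
    using inj_eq[OF inj] by (auto simp: es(2) image_iff intro!: bexI[of _ "(a, b)"])
  moreover have "{a, b} \<in> edges G \<longleftrightarrow> (a, b) \<in> set es \<or> (b, a) \<in> set es"
    unfolding es(1)[symmetric] by (force simp: doubleton_eq_iff)
  ultimately show ?thesis by (simp add: edge_in_def adj_def)
qed

lemma reach_from_component:
  assumes v: "v \<in> verts G" and w: "w \<in> verts G" "w \<noteq> v"
  shows "encodes_set \<nu> (reach_from I (\<nu> v) (\<nu> w)) (component_without G v w)"
proof -
  obtain vs where vs: "distinct vs" "set vs = verts G" "items (verts_of I) = map \<nu> vs"
    using verts_list by blast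
  define F where "F W = {u \<in> verts G - {v}. u \<in> W \<or> (\<exists>r\<in>W. adj G r u)}" for W
  \<comment> \<open>Encodes \<open>W\<close> in the order of \<open>vs\<close>; with a fixed order,
    one round of the search becomes an equation between trees.\<close>
  let ?e = "\<lambda>W. enc_list (map \<nu> (filter (\<lambda>u. u \<in> W) vs))"
  have inj': "\<nu> a = \<nu> b \<longleftrightarrow> a = b" for a b using inj by (rule inj_eq)
  have step: "reach_step I (\<nu> v) (?e W) = ?e (F W)" if "W \<subseteq> verts G" for W
  proof -
    have "set (items (?e W)) = \<nu> ` W" using that vs(2) by auto
    then have "reach_step I (\<nu> v) (?e W) = enc_list (map \<nu> (filter
        (\<lambda>u. u \<noteq> v \<and> (u \<in> W \<or> (\<exists>r\<in>W. adj G r u))) vs))"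
      by (simp add: reach_step_def vs(3) filter_map edge_in_iff inj_image_mem_iff[OF inj] inj' o_def)
    also have "filter (\<lambda>u. u \<noteq> v \<and> (u \<in> W \<or> (\<exists>r\<in>W. adj G r u))) vs = filter (\<lambda>u. u \<in> F W) vs"
      by (rule filter_cong) (auto simp: F_def vs(2)[symmetric])
    finally show ?thesis .
  qed
  have FV: "(F ^^ i) {w} \<subseteq> verts G - {v}" for i
    using w by (cases i) (auto simp: F_def)
  have Fmono: "(F ^^ i) {w} \<subseteq> (F ^^ Suc i) {w}" for i
    using FV[of i] by (auto simp: F_def)
  have "foldl (\<lambda>acc a. reach_step I (\<nu> v) acc) (?e {w}) xs = ?e ((F ^^ length xs) {w})" for xs :: "data list"
  proof (induction xs rule: rev_induct)
    case (snoc x xs)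
    have "(F ^^ length xs) {w} \<subseteq> verts G" using FV by blast
    then show ?case using snoc step by simp
  qed simp
  moreover have "enc_list (filter (\<lambda>u. u = \<nu> w) (items (verts_of I))) = ?e {w}"
    by (simp add: vs(3) filter_map inj' o_def)
  moreover have "length vs = card (verts G)" using vs by (metis distinct_card)
  ultimately have "reach_from I (\<nu> v) (\<nu> w) = ?e ((F ^^ card (verts G)) {w})"
    by (simp add: reach_from_def vs(3))
  moreover have "(F ^^ card (verts G)) {w} = (\<Union>i. (F ^^ i) {w})"
    using finite_chain_limit[of "verts G" F "{w}"] ugraph FV Fmono by (auto simp: ugraph_def)
  moreover have "(\<Union>i. (F ^^ i) {w}) = component_without G v w"
  proof
    have "(F ^^ i) {w} \<subseteq> component_without G v w" for i
    proof (induction i)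
      case (Suc i)
      show ?case
      proof
        fix u assume u: "u \<in> (F ^^ Suc i) {w}"
        show "u \<in> component_without G v w"
        proof (cases "u \<in> (F ^^ i) {w}")
          case False
          then obtain r where r: "r \<in> (F ^^ i) {w}" "adj G r u" "u \<noteq> v" using u by (auto simp: F_def)
          then have "adj (remove_verts G {v}) r u" using FV by auto
          then show ?thesis using Suc r(1)
            by (auto simp: component_without_def intro: rtranclp.rtrancl_into_rtrancl)
        qed (use Suc in blast)
      qed
    qed (simp add: component_without_def)
    then show "(\<Union>i. (F ^^ i) {w}) \<subseteq> component_without G v w" by blast
    show "component_without G v w \<subseteq> (\<Union>i. (F ^^ i) {w})"
    proof
      fix u assume "u \<in> component_without G v w"
      then have "(adj (remove_verts G {v}))\<^sup>*\<^sup>* w u" by (simp add: component_without_def)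
      then show "u \<in> (\<Union>i. (F ^^ i) {w})"
      proof (rule reach_closed)
        show "w \<in> (\<Union>i. (F ^^ i) {w})" by (rule UN_I[of 0]) auto
        fix a b assume "a \<in> (\<Union>i. (F ^^ i) {w})" and ab: "adj (remove_verts G {v}) a b"
        then obtain i where i: "a \<in> (F ^^ i) {w}" by blast
        have "b \<in> (F ^^ Suc i) {w}" using i ab adj_verts[OF ugraph, of a b] by (auto simp: F_def)
        then show "b \<in> (\<Union>i. (F ^^ i) {w})" by blast
      qed
    qed
  qed
  moreover have "component_without G v w \<subseteq> verts G"
    using component_separation[OF ugraph connected v w] by (auto simp: separation_def)
  ultimately show ?thesis
    unfolding encodes_set_def using vs
    by (intro exI[of _ "filter (\<lambda>u. u \<in> component_without G v w) vs"]) auto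
qed

lemma is_cut_iff:
  assumes v: "v \<in> verts G"
  shows "is_cut I (\<nu> v) \<longleftrightarrow> cut_vertex G v"
proof -
  have "\<nu> u \<in> set (items (reach_from I (\<nu> v) (\<nu> w))) \<longleftrightarrow> (adj (remove_verts G {v}))\<^sup>*\<^sup>* w u"
    if "w \<in> verts G" "w \<noteq> v" for u w
    using encodes_set_iff(1)[OF inj reach_from_component[OF v that]] by (simp add: component_without_def)
  then have "(\<exists>u\<in>verts G - {v}. \<nu> u \<notin> set (items (reach_from I (\<nu> v) (\<nu> w)))) \<longleftrightarrow>
      (\<exists>u\<in>verts G - {v}. \<not> (adj (remove_verts G {v}))\<^sup>*\<^sup>* w u)" if "w \<in> verts G - {v}" for w
    using that by simp
  moreover have "is_cut I (\<nu> v) \<longleftrightarrow> (\<exists>w\<in>verts G - {v}. \<exists>u\<in>verts G - {v}.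
      \<nu> u \<notin> set (items (reach_from I (\<nu> v) (\<nu> w))))"
    unfolding is_cut_def in_verts_of using inj_eq[OF inj] by auto
  ultimately show ?thesis
    unfolding cut_vertex_iff[OF ugraph connected] using v by blast
qed

lemma is_leaf_iff:
  assumes v: "v \<in> verts G" and w: "w \<in> verts G"
  shows "is_leaf I (\<nu> v) (\<nu> w) \<longleftrightarrow>
    cut_vertex G v \<and> w \<noteq> v \<and> (\<forall>u\<in>component_without G v w. \<not> cut_vertex G u)"
proof (cases "w = v")
  case False
  have sub: "component_without G v w \<subseteq> verts G"
    using component_separation[OF ugraph connected v w False] by (auto simp: separation_def)
  note e = encodes_set_iff[OF inj reach_from_component[OF v w False]]
  have "(\<exists>u\<in>set (items (reach_from I (\<nu> v) (\<nu> w))). is_cut I u) \<longleftrightarrow>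
      (\<exists>u\<in>component_without G v w. cut_vertex G u)"
    using e is_cut_iff sub by (metis subsetD)
  then show ?thesis using False by (simp add: is_leaf_def is_cut_iff[OF v] inj_eq[OF inj])
qed (simp add: is_leaf_def)

lemma cut_list_eq_Leaf: "cut_list I = Leaf \<longleftrightarrow> two_connected G"
proof -
  have "cut_list I = Leaf \<longleftrightarrow> \<not> (\<exists>v\<in>verts G. cut_vertex G v)"
    using is_cut_iff by (auto simp: cut_list_def filter_empty_conv in_verts_of)
  then show ?thesis using connected by (auto simp: two_connected_def cut_vertex_def)
qed

lemma leaf_found:
  assumes "\<not> two_connected G"
  shows "\<exists>v w. leaf_vertex I = \<nu> v \<and> leaf_start I (\<nu> v) = \<nu> w \<and> cut_vertex G v \<and>
    w \<in> verts G \<and> w \<noteq> v \<and> (\<forall>u\<in>component_without G v w. \<not> cut_vertex G u)"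
proof -
  obtain vs where vs: "set vs = verts G" "items (verts_of I) = map \<nu> vs"
    using verts_list by blast
  obtain v0 where "cut_vertex G v0" using assms connected by (auto simp: two_connected_def)
  from leaf_component_exists[OF ugraph connected this] obtain v1 w1 where
    vw1: "cut_vertex G v1" "w1 \<in> verts G" "w1 \<noteq> v1" "\<And>u. u \<in> component_without G v1 w1 \<Longrightarrow> \<not> cut_vertex G u"
    by metis
  then have v1: "v1 \<in> verts G" by (simp add: cut_vertex_def)
  have "is_leaf I (\<nu> v1) (\<nu> w1)" using is_leaf_iff[OF v1] vw1 by blast
  then have "\<exists>v\<in>set vs. \<exists>w\<in>set (items (verts_of I)). is_leaf I (\<nu> v) w"
    using v1 vw1(2) vs(1) in_verts_of by blast
  from dfst_filter[OF this] obtain v where v: "v \<in> verts G" "leaf_vertex I = \<nu> v"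
    "\<exists>w\<in>set vs. is_leaf I (\<nu> v) (\<nu> w)"
    using vs by (auto simp: leaf_vertex_def)
  from dfst_filter[OF v(3)] obtain w where w: "w \<in> verts G" "leaf_start I (\<nu> v) = \<nu> w"
    "is_leaf I (\<nu> v) (\<nu> w)"
    using vs by (auto simp: leaf_start_def)
  show ?thesis using v w is_leaf_iff[OF v(1) w(1)] by blast
qed

lemma encodes_induced:
  assumes X: "X \<subseteq> verts G" "encodes_set \<nu> x X"
  shows "encodes_instance \<nu> (induced I x (\<nu> v) (enc_colour c)) (induce G X) (f(v := c))"
proof -
  obtain vs es where L: "distinct vs" "set vs = verts G"
    "distinct (map (\<lambda>(u, w). {u, w}) es)" "set (map (\<lambda>(u, w). {u, w}) es) = edges G"
    "items (dfst I) = map (\<lambda>v. Node (\<nu> v) (enc_colour (f v))) vs"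
    "items (dsnd I) = map (\<lambda>(u, w). Node (\<nu> u) (\<nu> w)) es"
    using enc_lists by blast
  note x = encodes_set_iff(1)[OF inj X(2)]
  let ?vs = "filter (\<lambda>v. v \<in> X) vs" and ?es = "filter (\<lambda>(u, w). u \<in> X \<and> w \<in> X) es"
  have "distinct ?vs" "set ?vs = verts (induce G X)" using L(1,2) X(1) by auto
  moreover have "distinct (map (\<lambda>(u, w). {u, w}) ?es)" using L(3) by (rule distinct_map_filter)
  moreover have "set (map (\<lambda>(u, w). {u, w}) ?es) = edges (induce G X)"
    unfolding induce_def by (auto simp: L(4)[symmetric])
  moreover have "induced I x (\<nu> v) (enc_colour c) =
      Node (enc_list (map (\<lambda>u. Node (\<nu> u) (enc_colour ((f(v := c)) u))) ?vs))
           (enc_list (map (\<lambda>(u, w). Node (\<nu> u) (\<nu> w)) ?es))"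
    by (auto simp: induced_def L(5,6) filter_map o_def x inj_eq[OF inj] case_prod_unfold
        intro!: arg_cong[where f = enc_list])
  ultimately show ?thesis unfolding encodes_instance_def by blast
qed

lemma encodes_removal:
  assumes "encodes_set \<nu> x X"
  shows "encodes_set \<nu> (removal I x) (verts G - X)"
proof -
  obtain vs where vs: "distinct vs" "set vs = verts G" "items (verts_of I) = map \<nu> vs"
    using verts_list by blast
  have "{v \<in> set vs. \<nu> v \<notin> set (items x)} = verts G - X"
    using encodes_set_iff(1)[OF inj assms] vs by auto
  then show ?thesis using encodes_set_filter[OF vs(1), of \<nu> "\<lambda>a. a \<notin> set (items x)"]
    by (simp add: removal_def vs(3))
qed

lemma colour_of_eq: "v \<in> verts G \<Longrightarrow> colour_of I (\<nu> v) = enc_colour (f v)"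
proof -
  assume v: "v \<in> verts G"
  obtain vs where vs: "set vs = verts G" "items (dfst I) = map (\<lambda>v. Node (\<nu> v) (enc_colour (f v))) vs"
    using enc_lists by blast
  have "\<exists>u\<in>set vs. dfst (Node (\<nu> u) (enc_colour (f u))) = \<nu> v" using v vs by auto
  from dfst_filter[of vs "\<lambda>p. dfst p = \<nu> v", OF this] show ?thesis
    using inj_eq[OF inj] by (auto simp: colour_of_def vs(2))
qed

end

section \<open>The program\<close>

definition solver_domain :: "('v \<Rightarrow> data) \<Rightarrow> data set" where
  "solver_domain \<nu> = {x. \<exists>K g. ugraph K \<and> two_connected K \<and> g \<in> colourings K \<and> encodes_instance \<nu> x K g}"

text \<open>Represents the program for \<open>crSDS\<close> by a function on trees. Its answer may
  depend on the order and orientation used in the encoding, not only on \<open>K\<close> and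
  \<open>g\<close>.\<close>

definition solver :: "('v \<Rightarrow> data) \<Rightarrow> 'v procedure \<Rightarrow> (data \<Rightarrow> data) \<Rightarrow> bool" where
  "solver \<nu> crSDS sol \<longleftrightarrow> ptime_on (solver_domain \<nu>) sol \<and>
     (\<forall>K g x. ugraph K \<and> two_connected K \<and> g \<in> colourings K \<and> encodes_instance \<nu> x K g \<longrightarrow>
        (\<exists>y S n. sol x = Node y (enc_nat n) \<and> encodes_set \<nu> y S \<and> crSDS K g (S, n)))"

lemma solver_exists:
  assumes "inj \<nu>" "procedure_poly_time \<nu> crSDS"
  shows "\<exists>sol. solver \<nu> crSDS sol"
proof -
  define valid where "valid K g x \<longleftrightarrow> ugraph K \<and> two_connected K \<and> g \<in> colourings K \<and> encodes_instance \<nu> x K g"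
    for K :: "'a ugraph" and g x
  obtain p and q :: "nat poly" where pq: "\<And>K g x. valid K g x \<Longrightarrow>
      \<exists>y S n t. exec p x (Node y (enc_nat n)) t \<and> t \<le> poly q (size x) \<and> encodes_set \<nu> y S \<and> crSDS K g (S, n)"
    using assms(2) unfolding procedure_poly_time_def valid_def by metis
  \<comment> \<open>The choice depends on the tree only, so the instance that witnesses
    \<open>good\<close> might differ from a given one; uniqueness of the encoded instance identifies
    them.\<close>
  define good where "good x z \<longleftrightarrow> (\<exists>t. exec p x z t \<and> t \<le> poly q (size x)) \<and>
      (\<exists>K g y S n. valid K g x \<and> z = Node y (enc_nat n) \<and> encodes_set \<nu> y S \<and> crSDS K g (S, n))" for x z
  define sol where "sol x = (SOME z. good x z)" for x
  have good: "good x (sol x)" if "valid K g x" for K g x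
  proof -
    have "\<exists>z. good x z" using pq[OF that] that unfolding good_def by blast
    then show ?thesis unfolding sol_def by (rule someI_ex)
  qed
  have "ptime_on (solver_domain \<nu>) sol"
  proof (rule ptime_onI)
    fix x assume "x \<in> solver_domain \<nu>"
    then obtain K g where "valid K g x" by (auto simp: solver_domain_def valid_def)
    from good[OF this] show "\<exists>t. exec p x (sol x) t \<and> t \<le> poly q (size x)" by (simp add: good_def)
  qed
  moreover have "\<exists>y S n. sol x = Node y (enc_nat n) \<and> encodes_set \<nu> y S \<and> crSDS K g (S, n)"
    if v: "valid K g x" for K g x
  proof -
    from good[OF v] obtain K' g' y S n where z: "valid K' g' x" "sol x = Node y (enc_nat n)"
      "encodes_set \<nu> y S" "crSDS K' g' (S, n)"
      unfolding good_def by blast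
    have "K = K' \<and> g = g'"
      using v z(1) unfolding valid_def by (intro encodes_instance_unique[OF assms(1)]) auto
    then show ?thesis using z by blast
  qed
  ultimately show ?thesis unfolding solver_def valid_def by blast
qed

text \<open>Read as a list, the pair has the cut vertex as head and the component as tail: it lists
  the vertices of the block, and \<open>dfst\<close> recovers the cut vertex.\<close>

definition select_leaf :: "data \<Rightarrow> data" where
  "select_leaf st = Node (leaf_vertex (dfst st))
     (reach_from (dfst st) (leaf_vertex (dfst st)) (leaf_start (dfst st) (leaf_vertex (dfst st))))"

definition query :: "colour \<Rightarrow> data \<Rightarrow> data \<Rightarrow> data" where
  "query c I l = induced I l (dfst l) (enc_colour c)"

text \<open>The minimum sizes need only equality tests: a solution for \<open>One\<close> is one for \<open>HatZero\<close>, so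
  the sizes of these two can only compare as \<open>\<ge>\<close>.\<close>

definition update :: "data \<Rightarrow> data \<Rightarrow> (colour \<Rightarrow> data) \<Rightarrow> data" where
  "update st l r = Node
     (induced (dfst st) (removal (dfst st) (dsnd l)) (dfst l)
       (if dsnd (r One) = dsnd (r HatZero) \<and> dsnd (r HatZero) = dsnd (r Zero) then enc_colour One
        else if dsnd (r HatZero) = dsnd (r Zero) then
          (if colour_of (dfst st) (dfst l) = enc_colour One then enc_colour One else enc_colour Zero)
        else colour_of (dfst st) (dfst l)))
     (union_of
       (if dsnd (r One) = dsnd (r HatZero) \<and> dsnd (r HatZero) = dsnd (r Zero) then dfst (r One)
        else if dsnd (r HatZero) = dsnd (r Zero) then dfst (r HatZero)
        else dfst (r Zero))
       (dsnd st))"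

definition loop_body :: "(data \<Rightarrow> data) \<Rightarrow> data \<Rightarrow> data" where
  "loop_body sol st = update st (select_leaf st) (\<lambda>c. sol (query c (dfst st) (select_leaf st)))"

definition encodes_state :: "('v \<Rightarrow> data) \<Rightarrow> data \<Rightarrow> 'v ugraph \<Rightarrow> 'v colouring \<Rightarrow> 'v set \<Rightarrow> bool" where
  "encodes_state \<nu> st G f S \<longleftrightarrow> (\<exists>I s. st = Node I s \<and> encodes_instance \<nu> I G f \<and> encodes_set \<nu> s S)"

lemma remove_verts_eq_induce: "ugraph G \<Longrightarrow> remove_verts G X = induce G (verts G - X)"
  by (auto simp: remove_verts_def induce_def ugraph_def)

lemma selected_leaf:
  assumes inj: "inj \<nu>" and G: "ugraph G" "connected_graph G" "\<not> two_connected G"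
    and st: "encodes_state \<nu> st G f S"
  shows "\<exists>v C x. select_leaf st = Node (\<nu> v) x \<and> encodes_set \<nu> x C \<and>
    encodes_set \<nu> (select_leaf st) (insert v C) \<and> separation G v C \<and> v \<in> verts G \<and>
    block (induce G (insert v C)) G \<and> {u \<in> insert v C. cut_vertex G u} = {v}"
proof -
  obtain I s where I: "st = Node I s" "encodes_instance \<nu> I G f"
    using st by (auto simp: encodes_state_def)
  interpret encoded_graph \<nu> I G f by unfold_locales (use inj I G in auto)
  from leaf_found[OF G(3)] obtain v w where vw: "leaf_vertex I = \<nu> v" "leaf_start I (\<nu> v) = \<nu> w"
    "cut_vertex G v" "w \<in> verts G" "w \<noteq> v" "\<And>u. u \<in> component_without G v w \<Longrightarrow> \<not> cut_vertex G u"
    by blast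
  let ?C = "component_without G v w"
  have v: "v \<in> verts G" using vw(3) by (simp add: cut_vertex_def)
  have sep: "separation G v ?C" using component_separation[OF G(1,2) v vw(4,5)] .
  have enc: "encodes_set \<nu> (reach_from I (\<nu> v) (\<nu> w)) ?C" using reach_from_component[OF v vw(4,5)] .
  have sel: "select_leaf st = Node (\<nu> v) (reach_from I (\<nu> v) (\<nu> w))"
    using vw(1,2) I(1) by (simp add: select_leaf_def)
  obtain cs where cs: "distinct cs" "set cs = ?C" "reach_from I (\<nu> v) (\<nu> w) = enc_list (map \<nu> cs)"
    using enc by (auto simp: encodes_set_def)
  have "encodes_set \<nu> (select_leaf st) (insert v ?C)"
    unfolding encodes_set_def using cs separation.v_notin[OF sep]
    by (intro exI[of _ "v # cs"]) (simp add: sel)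
  moreover have "block (induce G (insert v ?C)) G" "{u \<in> verts (induce G (insert v ?C)). cut_vertex G u} = {v}"
    by (rule leaf_block_of_component[OF G(1,2) vw(3-6)]; assumption)+
  ultimately show ?thesis using sel enc sep v
    by (intro exI[of _ v] exI[of _ ?C] exI[of _ "reach_from I (\<nu> v) (\<nu> w)"]) simp
qed

lemma encodes_query:
  assumes inj: "inj \<nu>" and G: "ugraph G" "connected_graph G"
    and I: "encodes_instance \<nu> I G f" and X: "encodes_set \<nu> l (insert v C)" "dfst l = \<nu> v"
    and B: "block (induce G (insert v C)) G"
  shows "encodes_instance \<nu> (query c I l) (induce G (insert v C)) ((restrict f (insert v C))(v := c))"
proof -
  interpret encoded_graph \<nu> I G f by unfold_locales (use inj I G in auto)
  have "insert v C \<subseteq> verts G" using B by (auto simp: block_def subgraph_def)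
  from encodes_induced[OF this X(1), of v c]
  show ?thesis unfolding query_def X(2) by (rule encodes_instance_cong) auto
qed

text \<open>One run of the body is one \<open>step\<close> with a particular block and particular
  answers. The inclusions feed the size bound on later states.\<close>

lemma loop_body_step:
  assumes crsds: "crsds_procedure crSDS" and inj: "inj \<nu>" and sol: "solver \<nu> crSDS sol"
    and G: "ugraph G" "connected_graph G" "f \<in> colourings G" "\<not> two_connected G"
    and st: "encodes_state \<nu> st G f S"
  shows "\<exists>G' f' S'. step crSDS (Loop G f S) (Loop G' f' S') \<and> encodes_state \<nu> (loop_body sol st) G' f' S' \<and>
    verts G' \<subseteq> verts G \<and> edges G' \<subseteq> edges G \<and> S' \<subseteq> S \<union> verts G"
proof -
  obtain I s where I: "st = Node I s" "encodes_instance \<nu> I G f" "encodes_set \<nu> s S"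
    using st by (auto simp: encodes_state_def)
  interpret encoded_graph \<nu> I G f by unfold_locales (use inj I G in auto)
  from selected_leaf[OF inj G(1,2,4) st] obtain v C x where l: "select_leaf st = Node (\<nu> v) x"
    "encodes_set \<nu> x C" "encodes_set \<nu> (select_leaf st) (insert v C)" "separation G v C" "v \<in> verts G"
    "block (induce G (insert v C)) G" "{u \<in> insert v C. cut_vertex G u} = {v}" by blast
  interpret separation G v C using l(4) .
  define r where "r c = sol (query c I (select_leaf st))" for c
  have B: "two_connected B" using l(6) by (simp add: block_def)
  have vB: "v \<in> verts B" by simp
  have rec: "(restrict f (insert v C))(v := c) \<in> colourings B" for c
    using recolour_in_colourings[OF vB, of f c] unfolding verts_induce .
  have "\<exists>y S n. r c = Node y (enc_nat n) \<and> encodes_set \<nu> y S \<and>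
      crSDS B ((restrict f (insert v C))(v := c)) (S, n)" for c
    unfolding r_def using sol ugraph_B B rec encodes_query[OF inj G(1,2) I(2) l(3) _ l(6), of c] l(1)
    unfolding solver_def by (metis dfst.simps(2))
  then obtain y Sc num where r: "\<And>c. r c = Node (y c) (enc_nat (num c))" "\<And>c. encodes_set \<nu> (y c) (Sc c)"
    "\<And>c. crSDS B ((restrict f (insert v C))(v := c)) (Sc c, num c)"
    by metis
  have min: "minimum_respecting_sds B ((restrict f (insert v C))(v := c)) (Sc c) \<and> num c = card (Sc c)" for c
    by (rule crsds_minimum[OF crsds ugraph_B B rec r(3)])
  have min': "minimum_respecting_sds B (f(v := c)) (Sc c)" for c
  proof -
    have "(f(v := c)) x = ((restrict f (insert v C))(v := c)) x" if "x \<in> verts B" for x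
      using that by auto
    from minimum_respecting_sds_cong[of B "f(v := c)" "(restrict f (insert v C))(v := c)", OF this] min[of c]
    show ?thesis by blast
  qed
  have le: "num HatZero \<le> num One" using minimum_colour_bounds(2)[OF min'] min by simp
  define c' where "c' = (if num One = num HatZero \<and> num HatZero = num Zero then One
        else if num HatZero = num Zero then (if f v = One then One else Zero) else f v)"
  define D where "D = (if num One = num HatZero \<and> num HatZero = num Zero then Sc One
        else if num HatZero = num Zero then Sc HatZero else Sc Zero)"
  have cD: "(c', D) =
       (if num One = num HatZero \<and> num HatZero = num Zero then (One, Sc One)
        else if num One > num HatZero \<and> num HatZero = num Zero
          then (best {f v, Zero}, Sc HatZero)
        else (f v, Sc Zero))"
    using le by (auto simp: c'_def D_def best_Zero)
  have vC: "verts B - {v} = C" using v_notin by auto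
  have "step crSDS (Loop G f S) (Loop G' (restrict (f(v := c')) (verts G')) (S \<union> D))"
  proof (rule iterate[where B = B and v = v and Sc = Sc and num = num])
    show "{u \<in> verts B. cut_vertex G u} = {v}" using l(7) by simp
    show "\<forall>c. crSDS B ((restrict f (verts B))(v := c)) (Sc c, num c)" using r(3) by simp
    show "G' = remove_verts G (verts B - {v})" using vC by simp
  qed (use G(4) l(6) cD in auto)
  moreover have "encodes_state \<nu> (loop_body sol st) G' (restrict (f(v := c')) (verts G')) (S \<union> D)"
  proof -
    have body: "loop_body sol st = Node (induced I (removal I x) (\<nu> v) (enc_colour c'))
       (union_of (if num One = num HatZero \<and> num HatZero = num Zero then y One
        else if num HatZero = num Zero then y HatZero else y Zero) s)"
    proof -
      have st: "dfst st = I" "dsnd st = s" using I(1) by simp_all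
      have "loop_body sol st = update st (select_leaf st) r"
        unfolding loop_body_def st r_def ..
      then show ?thesis
        unfolding update_def l(1) st c'_def r(1) dfst.simps dsnd.simps colour_of_eq[OF l(5)]
          enc_colour_inj enc_nat_inj by simp
    qed
    have D: "encodes_set \<nu> (if num One = num HatZero \<and> num HatZero = num Zero then y One
        else if num HatZero = num Zero then y HatZero else y Zero) D"
      using r(2) by (simp add: D_def)
    have "encodes_instance \<nu> (induced I (removal I x) (\<nu> v) (enc_colour c')) (induce G (verts G - C)) (f(v := c'))"
      by (rule encodes_induced[OF _ encodes_removal[OF l(2)]]) auto
    then have "encodes_instance \<nu> (induced I (removal I x) (\<nu> v) (enc_colour c')) G' (f(v := c'))"
      using remove_verts_eq_induce[OF G(1)] by simp
    then have "encodes_instance \<nu> (induced I (removal I x) (\<nu> v) (enc_colour c')) G' (restrict (f(v := c')) (verts G'))"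
      by (rule encodes_instance_cong) simp
    then show ?thesis
      using encodes_set_union[OF inj D I(3)] unfolding encodes_state_def body by (auto simp: Un_commute)
  qed
  moreover have "D \<subseteq> verts G"
  proof -
    have "Sc c \<subseteq> verts G" for c
      using min'[of c] B_subset by (auto simp: minimum_respecting_sds_def respecting_sds_def)
    then show ?thesis by (simp add: D_def)
  qed
  moreover have "edges G' \<subseteq> edges G" by (auto simp: remove_verts_def)
  ultimately show ?thesis by (intro exI conjI; assumption?) auto
qed

section \<open>Size bounds along the loop\<close>

lemma size_encodes_set:
  assumes "encodes_set \<nu> y A"
  shows "size y = (\<Sum>a\<in>A. Suc (size (\<nu> a)))"
  using assms by (auto simp: encodes_set_def size_enc_list o_def sum_list_distinct_conv_sum_set)

text \<open>The size depends on the graph and the colouring, not on order or orientation, which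
  makes encodings of different graphs comparable. The 2 in each entry counts a list cell and a
  pair.\<close>

lemma size_encodes_instance:
  assumes "ugraph G" "encodes_instance \<nu> x G f"
  shows "size x = (\<Sum>v\<in>verts G. size (\<nu> v) + size (enc_colour (f v)) + 2) +
    (\<Sum>e\<in>edges G. (\<Sum>u\<in>e. size (\<nu> u)) + 2) + 1"
proof -
  obtain vs es where L: "distinct vs" "set vs = verts G"
    "distinct (map (\<lambda>(u, w). {u, w}) es)" "set (map (\<lambda>(u, w). {u, w}) es) = edges G"
    "x = Node (enc_list (map (\<lambda>v. Node (\<nu> v) (enc_colour (f v))) vs))
       (enc_list (map (\<lambda>(u, w). Node (\<nu> u) (\<nu> w)) es))"
    using assms(2) unfolding encodes_instance_def by blast
  have "size (enc_list (map (\<lambda>v. Node (\<nu> v) (enc_colour (f v))) vs)) =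
      (\<Sum>v\<leftarrow>vs. size (\<nu> v) + size (enc_colour (f v)) + 2)"
    by (simp add: size_enc_list o_def)
  also have "\<dots> = (\<Sum>v\<in>verts G. size (\<nu> v) + size (enc_colour (f v)) + 2)"
    using sum_list_distinct_conv_sum_set[OF L(1)] L(2) by simp
  finally have 1: "size (enc_list (map (\<lambda>v. Node (\<nu> v) (enc_colour (f v))) vs)) = \<dots>" .
  let ?h = "\<lambda>e. (\<Sum>u\<in>e. size (\<nu> u)) + 2"
  have eq: "map (\<lambda>(u, w). Suc (size (Node (\<nu> u) (\<nu> w)))) es = map ?h (map (\<lambda>(u, w). {u, w}) es)"
  proof -
    \<comment> \<open>Without loops the sum over \<open>{u, w}\<close> counts both ends.\<close>
    have "u \<noteq> w" if "(u, w) \<in> set es" for u w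
    proof -
      have "{u, w} \<in> edges G" using that unfolding L(4)[symmetric] by force
      then have "card {u, w} = 2" using assms(1) by (simp add: ugraph_def)
      then show ?thesis by auto
    qed
    then show ?thesis by auto
  qed
  have "size (enc_list (map (\<lambda>(u, w). Node (\<nu> u) (\<nu> w)) es)) =
      sum_list (map (\<lambda>(u, w). Suc (size (Node (\<nu> u) (\<nu> w)))) es)"
    by (simp add: size_enc_list o_def case_prod_unfold)
  also have "\<dots> = sum_list (map ?h (map (\<lambda>(u, w). {u, w}) es))"
    by (simp only: eq)
  also have "\<dots> = (\<Sum>e\<in>edges G. ?h e)"
    using sum_list_distinct_conv_sum_set[OF L(3), of ?h] L(4) by simp
  finally show ?thesis using 1 L(5) by simp
qed

lemma size_enc_colour: "size (enc_colour c) \<le> 2"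
  by (cases c) auto

text \<open>A colour code has size at most 2, no more than the 2 already present in each vertex
  entry, so recolouring at most doubles the vertex part. The collected set \<open>S\<close> takes a
  third share.\<close>

lemma size_encodes_state:
  assumes G0: "ugraph G0" "encodes_instance \<nu> x G0 f0"
    and G: "ugraph G" "verts G \<subseteq> verts G0" "edges G \<subseteq> edges G0" "S \<subseteq> verts G0"
    and st: "encodes_state \<nu> st G f S"
  shows "size st \<le> 3 * size x + 1"
proof -
  obtain I s where I: "st = Node I s" "encodes_instance \<nu> I G f" "encodes_set \<nu> s S"
    using st by (auto simp: encodes_state_def)
  have fin: "finite (verts G0)" "finite (edges G0)"
    using G0(1) finite_edges by (auto simp: ugraph_def)
  have "(\<Sum>v\<in>verts G. size (\<nu> v) + size (enc_colour (f v)) + 2) \<le> (\<Sum>v\<in>verts G. 2 * (size (\<nu> v) + size (enc_colour (f0 v)) + 2))"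
  proof (rule sum_mono)
    fix v
    show "size (\<nu> v) + size (enc_colour (f v)) + 2 \<le> 2 * (size (\<nu> v) + size (enc_colour (f0 v)) + 2)"
      using size_enc_colour[of "f v"] by simp
  qed
  also have "\<dots> \<le> (\<Sum>v\<in>verts G0. 2 * (size (\<nu> v) + size (enc_colour (f0 v)) + 2))"
    using fin G by (intro sum_mono2) auto
  finally have v: "(\<Sum>v\<in>verts G. size (\<nu> v) + size (enc_colour (f v)) + 2) \<le>
      2 * (\<Sum>v\<in>verts G0. size (\<nu> v) + size (enc_colour (f0 v)) + 2)"
    by (simp only: sum_distrib_left)
  have e: "(\<Sum>e\<in>edges G. (\<Sum>u\<in>e. size (\<nu> u)) + 2) \<le> (\<Sum>e\<in>edges G0. (\<Sum>u\<in>e. size (\<nu> u)) + 2)"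
    using fin G by (intro sum_mono2) auto
  have "(\<Sum>a\<in>S. Suc (size (\<nu> a))) \<le> (\<Sum>a\<in>verts G0. Suc (size (\<nu> a)))"
    using fin G by (intro sum_mono2) auto
  also have "\<dots> \<le> (\<Sum>v\<in>verts G0. size (\<nu> v) + size (enc_colour (f0 v)) + 2)"
    by (rule sum_mono) simp
  finally have "size s \<le> (\<Sum>v\<in>verts G0. size (\<nu> v) + size (enc_colour (f0 v)) + 2)"
    using size_encodes_set[OF I(3)] by simp
  then show ?thesis
    using v e size_encodes_instance[OF G0] size_encodes_instance[OF G(1) I(2)] I(1) by simp
qed

section \<open>Running the loop on encodings\<close>

lemma iterate_until:
  fixes m :: "'a \<Rightarrow> nat"
  assumes "\<And>s. P s \<Longrightarrow> \<not> Q s \<Longrightarrow> P (F s) \<and> m (F s) < m s" and "P s"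
  shows "\<exists>n \<le> m s. Q ((F ^^ n) s) \<and> (\<forall>i<n. \<not> Q ((F ^^ i) s)) \<and> (\<forall>i\<le>n. P ((F ^^ i) s))"
  using assms(2)
proof (induction "m s" arbitrary: s rule: less_induct)
  case less
  show ?case
  proof (cases "Q s")
    case True
    then show ?thesis using less.prems by (intro exI[of _ 0]) simp
  next
    case False
    then have F: "P (F s)" "m (F s) < m s" using assms(1) less.prems by auto
    from less.hyps[OF F(2,1)] obtain n where n: "n \<le> m (F s)" "Q ((F ^^ n) (F s))"
      "\<And>i. i < n \<Longrightarrow> \<not> Q ((F ^^ i) (F s))" "\<And>i. i \<le> n \<Longrightarrow> P ((F ^^ i) (F s))" by blast
    have sw: "(F ^^ i) (F s) = (F ^^ Suc i) s" for i by (simp add: funpow_swap1)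
    have "\<not> Q ((F ^^ i) s)" if "i < Suc n" for i
      using that False n(3)[of "i - 1"] sw[of "i - 1"] by (cases i) auto
    moreover have "P ((F ^^ i) s)" if "i \<le> Suc n" for i
      using that less.prems n(4)[of "i - 1"] sw[of "i - 1"] by (cases i) auto
    ultimately show ?thesis using n(1,2) F(2) sw[of n] by (intro exI[of _ "Suc n"]) auto
  qed
qed

text \<open>\<open>LEAST\<close> fixes the number of rounds from the tree alone, so that the loop
  becomes a function on trees.\<close>

definition loop_result :: "(data \<Rightarrow> data) \<Rightarrow> data \<Rightarrow> data" where
  "loop_result sol st =
     (loop_body sol ^^ (LEAST n. cut_list (dfst ((loop_body sol ^^ n) st)) = Leaf)) st"

definition algorithm_result :: "(data \<Rightarrow> data) \<Rightarrow> data \<Rightarrow> data" where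
  "algorithm_result sol x = union_of
     (dfst (sol (dfst (loop_result sol (Node x Leaf))))) (dsnd (loop_result sol (Node x Leaf)))"

definition algorithm_domain :: "('v \<Rightarrow> data) \<Rightarrow> data set" where
  "algorithm_domain \<nu> =
     {x. \<exists>G f. ugraph G \<and> connected_graph G \<and> f \<in> colourings G \<and> encodes_instance \<nu> x G f}"

text \<open>The number of vertices is at most the size of the encoding and drops in every iteration, so
  it bounds the number of iterations.\<close>

lemma loop_run:
  assumes crsds: "crsds_procedure crSDS" and inj: "inj \<nu>" and sol: "solver \<nu> crSDS sol"
    and G0: "ugraph G0" "connected_graph G0" "f0 \<in> colourings G0" "encodes_instance \<nu> x G0 f0"
  defines "F \<equiv> loop_body sol" and "st0 \<equiv> Node x Leaf"
  shows "\<exists>n \<le> size x. loop_result sol st0 = (F ^^ n) st0 \<and> cut_list (dfst ((F ^^ n) st0)) = Leaf \<and>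
    (\<forall>i<n. cut_list (dfst ((F ^^ i) st0)) \<noteq> Leaf) \<and>
    (\<forall>i\<le>n. \<exists>G f S. ugraph G \<and> connected_graph G \<and> f \<in> colourings G \<and> encodes_state \<nu> ((F ^^ i) st0) G f S \<and>
       (step crSDS)\<^sup>*\<^sup>* (Loop G0 f0 {}) (Loop G f S) \<and> size ((F ^^ i) st0) \<le> 3 * size x + 1)"
proof -
  \<comment> \<open>The tree encodes a configuration reachable by \<open>step\<close> whose graph
    and collected set stay inside the initial graph, as the size bound requires.\<close>
  define P where "P st \<longleftrightarrow> (\<exists>G f S. ugraph G \<and> connected_graph G \<and> f \<in> colourings G \<and> encodes_state \<nu> st G f S \<and>
      (step crSDS)\<^sup>*\<^sup>* (Loop G0 f0 {}) (Loop G f S) \<and>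
      verts G \<subseteq> verts G0 \<and> edges G \<subseteq> edges G0 \<and> S \<subseteq> verts G0)" for st
  define m where "m st = length (items (verts_of (dfst st)))" for st
  have m: "m st = card (verts G)" if e: "encodes_state \<nu> st G f S" "ugraph G" "connected_graph G" for st G f S
  proof -
    obtain I s where I: "st = Node I s" "encodes_instance \<nu> I G f"
      using e(1) by (auto simp: encodes_state_def)
    interpret encoded_graph \<nu> I G f by unfold_locales (use inj I e in auto)
    obtain vs where "distinct vs" "set vs = verts G" "items (verts_of I) = map \<nu> vs"
      using verts_list by blast
    then show ?thesis using distinct_card[of vs] I(1) by (simp add: m_def)
  qed
  have cut: "cut_list (dfst st) = Leaf \<longleftrightarrow> two_connected G"
    if e: "encodes_state \<nu> st G f S" "ugraph G" "connected_graph G" for st G f S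
  proof -
    obtain I s where I: "st = Node I s" "encodes_instance \<nu> I G f"
      using e(1) by (auto simp: encodes_state_def)
    interpret encoded_graph \<nu> I G f by unfold_locales (use inj I e in auto)
    show ?thesis using cut_list_eq_Leaf I(1) by simp
  qed
  have st0: "encodes_state \<nu> st0 G0 f0 {}"
    using G0 by (auto simp: encodes_state_def st0_def encodes_set_def)
  have P0: "P st0" unfolding P_def using G0 st0 by blast
  have step: "P (F st) \<and> m (F st) < m st" if "P st" and ncut: "cut_list (dfst st) \<noteq> Leaf" for st
  proof -
    obtain G f S where G: "ugraph G" "connected_graph G" "f \<in> colourings G" "encodes_state \<nu> st G f S"
      "(step crSDS)\<^sup>*\<^sup>* (Loop G0 f0 {}) (Loop G f S)" "verts G \<subseteq> verts G0" "edges G \<subseteq> edges G0" "S \<subseteq> verts G0"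
      using \<open>P st\<close> unfolding P_def by blast
    have "\<not> two_connected G" using cut[OF G(4,1,2)] ncut by simp
    from loop_body_step[OF crsds inj sol G(1-3) this G(4)] obtain G' f' S' where
      G': "step crSDS (Loop G f S) (Loop G' f' S')" "encodes_state \<nu> (F st) G' f' S'"
      "verts G' \<subseteq> verts G" "edges G' \<subseteq> edges G" "S' \<subseteq> S \<union> verts G"
      unfolding F_def by blast
    \<comment> \<open>Soundness of the configurations yields that the next graph is connected and
      has fewer vertices.\<close>
    have "sound_config G0 f0 (Loop G0 f0 {})" using G0 by simp
    then have "sound_config G0 f0 (Loop G f S)" using steps_sound[OF crsds G(5)] by blast
    from step_sound[OF crsds G'(1) this] have snd: "ugraph G'" "connected_graph G'" "f' \<in> colourings G'"
      "card (verts G') < card (verts G)" by auto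
    have "(step crSDS)\<^sup>*\<^sup>* (Loop G0 f0 {}) (Loop G' f' S')"
      using G(5) G'(1) by (rule rtranclp.rtrancl_into_rtrancl)
    then have "P (F st)" unfolding P_def using G' G(6-8) snd
      by (intro exI[of _ G'] exI[of _ f'] exI[of _ S']) auto
    then show ?thesis using m[OF G(4,1,2)] m[OF G'(2) snd(1,2)] snd(4) by simp
  qed
  from iterate_until[of P "\<lambda>st. cut_list (dfst st) = Leaf" F m, OF step P0] obtain n where
    n: "n \<le> m st0" "cut_list (dfst ((F ^^ n) st0)) = Leaf" "\<And>i. i < n \<Longrightarrow> cut_list (dfst ((F ^^ i) st0)) \<noteq> Leaf"
    "\<And>i. i \<le> n \<Longrightarrow> P ((F ^^ i) st0)" by blast
  have "(LEAST n. cut_list (dfst ((F ^^ n) st0)) = Leaf) = n"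
    using n(2,3) by (intro Least_equality) (auto simp: not_less[symmetric])
  then have "loop_result sol st0 = (F ^^ n) st0" by (simp add: loop_result_def F_def)
  moreover have "m st0 \<le> size x"
  proof -
    have "m st0 \<le> length (items (dfst x))" by (simp add: m_def st0_def verts_of_def)
    also have "\<dots> \<le> size (dfst x)" by (rule length_items)
    also have "\<dots> \<le> size x" by (cases x) auto
    finally show ?thesis .
  qed
  moreover have "\<exists>G f S. ugraph G \<and> connected_graph G \<and> f \<in> colourings G \<and> encodes_state \<nu> ((F ^^ i) st0) G f S \<and>
       (step crSDS)\<^sup>*\<^sup>* (Loop G0 f0 {}) (Loop G f S) \<and> size ((F ^^ i) st0) \<le> 3 * size x + 1" if "i \<le> n" for i
    using n(4)[OF that] size_encodes_state[OF G0(1,4)] unfolding P_def by meson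
  ultimately show ?thesis using n(1-3) by (intro exI[of _ n]) auto
qed

text \<open>The body is polynomial where its three calls are: a failed loop test means that a leaf
  block exists, and this puts the queries into \<open>solver_domain\<close>.\<close>

lemma ptime_loop_body:
  assumes inj: "inj \<nu>" and sol: "solver \<nu> crSDS sol"
  shows "ptime_on {st. cut_list (dfst st) \<noteq> Leaf \<and>
    (\<exists>G f S. ugraph G \<and> connected_graph G \<and> f \<in> colourings G \<and> encodes_state \<nu> st G f S)} (loop_body sol)"
    (is "ptime_on ?D _")
proof -
  have q: "query c (dfst st) (select_leaf st) \<in> solver_domain \<nu>" if st: "st \<in> ?D" for c st
  proof -
    obtain G f S where G: "ugraph G" "connected_graph G" "f \<in> colourings G" "encodes_state \<nu> st G f S"
      "cut_list (dfst st) \<noteq> Leaf" using st by blast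
    obtain I s where I: "st = Node I s" "encodes_instance \<nu> I G f"
      using G(4) by (auto simp: encodes_state_def)
    interpret encoded_graph \<nu> I G f by unfold_locales (use inj I G in auto)
    have "\<not> two_connected G" using cut_list_eq_Leaf I(1) G(5) by simp
    from selected_leaf[OF inj G(1,2) this G(4)] obtain v C x where l: "select_leaf st = Node (\<nu> v) x"
      "encodes_set \<nu> (select_leaf st) (insert v C)" "block (induce G (insert v C)) G" by blast
    have "encodes_instance \<nu> (query c I (select_leaf st)) (induce G (insert v C)) ((restrict f (insert v C))(v := c))"
      by (rule encodes_query[OF inj G(1,2) I(2) l(2) _ l(3)]) (simp add: l(1))
    moreover have "ugraph (induce G (insert v C))" "two_connected (induce G (insert v C))"
      using l(3) by (auto simp: block_def subgraph_def)
    moreover have "(restrict f (insert v C))(v := c) \<in> colourings (induce G (insert v C))"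
      using recolour_in_colourings[of v "induce G (insert v C)" f c] by (simp only: verts_induce insertI1)
    ultimately show ?thesis unfolding solver_domain_def I(1) dfst.simps mem_Collect_eq
      by (intro exI conjI)
  qed
  have o: "ptime_on (solver_domain \<nu>) sol" using sol by (simp add: solver_def)
  have sel: "ptime select_leaf" unfolding select_leaf_def[abs_def] by (intro ptime_rules)
  have "ptime (\<lambda>st. query c (dfst st) (select_leaf st))" for c
    unfolding query_def by (intro ptime_rules sel)
  then have "ptime_on ?D (\<lambda>st. query c (dfst st) (select_leaf st))" for c
    by (rule ptime_on_subset) simp
  from ptime_on_comp[OF this o q]
  have r: "ptime_on ?D (\<lambda>st. sol (query c (dfst st) (select_leaf st)))" for c .
  \<comment> \<open>The work after the calls is polynomial on all trees. It takes the three answers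
    as a tuple, which separates it from \<open>sol\<close>, known to be polynomial only on its
    domain.\<close>
  define U where "U z = update (dfst (dfst z)) (dsnd (dfst z))
    (\<lambda>c. case c of One \<Rightarrow> dfst (dsnd z) | Zero \<Rightarrow> dfst (dsnd (dsnd z)) | HatZero \<Rightarrow> dsnd (dsnd (dsnd z)))" for z
  have U: "ptime U" unfolding U_def update_def colour.case by (intro ptime_rules)
  have "ptime (\<lambda>st. Node st (select_leaf st))" by (intro ptime_rules sel)
  then have "ptime_on ?D (\<lambda>st. Node st (select_leaf st))" by (rule ptime_on_subset) simp
  from ptime_on_comp[OF ptime_on_pair[OF this
      ptime_on_pair[OF r[of One] ptime_on_pair[OF r[of Zero] r[of HatZero]]]] U UNIV_I]
  show ?thesis
    by (rule ptime_on_cong) (simp add: U_def loop_body_def update_def)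
qed

lemma loop_result_state:
  assumes "crsds_procedure crSDS" and inj: "inj \<nu>" and "solver \<nu> crSDS sol"
    and "ugraph G0" "connected_graph G0" "f0 \<in> colourings G0" "encodes_instance \<nu> x G0 f0"
  shows "\<exists>G f S. ugraph G \<and> two_connected G \<and> f \<in> colourings G \<and>
    encodes_state \<nu> (loop_result sol (Node x Leaf)) G f S \<and> (step crSDS)\<^sup>*\<^sup>* (Loop G0 f0 {}) (Loop G f S)"
proof -
  obtain G f S where G: "ugraph G" "connected_graph G" "f \<in> colourings G"
    "encodes_state \<nu> (loop_result sol (Node x Leaf)) G f S" "(step crSDS)\<^sup>*\<^sup>* (Loop G0 f0 {}) (Loop G f S)"
    "cut_list (dfst (loop_result sol (Node x Leaf))) = Leaf"
    using loop_run[OF assms] by (metis order_refl)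
  obtain I s where I: "loop_result sol (Node x Leaf) = Node I s" "encodes_instance \<nu> I G f"
    using G(4) by (auto simp: encodes_state_def)
  interpret encoded_graph \<nu> I G f by unfold_locales (use inj I G in auto)
  have "two_connected G" using cut_list_eq_Leaf G(6) I(1) by simp
  then show ?thesis using G by blast
qed

lemma ptime_algorithm_result:
  assumes crsds: "crsds_procedure crSDS" and inj: "inj \<nu>" and sol: "solver \<nu> crSDS sol"
  shows "ptime_on (algorithm_domain \<nu>) (algorithm_result sol)"
proof -
  let ?init = "\<lambda>x. Node x Leaf"
  have loop: "ptime_on (?init ` algorithm_domain \<nu>) (loop_result sol)"
  \<comment> \<open>\<open>[:1, 3:]\<close> is the bound \<open>3 * size x + 1\<close> of
    \<open>loop_run\<close>, evaluated at the initial state, whose size exceeds that of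
    \<open>x\<close>.\<close>
  proof (rule ptime_on_while[OF ptime_loop_body[OF inj sol], where qn = "[:0, 1:]" and qs = "[:1, 3:]"])
    show "ptime (\<lambda>st. cut_list (dfst st))" by (intro ptime_rules)
    fix st assume "st \<in> ?init ` algorithm_domain \<nu>"
    then obtain x G0 f0 where st: "st = Node x Leaf" and G0: "ugraph G0" "connected_graph G0"
      "f0 \<in> colourings G0" "encodes_instance \<nu> x G0 f0" by (auto simp: algorithm_domain_def)
    from loop_run[OF crsds inj sol G0, folded st] obtain n where n: "n \<le> size x"
      "loop_result sol st = (loop_body sol ^^ n) st" "cut_list (dfst ((loop_body sol ^^ n) st)) = Leaf"
      "\<And>i. i < n \<Longrightarrow> cut_list (dfst ((loop_body sol ^^ i) st)) \<noteq> Leaf"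
      "\<And>i. i \<le> n \<Longrightarrow> \<exists>G f S. ugraph G \<and> connected_graph G \<and> f \<in> colourings G \<and>
         encodes_state \<nu> ((loop_body sol ^^ i) st) G f S \<and>
         (step crSDS)\<^sup>*\<^sup>* (Loop G0 f0 {}) (Loop G f S) \<and> size ((loop_body sol ^^ i) st) \<le> 3 * size x + 1"
      by blast
    have "size ((loop_body sol ^^ i) st) \<le> 3 * size x + 1" if "i \<le> n" for i using n(5)[OF that] by blast
    then have sz: "size ((loop_body sol ^^ i) st) \<le> poly [:1, 3:] (size st)" if "i \<le> n" for i
      using that by (fastforce simp: st)
    have "(loop_body sol ^^ i) st \<in> {st. cut_list (dfst st) \<noteq> Leaf \<and>
      (\<exists>G f S. ugraph G \<and> connected_graph G \<and> f \<in> colourings G \<and> encodes_state \<nu> st G f S)}" if "i < n" for i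
      using n(4)[OF that] n(5)[of i] that by auto
    then show "\<exists>n\<le>poly [:0, 1:] (size st). loop_result sol st = (loop_body sol ^^ n) st \<and>
        cut_list (dfst ((loop_body sol ^^ n) st)) = Leaf \<and>
        (\<forall>i<n. cut_list (dfst ((loop_body sol ^^ i) st)) \<noteq> Leaf \<and> (loop_body sol ^^ i) st \<in>
          {st. cut_list (dfst st) \<noteq> Leaf \<and>
      (\<exists>G f S. ugraph G \<and> connected_graph G \<and> f \<in> colourings G \<and> encodes_state \<nu> st G f S)}) \<and>
        (\<forall>i\<le>n. size ((loop_body sol ^^ i) st) \<le> poly [:1, 3:] (size st))"
      using n(1-4) sz by (intro exI[of _ n] conjI) (simp_all add: st)
  qed
  have "ptime_on (algorithm_domain \<nu>) ?init"
    by (rule ptime_on_subset[of UNIV]) (intro ptime_rules, simp)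
  from ptime_on_comp[OF this loop]
  have L: "ptime_on (algorithm_domain \<nu>) (\<lambda>x. loop_result sol (?init x))" by simp
  have fst: "ptime (\<lambda>x. dfst x)" by (intro ptime_rules)
  \<comment> \<open>The loop ends on a two-connected graph, where the last call is
    permitted.\<close>
  have "dfst (loop_result sol (?init x)) \<in> solver_domain \<nu>" if "x \<in> algorithm_domain \<nu>" for x
    using that loop_result_state[OF crsds inj sol]
    unfolding algorithm_domain_def solver_domain_def encodes_state_def by fastforce
  then have "ptime_on (algorithm_domain \<nu>) (\<lambda>x. sol (dfst (loop_result sol (?init x))))"
    using sol unfolding solver_def by (intro ptime_on_comp[OF ptime_on_comp[OF L fst]]) auto
  from ptime_on_pair[OF this L]
  have pair: "ptime_on (algorithm_domain \<nu>) (\<lambda>x. Node (sol (dfst (loop_result sol (?init x)))) (loop_result sol (?init x)))" .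
  have "ptime (\<lambda>z. union_of (dfst (dfst z)) (dsnd (dsnd z)))" by (intro ptime_rules)
  from ptime_on_comp[OF pair this] show ?thesis by (simp add: algorithm_result_def[abs_def])
qed

lemma algorithm_result_correct:
  assumes crsds: "crsds_procedure crSDS" and inj: "inj \<nu>" and sol: "solver \<nu> crSDS sol"
    and G0: "ugraph G0" "connected_graph G0" "f0 \<in> colourings G0" "encodes_instance \<nu> x G0 f0"
  shows "\<exists>R. encodes_set \<nu> (algorithm_result sol x) R \<and> (step crSDS)\<^sup>*\<^sup>* (Loop G0 f0 {}) (Return R)"
proof -
  from loop_result_state[OF assms] obtain G f S where G: "ugraph G" "two_connected G" "f \<in> colourings G"
    "encodes_state \<nu> (loop_result sol (Node x Leaf)) G f S" "(step crSDS)\<^sup>*\<^sup>* (Loop G0 f0 {}) (Loop G f S)"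
    by blast
  obtain I s where I: "loop_result sol (Node x Leaf) = Node I s" "encodes_instance \<nu> I G f" "encodes_set \<nu> s S"
    using G(4) by (auto simp: encodes_state_def)
  obtain y SG n where o: "sol I = Node y (enc_nat n)" "encodes_set \<nu> y SG" "crSDS G f (SG, n)"
    using sol G(1-3) I(2) unfolding solver_def by blast
  have "encodes_set \<nu> (algorithm_result sol x) (SG \<union> S)"
    using encodes_set_union[OF inj o(2) I(3)] by (simp add: algorithm_result_def I(1) o(1))
  moreover have "step crSDS (Loop G f S) (Return (S \<union> SG))" using G(2) o(3) by (rule finish)
  with G(5) have "(step crSDS)\<^sup>*\<^sup>* (Loop G0 f0 {}) (Return (SG \<union> S))"
    by (simp add: Un_commute rtranclp.rtrancl_into_rtrancl)
  ultimately show ?thesis by blast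
qed

theorem theorem10:
  fixes crSDS :: "'v procedure"
  assumes "crsds_procedure crSDS"
  shows "(\<forall>G f. ugraph G \<and> connected_graph G \<and> f \<in> colourings G \<longrightarrow>
            termip (step crSDS) (Loop G f {}) \<and>
            (\<forall>c. (step crSDS)\<^sup>*\<^sup>* (Loop G f {}) c \<and> (\<nexists>c'. step crSDS c c') \<longrightarrow>
               (\<exists>R. c = Return R \<and> minimum_respecting_sds G f R))) \<and>
         (\<forall>\<nu> :: 'v \<Rightarrow> data. inj \<nu> \<longrightarrow>
            procedure_poly_time \<nu> crSDS \<longrightarrow> algorithm_poly_time \<nu> crSDS)"
proof (intro conjI allI impI)
  fix G :: "'v ugraph" and f
  assume "ugraph G \<and> connected_graph G \<and> f \<in> colourings G"
  then have init: "sound_config G f (Loop G f {})" by simp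
  show "termip (step crSDS) (Loop G f {})" by (rule step_terminates[OF assms init])
  fix c assume c: "(step crSDS)\<^sup>*\<^sup>* (Loop G f {}) c \<and> (\<nexists>c'. step crSDS c c')"
  then have "sound_config G f c" using steps_sound[OF assms _ init] by blast
  then show "\<exists>R. c = Return R \<and> minimum_respecting_sds G f R"
  proof (cases c)
    case (Loop G' f' S)
    \<comment> \<open>A sound loop configuration has a successor, so a final one cannot be of this
      form.\<close>
    then show ?thesis using c step_progress[OF assms, of G f G' f' S] \<open>sound_config G f c\<close> by blast
  qed simp
next
  fix \<nu> :: "'v \<Rightarrow> data"
  assume inj: "inj \<nu>" and "procedure_poly_time \<nu> crSDS"
  then obtain sol where sol: "solver \<nu> crSDS sol" using solver_exists by blast
  obtain p and q :: "nat poly" where pq: "\<And>x. x \<in> algorithm_domain \<nu> \<Longrightarrow>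
      \<exists>t. exec p x (algorithm_result sol x) t \<and> t \<le> poly q (size x)"
    using ptime_algorithm_result[OF assms inj sol] unfolding ptime_on_def by blast
  show "algorithm_poly_time \<nu> crSDS"
    unfolding algorithm_poly_time_def
  proof (rule exI[of _ p], rule exI[of _ q], intro allI impI)
    fix G :: "'v ugraph" and f x
    assume G: "ugraph G \<and> connected_graph G \<and> f \<in> colourings G \<and> encodes_instance \<nu> x G f"
    then have "x \<in> algorithm_domain \<nu>" by (auto simp: algorithm_domain_def)
    from pq[OF this] algorithm_result_correct[OF assms inj sol, of G f x] G
    show "\<exists>y R t. exec p x y t \<and> t \<le> poly q (size x) \<and> encodes_set \<nu> y R \<and>
        (step crSDS)\<^sup>*\<^sup>* (Loop G f {}) (Return R)" by blast
  qed
qed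

end
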